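(* $\mathsf{HT}^{\exists\{a\geq 3\}}_2$ with apartness is equivalent to $\mathsf{ACA}_0$ over $\mathsf{RCA}_0$.
   Context: $\mathbb{N}$ denotes the positive integers. $\mathsf{RCA}_0$ and $\mathsf{ACA}_0$ are the standard systems of reverse mathematics. For $m\in\mathbb{N}$, $\lambda(m)$ and $\mu(m)$ are the least and greatest exponents in the binary expansion of $m$; $X\subseteq\mathbb{N}$ is apart if for all $x<x'$ in $X$, $\mu(x)<\lambda(x')$. $\mathsf{HT}^{\exists\{a\geq 3\}}_2$ with apartness: for every $f:\mathbb{N}\to 2$ there exist an infinite apart $H\subseteq\mathbb{N}$ and a number $a\geq 3$ such that $f$ is constant on the set of sums of exactly $a$ distinct elements of $H$. *)

theory Defs
  imports Main
begin

section \<open>The language of second-order arithmetic\<close>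

text \<open>Number variables and set variables are two separate families of de Bruijn indices: number
  quantifiers bind number index 0, set quantifiers bind set index 0, and neither shifts the indices
  of the other sort. Equality is primitive for numbers only.\<close>

datatype tm =
    V nat
  | Zero ("\<^bold>0")
  | One ("\<^bold>1")
  | Add tm tm (infixl "\<^bold>+" 65)
  | Mul tm tm (infixl "\<^bold>*" 70)

datatype fm =
    Eq tm tm (infix "\<^bold>=" 50)
  | Less tm tm (infix "\<^bold><" 50)
  | Mem tm nat (infix "\<^bold>\<in>" 50)
  | Falsum ("\<^bold>\<bottom>")
  | Imp fm fm (infixr "\<^bold>\<longrightarrow>" 25)
  | Forall fm ("\<^bold>\<forall>_" [40] 40)
  | SForall fm ("\<^bold>\<forall>\<^sub>s_" [40] 40)

definition Neg :: "fm \<Rightarrow> fm" ("\<^bold>\<not>_" [40] 40) where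
  "(\<^bold>\<not>\<phi>) = (\<phi> \<^bold>\<longrightarrow> \<^bold>\<bottom>)"

definition Conj :: "fm \<Rightarrow> fm \<Rightarrow> fm" (infixr "\<^bold>\<and>" 35) where
  "(\<phi> \<^bold>\<and> \<psi>) = (\<^bold>\<not>(\<phi> \<^bold>\<longrightarrow> \<^bold>\<not>\<psi>))"

definition Disj :: "fm \<Rightarrow> fm \<Rightarrow> fm" (infixr "\<^bold>\<or>" 30) where
  "(\<phi> \<^bold>\<or> \<psi>) = (\<^bold>\<not>\<phi> \<^bold>\<longrightarrow> \<psi>)"

definition Iff :: "fm \<Rightarrow> fm \<Rightarrow> fm" (infixr "\<^bold>\<longleftrightarrow>" 25) where
  "(\<phi> \<^bold>\<longleftrightarrow> \<psi>) = ((\<phi> \<^bold>\<longrightarrow> \<psi>) \<^bold>\<and> (\<psi> \<^bold>\<longrightarrow> \<phi>))"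

definition Exists :: "fm \<Rightarrow> fm" ("\<^bold>\<exists>_" [40] 40) where
  "(\<^bold>\<exists>\<phi>) = (\<^bold>\<not>\<^bold>\<forall>\<^bold>\<not>\<phi>)"

definition SExists :: "fm \<Rightarrow> fm" ("\<^bold>\<exists>\<^sub>s_" [40] 40) where
  "(\<^bold>\<exists>\<^sub>s\<phi>) = (\<^bold>\<not>\<^bold>\<forall>\<^sub>s\<^bold>\<not>\<phi>)"

primrec subst_tm :: "(nat \<Rightarrow> tm) \<Rightarrow> tm \<Rightarrow> tm" where
  "subst_tm \<sigma> (V n) = \<sigma> n"
| "subst_tm \<sigma> \<^bold>0 = \<^bold>0"
| "subst_tm \<sigma> \<^bold>1 = \<^bold>1"
| "subst_tm \<sigma> (s \<^bold>+ t) = subst_tm \<sigma> s \<^bold>+ subst_tm \<sigma> t"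
| "subst_tm \<sigma> (s \<^bold>* t) = subst_tm \<sigma> s \<^bold>* subst_tm \<sigma> t"

definition lift_tm :: "tm \<Rightarrow> tm" ("\<up>_" [100] 100) where
  "\<up>t = subst_tm (\<lambda>n. V (Suc n)) t"

text \<open>Simultaneous substitution of terms for number variables and set variables for set
  variables.\<close>

primrec subst :: "(nat \<Rightarrow> tm) \<Rightarrow> (nat \<Rightarrow> nat) \<Rightarrow> fm \<Rightarrow> fm" where
  "subst \<sigma> \<rho> (s \<^bold>= t) = (subst_tm \<sigma> s \<^bold>= subst_tm \<sigma> t)"
| "subst \<sigma> \<rho> (s \<^bold>< t) = (subst_tm \<sigma> s \<^bold>< subst_tm \<sigma> t)"
| "subst \<sigma> \<rho> (t \<^bold>\<in> X) = (subst_tm \<sigma> t \<^bold>\<in> \<rho> X)"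
| "subst \<sigma> \<rho> \<^bold>\<bottom> = \<^bold>\<bottom>"
| "subst \<sigma> \<rho> (\<phi> \<^bold>\<longrightarrow> \<psi>) = (subst \<sigma> \<rho> \<phi> \<^bold>\<longrightarrow> subst \<sigma> \<rho> \<psi>)"
| "subst \<sigma> \<rho> (\<^bold>\<forall>\<phi>) = (\<^bold>\<forall>(subst (case_nat (V 0) (\<lambda>n. \<up>(\<sigma> n))) \<rho> \<phi>))"
| "subst \<sigma> \<rho> (\<^bold>\<forall>\<^sub>s\<phi>) = (\<^bold>\<forall>\<^sub>s(subst \<sigma> (case_nat 0 (\<lambda>n. Suc (\<rho> n))) \<phi>))"

definition lift :: "fm \<Rightarrow> fm" where
  "lift \<phi> = subst (\<lambda>n. V (Suc n)) (\<lambda>n. n) \<phi>"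

definition slift :: "fm \<Rightarrow> fm" where
  "slift \<phi> = subst V Suc \<phi>"

definition inst :: "tm \<Rightarrow> fm \<Rightarrow> fm" where
  "inst t \<phi> = subst (case_nat t V) (\<lambda>n. n) \<phi>"

definition sinst :: "nat \<Rightarrow> fm \<Rightarrow> fm" where
  "sinst X \<phi> = subst V (case_nat X (\<lambda>n. n)) \<phi>"

section \<open>Provability\<close>

text \<open>Natural deduction for classical two-sorted first-order logic with equality. Derivations are
  finite, but the set of assumptions may be infinite.\<close>

inductive proves :: "fm set \<Rightarrow> fm \<Rightarrow> bool" (infix "\<turnstile>" 15) where
  Assm: "\<phi> \<in> \<Gamma> \<Longrightarrow> \<Gamma> \<turnstile> \<phi>"
| ImpI: "insert \<phi> \<Gamma> \<turnstile> \<psi> \<Longrightarrow> \<Gamma> \<turnstile> (\<phi> \<^bold>\<longrightarrow> \<psi>)"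
| ImpE: "\<Gamma> \<turnstile> (\<phi> \<^bold>\<longrightarrow> \<psi>) \<Longrightarrow> \<Gamma> \<turnstile> \<phi> \<Longrightarrow> \<Gamma> \<turnstile> \<psi>"
| Contr: "insert (\<^bold>\<not>\<phi>) \<Gamma> \<turnstile> \<^bold>\<bottom> \<Longrightarrow> \<Gamma> \<turnstile> \<phi>"
| AllI: "lift ` \<Gamma> \<turnstile> \<phi> \<Longrightarrow> \<Gamma> \<turnstile> \<^bold>\<forall>\<phi>"
| AllE: "\<Gamma> \<turnstile> \<^bold>\<forall>\<phi> \<Longrightarrow> \<Gamma> \<turnstile> inst t \<phi>"
| SAllI: "slift ` \<Gamma> \<turnstile> \<phi> \<Longrightarrow> \<Gamma> \<turnstile> \<^bold>\<forall>\<^sub>s\<phi>"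
| SAllE: "\<Gamma> \<turnstile> \<^bold>\<forall>\<^sub>s\<phi> \<Longrightarrow> \<Gamma> \<turnstile> sinst X \<phi>"
| EqRefl: "\<Gamma> \<turnstile> (t \<^bold>= t)"
| EqSubst: "\<Gamma> \<turnstile> (s \<^bold>= t) \<Longrightarrow> \<Gamma> \<turnstile> inst s \<phi> \<Longrightarrow> \<Gamma> \<turnstile> inst t \<phi>"

definition equivalent_over :: "fm set \<Rightarrow> fm set \<Rightarrow> fm set \<Rightarrow> bool" where
  "equivalent_over T S S' \<longleftrightarrow>
     (\<forall>\<phi>\<in>S'. T \<union> S \<turnstile> \<phi>) \<and> (\<forall>\<phi>\<in>S. T \<union> S' \<turnstile> \<phi>)"

section \<open>Formula classes and universal closure\<close>

text \<open>The number and set indices occurring free are below k and l, respectively.\<close>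

primrec free_below_tm :: "nat \<Rightarrow> tm \<Rightarrow> bool" where
  "free_below_tm k (V n) \<longleftrightarrow> n < k"
| "free_below_tm k \<^bold>0 \<longleftrightarrow> True"
| "free_below_tm k \<^bold>1 \<longleftrightarrow> True"
| "free_below_tm k (s \<^bold>+ t) \<longleftrightarrow> free_below_tm k s \<and> free_below_tm k t"
| "free_below_tm k (s \<^bold>* t) \<longleftrightarrow> free_below_tm k s \<and> free_below_tm k t"

primrec free_below :: "nat \<Rightarrow> nat \<Rightarrow> fm \<Rightarrow> bool" where
  "free_below k l (s \<^bold>= t) \<longleftrightarrow> free_below_tm k s \<and> free_below_tm k t"
| "free_below k l (s \<^bold>< t) \<longleftrightarrow> free_below_tm k s \<and> free_below_tm k t"
| "free_below k l (t \<^bold>\<in> X) \<longleftrightarrow> free_below_tm k t \<and> X < l"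
| "free_below k l \<^bold>\<bottom> \<longleftrightarrow> True"
| "free_below k l (\<phi> \<^bold>\<longrightarrow> \<psi>) \<longleftrightarrow> free_below k l \<phi> \<and> free_below k l \<psi>"
| "free_below k l (\<^bold>\<forall>\<phi>) \<longleftrightarrow> free_below (Suc k) l \<phi>"
| "free_below k l (\<^bold>\<forall>\<^sub>s\<phi>) \<longleftrightarrow> free_below k (Suc l) \<phi>"

definition closures :: "fm set \<Rightarrow> fm set" where
  "closures S = {(SForall ^^ l) ((Forall ^^ k) \<phi>) | \<phi> k l. \<phi> \<in> S \<and> free_below k l \<phi>}"

text \<open>Lifting the bound t expresses that the quantified variable does not occur in it.\<close>

inductive_set Delta0 :: "fm set" where
  "(s \<^bold>= t) \<in> Delta0"
| "(s \<^bold>< t) \<in> Delta0"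
| "(t \<^bold>\<in> X) \<in> Delta0"
| "\<^bold>\<bottom> \<in> Delta0"
| "\<phi> \<in> Delta0 \<Longrightarrow> \<psi> \<in> Delta0 \<Longrightarrow> (\<phi> \<^bold>\<longrightarrow> \<psi>) \<in> Delta0"
| "\<phi> \<in> Delta0 \<Longrightarrow> (\<^bold>\<forall>(V 0 \<^bold>< \<up>t \<^bold>\<longrightarrow> \<phi>)) \<in> Delta0"
| "\<phi> \<in> Delta0 \<Longrightarrow> (\<^bold>\<exists>(V 0 \<^bold>< \<up>t \<^bold>\<and> \<phi>)) \<in> Delta0"

definition Sigma1 :: "fm set" where
  "Sigma1 = {\<^bold>\<exists>\<theta> | \<theta>. \<theta> \<in> Delta0}"

definition Pi1 :: "fm set" where
  "Pi1 = {\<^bold>\<forall>\<theta> | \<theta>. \<theta> \<in> Delta0}"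

primrec arithmetical :: "fm \<Rightarrow> bool" where
  "arithmetical (s \<^bold>= t) \<longleftrightarrow> True"
| "arithmetical (s \<^bold>< t) \<longleftrightarrow> True"
| "arithmetical (t \<^bold>\<in> X) \<longleftrightarrow> True"
| "arithmetical \<^bold>\<bottom> \<longleftrightarrow> True"
| "arithmetical (\<phi> \<^bold>\<longrightarrow> \<psi>) \<longleftrightarrow> arithmetical \<phi> \<and> arithmetical \<psi>"
| "arithmetical (\<^bold>\<forall>\<phi>) \<longleftrightarrow> arithmetical \<phi>"
| "arithmetical (\<^bold>\<forall>\<^sub>s\<phi>) \<longleftrightarrow> False"

section \<open>The systems\<close>

definition basic_axioms :: "fm set" where
  "basic_axioms =
    {\<^bold>\<not>(V 0 \<^bold>+ \<^bold>1 \<^bold>= \<^bold>0),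
     V 0 \<^bold>+ \<^bold>1 \<^bold>= V 1 \<^bold>+ \<^bold>1 \<^bold>\<longrightarrow> V 0 \<^bold>= V 1,
     V 0 \<^bold>+ \<^bold>0 \<^bold>= V 0,
     V 0 \<^bold>+ (V 1 \<^bold>+ \<^bold>1) \<^bold>= (V 0 \<^bold>+ V 1) \<^bold>+ \<^bold>1,
     V 0 \<^bold>* \<^bold>0 \<^bold>= \<^bold>0,
     V 0 \<^bold>* (V 1 \<^bold>+ \<^bold>1) \<^bold>= (V 0 \<^bold>* V 1) \<^bold>+ V 0,
     \<^bold>\<not>(V 0 \<^bold>< \<^bold>0),
     V 0 \<^bold>< V 1 \<^bold>+ \<^bold>1 \<^bold>\<longleftrightarrow> (V 0 \<^bold>< V 1 \<^bold>\<or> V 0 \<^bold>= V 1)}"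

definition induction_for :: "fm \<Rightarrow> fm" where
  "induction_for \<phi> =
    (inst \<^bold>0 \<phi> \<^bold>\<and> (\<^bold>\<forall>(\<phi> \<^bold>\<longrightarrow> subst (case_nat (V 0 \<^bold>+ \<^bold>1) (\<lambda>n. V (Suc n))) (\<lambda>n. n) \<phi>)) \<^bold>\<longrightarrow> \<^bold>\<forall>\<phi>)"

text \<open>Lifting the set indices expresses that the set being defined is not a parameter of the
  defining formula.\<close>

definition comprehension_for :: "fm \<Rightarrow> fm" where
  "comprehension_for \<phi> = (\<^bold>\<exists>\<^sub>s\<^bold>\<forall>(V 0 \<^bold>\<in> 0 \<^bold>\<longleftrightarrow> slift \<phi>))"

definition RCA0 :: "fm set" where
  "RCA0 = closures (basic_axioms
     \<union> {induction_for \<phi> | \<phi>. \<phi> \<in> Sigma1}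
     \<union> {(\<^bold>\<forall>(\<phi> \<^bold>\<longleftrightarrow> \<psi>)) \<^bold>\<longrightarrow> comprehension_for \<phi> | \<phi> \<psi>. \<phi> \<in> Sigma1 \<and> \<psi> \<in> Pi1})"

definition ACA0 :: "fm set" where
  "ACA0 = closures (basic_axioms
     \<union> {induction_for (V 0 \<^bold>\<in> 0)}
     \<union> {comprehension_for \<phi> | \<phi>. arithmetical \<phi>})"

section \<open>The Hindman-type principle\<close>

definition Le :: "tm \<Rightarrow> tm \<Rightarrow> fm" (infix "\<^bold>\<le>" 50) where
  "(s \<^bold>\<le> t) = (s \<^bold>< t \<^bold>\<or> s \<^bold>= t)"

definition pair_code :: "tm \<Rightarrow> tm \<Rightarrow> tm" where
  "pair_code s t = (s \<^bold>+ t) \<^bold>* (s \<^bold>+ t) \<^bold>+ s"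

text \<open>As a set of coded pairs, F takes the value t at s.\<close>

definition Val :: "nat \<Rightarrow> tm \<Rightarrow> tm \<Rightarrow> fm" where
  "Val F s t = (pair_code s t \<^bold>\<in> F)"

text \<open>F is a function from the numbers satisfying D to the numbers satisfying R.\<close>

definition Fun :: "nat \<Rightarrow> (tm \<Rightarrow> fm) \<Rightarrow> (tm \<Rightarrow> fm) \<Rightarrow> fm" where
  "Fun F D R =
    ((\<^bold>\<forall>(V 0 \<^bold>\<in> F \<^bold>\<longrightarrow> \<^bold>\<exists>\<^bold>\<exists>(V 2 \<^bold>= pair_code (V 1) (V 0) \<^bold>\<and> D (V 1) \<^bold>\<and> R (V 0)))) \<^bold>\<and>
     (\<^bold>\<forall>(D (V 0) \<^bold>\<longrightarrow> \<^bold>\<exists>(Val F (V 1) (V 0) \<^bold>\<and> \<^bold>\<forall>(Val F (V 2) (V 0) \<^bold>\<longrightarrow> V 0 \<^bold>= V 1)))))"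

abbreviation "NN \<equiv> (\<lambda>t. t \<^bold>= t)"

abbreviation "positive \<equiv> (\<lambda>t. \<^bold>0 \<^bold>< t)"

abbreviation "two \<equiv> \<^bold>1 \<^bold>+ \<^bold>1"

abbreviation "three \<equiv> two \<^bold>+ \<^bold>1"

text \<open>p is the i-th power of two, as given by the primitive recursion defining the powers.\<close>

definition Pow2 :: "tm \<Rightarrow> tm \<Rightarrow> fm" where
  "Pow2 i p = (\<^bold>\<exists>\<^sub>s(Fun 0 NN NN \<^bold>\<and> Val 0 \<^bold>0 \<^bold>1 \<^bold>\<and>
     (\<^bold>\<forall>\<^bold>\<forall>(Val 0 (V 1) (V 0) \<^bold>\<longrightarrow> Val 0 (V 1 \<^bold>+ \<^bold>1) (two \<^bold>* V 0))) \<^bold>\<and> Val 0 i p))"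

text \<open>The exponent i occurs in the binary expansion of m.\<close>

definition Exponent :: "tm \<Rightarrow> tm \<Rightarrow> fm" where
  "Exponent i m = (\<^bold>\<exists>\<^bold>\<exists>\<^bold>\<exists>(Pow2 (\<up>\<up>\<up>i) (V 2) \<^bold>\<and>
     \<up>\<up>\<up>m \<^bold>= V 2 \<^bold>* (two \<^bold>* V 1 \<^bold>+ \<^bold>1) \<^bold>+ V 0 \<^bold>\<and> V 0 \<^bold>< V 2))"

definition Lambda :: "tm \<Rightarrow> tm \<Rightarrow> fm" where
  "Lambda m i = (Exponent i m \<^bold>\<and> \<^bold>\<forall>(Exponent (V 0) (\<up>m) \<^bold>\<longrightarrow> \<up>i \<^bold>\<le> V 0))"

definition Mu :: "tm \<Rightarrow> tm \<Rightarrow> fm" where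
  "Mu m i = (Exponent i m \<^bold>\<and> \<^bold>\<forall>(Exponent (V 0) (\<up>m) \<^bold>\<longrightarrow> V 0 \<^bold>\<le> \<up>i))"

definition Apart :: "nat \<Rightarrow> fm" where
  "Apart X = (\<^bold>\<forall>\<^bold>\<forall>(V 1 \<^bold>\<in> X \<^bold>\<and> V 0 \<^bold>\<in> X \<^bold>\<and> V 1 \<^bold>< V 0 \<^bold>\<longrightarrow>
     \<^bold>\<exists>\<^bold>\<exists>(Mu (V 3) (V 1) \<^bold>\<and> Lambda (V 2) (V 0) \<^bold>\<and> V 1 \<^bold>< V 0)))"

definition Infinite :: "nat \<Rightarrow> fm" where
  "Infinite X = (\<^bold>\<forall>\<^bold>\<exists>(V 0 \<^bold>\<in> X \<^bold>\<and> V 1 \<^bold>< V 0))"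

text \<open>Set variable 1 is a sequence whose first a entries are pairwise distinct elements of H, and
  set variable 0 is the sequence of its partial sums, with x at place a.\<close>

definition Sum :: "nat \<Rightarrow> tm \<Rightarrow> tm \<Rightarrow> fm" where
  "Sum H a x = (\<^bold>\<exists>\<^sub>s\<^bold>\<exists>\<^sub>s(Fun 1 NN NN \<^bold>\<and> Fun 0 NN NN \<^bold>\<and>
     (\<^bold>\<forall>\<^bold>\<forall>(V 1 \<^bold>< \<up>\<up>a \<^bold>\<and> Val 1 (V 1) (V 0) \<^bold>\<longrightarrow> V 0 \<^bold>\<in> H + 2)) \<^bold>\<and>
     (\<^bold>\<forall>\<^bold>\<forall>\<^bold>\<forall>(V 2 \<^bold>< \<up>\<up>\<up>a \<^bold>\<and> V 1 \<^bold>< \<up>\<up>\<up>a \<^bold>\<and> Val 1 (V 2) (V 0) \<^bold>\<and> Val 1 (V 1) (V 0) \<^bold>\<longrightarrow> V 2 \<^bold>= V 1)) \<^bold>\<and>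
     Val 0 \<^bold>0 \<^bold>0 \<^bold>\<and>
     (\<^bold>\<forall>\<^bold>\<forall>\<^bold>\<forall>(V 2 \<^bold>< \<up>\<up>\<up>a \<^bold>\<and> Val 0 (V 2) (V 1) \<^bold>\<and> Val 1 (V 2) (V 0) \<^bold>\<longrightarrow> Val 0 (V 2 \<^bold>+ \<^bold>1) (V 1 \<^bold>+ V 0))) \<^bold>\<and>
     Val 0 a x))"

text \<open>The colouring f is set variable 0 outside and 1 inside the quantifier introducing H. The last
  three number quantifiers introduce a, the colour, and the sum.\<close>

definition HT_ex_ge3_apart :: fm where
  "HT_ex_ge3_apart = (\<^bold>\<forall>\<^sub>s(Fun 0 positive (\<lambda>t. t \<^bold>< two) \<^bold>\<longrightarrow>
     \<^bold>\<exists>\<^sub>s((\<^bold>\<forall>(V 0 \<^bold>\<in> 0 \<^bold>\<longrightarrow> positive (V 0))) \<^bold>\<and> Infinite 0 \<^bold>\<and> Apart 0 \<^bold>\<and>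
       \<^bold>\<exists>(three \<^bold>\<le> V 0 \<^bold>\<and>
         \<^bold>\<exists>(V 0 \<^bold>< two \<^bold>\<and> \<^bold>\<forall>(Sum 0 (V 2) (V 0) \<^bold>\<longrightarrow> Val 1 (V 0) (V 1)))))))"

end

theory Submission
  imports Defs "HOL-Library.Countable_Set"
begin

text \<open>By the completeness theorem it suffices to show that every model of RCA0 satisfies either both or
  none of the two principles.

  For the direction to ACA0, let E be an enumerable set and \<open>E\<^sub>v\<close> its part enumerated before stage v.
  Call a gap between consecutive binary digits of x important for p if a number below p is enumerated
  in it, and colour x by the parity of the number of its gaps that are important for p, where p is the
  least power of two in x. Given H and a, let z be a sum of a - 1 elements of H and let h be a larger
  element of H. If no number below p is enumerated between z and z + h, then z + h has the colour
  parity of z; for h beyond the last enumeration of a number below p, it has that parity changed by one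
  if a number below p is enumerated after z. As the colours agree, nothing below p is enumerated after
  z in the first case. Such pairs z, h exist for arbitrarily large p because a is at least 3: all but
  the first summand can be chosen late. Hence E is decidable from H.

  For the converse take a = 3 and apply Ramsey's theorem for triples to the powers of two: pass twice
  to a set on which the colour has a limit in its last argument, and then choose greedily.\<close>

section \<open>Substitution and provability\<close>

text \<open>The direction to ACA0 takes place in an arbitrary model of RCA0, where only Sigma1
  induction is at hand and \<open>a\<close> and \<open>p\<close> may be nonstandard. Hence the sum
  of \<open>a - 1\<close> elements is produced by a recursion inside the model, and a stage after
  the last enumeration of a number below \<open>p\<close> comes from strong Sigma1 bounding. The
  least power \<open>p\<close> enters the colouring because a sum of apart elements has the same
  \<open>p\<close> as its smallest summand: the first summand fixes which numbers \<open>z\<close>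
  decides, and the next one, present because \<open>a - 1\<close> is at least 2, can be moved past
  any stage without changing \<open>p\<close>. The condition on a pair \<open>z\<close>,
  \<open>h\<close> only says that nothing happens between \<open>z\<close> and \<open>z + h\<close>,
  so it is decidable; homogeneity turns it into a statement about all later stages, and a search for
  such a pair decides E. To make arithmetic in a model usable, a hypothetical countermodel on a
  fixed countable domain becomes the interpretation of a type class, so that algebra and order
  reasoning for ordered semirings applies to it.\<close>

definition shift_subst :: "(nat \<Rightarrow> tm) \<Rightarrow> nat \<Rightarrow> tm" where
  "shift_subst \<sigma> = case_nat (V 0) (\<lambda>n. \<up>(\<sigma> n))"

definition shift_ren :: "(nat \<Rightarrow> nat) \<Rightarrow> nat \<Rightarrow> nat" where
  "shift_ren \<rho> = case_nat 0 (\<lambda>n. Suc (\<rho> n))"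

lemma shift_subst_simps [simp]: "shift_subst \<sigma> 0 = V 0" "shift_subst \<sigma> (Suc n) = \<up>(\<sigma> n)"
  by (simp_all add: shift_subst_def)

lemma shift_ren_simps [simp]: "shift_ren \<rho> 0 = 0" "shift_ren \<rho> (Suc n) = Suc (\<rho> n)"
  by (simp_all add: shift_ren_def)

text \<open>From here on the binder clauses use named shifts instead of raw \<open>case_nat\<close>
  terms, so that the composition laws below act as rewrite rules.\<close>

lemma subst_Forall [simp]: "subst \<sigma> \<rho> (\<^bold>\<forall>\<phi>) = (\<^bold>\<forall>(subst (shift_subst \<sigma>) \<rho> \<phi>))"
  by (simp add: shift_subst_def)

lemma subst_SForall [simp]: "subst \<sigma> \<rho> (\<^bold>\<forall>\<^sub>s\<phi>) = (\<^bold>\<forall>\<^sub>s(subst \<sigma> (shift_ren \<rho>) \<phi>))"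
  by (simp add: shift_ren_def)

declare subst.simps(6,7) [simp del]

lemma subst_tm_subst_tm: "subst_tm \<sigma> (subst_tm \<tau> t) = subst_tm (\<lambda>n. subst_tm \<sigma> (\<tau> n)) t"
  by (induction t) simp_all

lemma shift_subst_comp:
  "(\<lambda>n. subst_tm (shift_subst \<sigma>) (shift_subst \<tau> n)) = shift_subst (\<lambda>n. subst_tm \<sigma> (\<tau> n))"
proof
  fix n show "subst_tm (shift_subst \<sigma>) (shift_subst \<tau> n) = shift_subst (\<lambda>n. subst_tm \<sigma> (\<tau> n)) n"
    by (cases n) (simp_all add: lift_tm_def subst_tm_subst_tm)
qed

lemma shift_ren_comp: "(\<lambda>n. shift_ren \<rho> (shift_ren \<rho>' n)) = shift_ren (\<lambda>n. \<rho> (\<rho>' n))"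
proof
  fix n show "shift_ren \<rho> (shift_ren \<rho>' n) = shift_ren (\<lambda>n. \<rho> (\<rho>' n)) n"
    by (cases n) simp_all
qed

lemma subst_subst:
  "subst \<sigma> \<rho> (subst \<tau> \<rho>' \<phi>) = subst (\<lambda>n. subst_tm \<sigma> (\<tau> n)) (\<lambda>n. \<rho> (\<rho>' n)) \<phi>"
  by (induction \<phi> arbitrary: \<sigma> \<rho> \<tau> \<rho>')
    (simp_all add: subst_tm_subst_tm shift_subst_comp shift_ren_comp)

lemma subst_tm_V [simp]: "subst_tm V t = t"
  by (induction t) simp_all

lemma shift_subst_V [simp]: "shift_subst V = V"
  by (rule ext) (simp add: shift_subst_def lift_tm_def split: nat.split)

lemma shift_ren_id [simp]: "shift_ren (\<lambda>n. n) = (\<lambda>n. n)"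
  by (rule ext) (simp add: shift_ren_def split: nat.split)

lemma subst_id [simp]: "subst V (\<lambda>n. n) \<phi> = \<phi>"
  by (induction \<phi>) simp_all

lemma subst_tm_cong:
  "free_below_tm k t \<Longrightarrow> (\<And>n. n < k \<Longrightarrow> \<sigma> n = \<sigma>' n) \<Longrightarrow> subst_tm \<sigma> t = subst_tm \<sigma>' t"
  by (induction t) auto

lemma subst_cong:
  assumes "free_below k l \<phi>" "\<And>n. n < k \<Longrightarrow> \<sigma> n = \<sigma>' n" "\<And>n. n < l \<Longrightarrow> \<rho> n = \<rho>' n"
  shows "subst \<sigma> \<rho> \<phi> = subst \<sigma>' \<rho>' \<phi>"
  using assms
proof (induction \<phi> arbitrary: k l \<sigma> \<sigma>' \<rho> \<rho>')
  case (Forall \<phi>)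
  show ?case using Forall.prems
    by (auto intro!: Forall.IH[of "Suc k" l] simp: shift_subst_def split: nat.split)
next
  case (SForall \<phi>)
  show ?case using SForall.prems
    by (auto intro!: SForall.IH[of k "Suc l"] simp: shift_ren_def split: nat.split)
next
  case (Imp \<phi> \<psi>)
  then show ?case by simp blast
qed (auto intro: subst_tm_cong)

lemma free_below_tm_mono: "free_below_tm k t \<Longrightarrow> k \<le> k' \<Longrightarrow> free_below_tm k' t"
  by (induction t) auto

lemma free_below_mono: "free_below k l \<phi> \<Longrightarrow> k \<le> k' \<Longrightarrow> l \<le> l' \<Longrightarrow> free_below k' l' \<phi>"
proof (induction \<phi> arbitrary: k l k' l')
  case (Forall \<phi>)
  then show ?case by (metis free_below.simps(6) Suc_le_mono)
next
  case (SForall \<phi>)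
  then show ?case by (metis free_below.simps(7) Suc_le_mono)
qed (auto intro: free_below_tm_mono)

lemma free_below_tm_exists: "\<exists>k. free_below_tm k t"
proof (induction t)
  case (Add s t)
  then obtain i j where "free_below_tm i s" "free_below_tm j t" by auto
  then have "free_below_tm (max i j) (s \<^bold>+ t)" by (auto intro: free_below_tm_mono)
  then show ?case ..
next
  case (Mul s t)
  then obtain i j where "free_below_tm i s" "free_below_tm j t" by auto
  then have "free_below_tm (max i j) (s \<^bold>* t)" by (auto intro: free_below_tm_mono)
  then show ?case ..
qed auto

lemma free_below_exists: "\<exists>k. free_below k k \<phi>"
proof (induction \<phi>)
  case (Eq s t)
  obtain i where "free_below_tm i (s \<^bold>+ t)" using free_below_tm_exists by blast
  then show ?case by auto
next
  case (Less s t)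
  obtain i where "free_below_tm i (s \<^bold>+ t)" using free_below_tm_exists by blast
  then show ?case by auto
next
  case (Mem t X)
  obtain i where "free_below_tm i t" using free_below_tm_exists by blast
  then have "free_below (max i (Suc X)) (max i (Suc X)) (t \<^bold>\<in> X)"
    by (auto intro: free_below_tm_mono)
  then show ?case ..
next
  case (Imp \<phi> \<psi>)
  then obtain i j where "free_below i i \<phi>" "free_below j j \<psi>" by auto
  then have "free_below (max i j) (max i j) (\<phi> \<^bold>\<longrightarrow> \<psi>)" by (auto intro: free_below_mono)
  then show ?case ..
next
  case (Forall \<phi>)
  then obtain i where "free_below i i \<phi>" by auto
  then have "free_below i i (\<^bold>\<forall>\<phi>)" by (auto intro: free_below_mono)
  then show ?case ..
next
  case (SForall \<phi>)
  then obtain i where "free_below i i \<phi>" by auto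
  then have "free_below i i (\<^bold>\<forall>\<^sub>s\<phi>)" by (auto intro: free_below_mono)
  then show ?case ..
qed simp

lemma free_below_tm_subst:
  "free_below_tm k t \<Longrightarrow> (\<And>n. n < k \<Longrightarrow> free_below_tm k' (\<sigma> n)) \<Longrightarrow> free_below_tm k' (subst_tm \<sigma> t)"
  by (induction t) auto

lemma free_below_tm_lift [simp]: "free_below_tm k t \<Longrightarrow> free_below_tm (Suc k) (\<up>t)"
  unfolding lift_tm_def by (rule free_below_tm_subst) auto

lemma free_below_subst:
  assumes "free_below k l \<phi>" "\<And>n. n < k \<Longrightarrow> free_below_tm k' (\<sigma> n)" "\<And>n. n < l \<Longrightarrow> \<rho> n < l'"
  shows "free_below k' l' (subst \<sigma> \<rho> \<phi>)"
  using assms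
proof (induction \<phi> arbitrary: k l k' l' \<sigma> \<rho>)
  case (Forall \<phi>)
  show ?case using Forall.prems
    by (auto intro!: Forall.IH[of "Suc k" l] simp: shift_subst_def split: nat.split)
next
  case (SForall \<phi>)
  show ?case using SForall.prems
    by (auto intro!: SForall.IH[of k "Suc l"] simp: shift_ren_def split: nat.split)
next
  case (Imp \<phi> \<psi>)
  then show ?case by simp blast
qed (auto intro: free_below_tm_subst)

lemma free_below_closures: "\<phi> \<in> closures T \<Longrightarrow> free_below 0 0 \<phi>"
proof -
  have num: "free_below (k + n) l \<psi> \<Longrightarrow> free_below n l ((Forall ^^ k) \<psi>)" for k n l \<psi>
    by (induction k arbitrary: n) (auto simp: add.commute)
  have set: "free_below k (l + n) \<psi> \<Longrightarrow> free_below k n ((SForall ^^ l) \<psi>)" for k n l \<psi>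
    by (induction l arbitrary: n) (auto simp: add.commute)
  show "\<phi> \<in> closures T \<Longrightarrow> free_below 0 0 \<phi>"
    unfolding closures_def using num[of _ 0] set[of 0 _ 0] by auto
qed

lemma weakening: "\<Gamma> \<turnstile> \<phi> \<Longrightarrow> \<Gamma> \<subseteq> \<Delta> \<Longrightarrow> \<Delta> \<turnstile> \<phi>"
proof (induction arbitrary: \<Delta> rule: proves.induct)
  case (ImpI \<phi> \<Gamma> \<psi>)
  then show ?case by (meson insert_mono proves.ImpI)
next
  case (Contr \<phi> \<Gamma>)
  then show ?case by (meson insert_mono proves.Contr)
next
  case (AllI \<Gamma> \<phi>)
  then show ?case by (meson image_mono proves.AllI)
next
  case (SAllI \<Gamma> \<phi>)
  then show ?case by (meson image_mono proves.SAllI)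
qed (blast intro: proves.intros)+

lemma subst_lift: "subst (shift_subst \<sigma>) \<rho> (lift \<phi>) = lift (subst \<sigma> \<rho> \<phi>)"
  by (simp add: lift_def subst_subst) (simp add: lift_tm_def)

lemma subst_slift: "subst \<sigma> (shift_ren \<rho>) (slift \<phi>) = slift (subst \<sigma> \<rho> \<phi>)"
  by (simp add: slift_def subst_subst)

lemma subst_inst: "subst \<sigma> \<rho> (inst t \<phi>) = inst (subst_tm \<sigma> t) (subst (shift_subst \<sigma>) \<rho> \<phi>)"
proof -
  have "subst_tm \<sigma> (case_nat t V n) = subst_tm (case_nat (subst_tm \<sigma> t) V) (shift_subst \<sigma> n)" for n
    by (cases n) (simp_all add: lift_tm_def subst_tm_subst_tm)
  then show ?thesis by (simp add: inst_def subst_subst)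
qed

lemma subst_sinst: "subst \<sigma> \<rho> (sinst X \<phi>) = sinst (\<rho> X) (subst \<sigma> (shift_ren \<rho>) \<phi>)"
proof -
  have "\<rho> (case_nat X (\<lambda>n. n) n) = case_nat (\<rho> X) (\<lambda>n. n) (shift_ren \<rho> n)" for n
    by (cases n) simp_all
  then show ?thesis by (simp add: sinst_def subst_subst)
qed

lemma subst_Neg [simp]: "subst \<sigma> \<rho> (\<^bold>\<not>\<phi>) = (\<^bold>\<not>(subst \<sigma> \<rho> \<phi>))"
  by (simp add: Neg_def)

text \<open>This takes the place of side conditions on fresh variables: a witness variable is
  renamed to index 0, after which \<open>AllI\<close> or \<open>SAllI\<close> applies.\<close>

lemma proves_subst: "\<Gamma> \<turnstile> \<phi> \<Longrightarrow> subst \<sigma> \<rho> ` \<Gamma> \<turnstile> subst \<sigma> \<rho> \<phi>"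
proof (induction arbitrary: \<sigma> \<rho> rule: proves.induct)
  case (Assm \<phi> \<Gamma>)
  then show ?case by (simp add: proves.Assm)
next
  case (ImpI \<phi> \<Gamma> \<psi>)
  then show ?case by (simp add: proves.ImpI)
next
  case (ImpE \<Gamma> \<phi> \<psi>)
  then show ?case by (metis proves.ImpE subst.simps(5))
next
  case (Contr \<phi> \<Gamma>)
  have "subst \<sigma> \<rho> ` insert (\<^bold>\<not>\<phi>) \<Gamma> \<turnstile> \<^bold>\<bottom>" using Contr.IH[of \<sigma> \<rho>] by simp
  then show ?case by (simp add: proves.Contr)
next
  case (AllI \<Gamma> \<phi>)
  have "subst (shift_subst \<sigma>) \<rho> ` lift ` \<Gamma> = lift ` subst \<sigma> \<rho> ` \<Gamma>"
    by (simp add: image_image subst_lift)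
  then show ?case using AllI.IH[of "shift_subst \<sigma>" \<rho>] by (simp add: proves.AllI)
next
  case (AllE \<Gamma> \<phi> t)
  then show ?case by (simp add: subst_inst proves.AllE)
next
  case (SAllI \<Gamma> \<phi>)
  have "subst \<sigma> (shift_ren \<rho>) ` slift ` \<Gamma> = slift ` subst \<sigma> \<rho> ` \<Gamma>"
    by (simp add: image_image subst_slift)
  then show ?case using SAllI.IH[of \<sigma> "shift_ren \<rho>"] by (simp add: proves.SAllI)
next
  case (SAllE \<Gamma> \<phi> X)
  then show ?case by (simp add: subst_sinst proves.SAllE)
next
  case (EqRefl \<Gamma> t)
  then show ?case by (simp add: proves.EqRefl)
next
  case (EqSubst \<Gamma> s t \<phi>)
  have "subst \<sigma> \<rho> ` \<Gamma> \<turnstile> (subst_tm \<sigma> s \<^bold>= subst_tm \<sigma> t)" using EqSubst.IH(1)[of \<sigma> \<rho>] by simp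
  then show ?case using EqSubst.IH(2)[of \<sigma> \<rho>] unfolding subst_inst by (rule proves.EqSubst)
qed

lemma compactness: "\<Gamma> \<turnstile> \<phi> \<Longrightarrow> \<exists>\<Delta>. finite \<Delta> \<and> \<Delta> \<subseteq> \<Gamma> \<and> (\<Delta> \<turnstile> \<phi>)"
proof (induction rule: proves.induct)
  case (Assm \<phi> \<Gamma>)
  then show ?case by (intro exI[of _ "{\<phi>}"]) (simp add: proves.Assm)
next
  case (ImpI \<phi> \<Gamma> \<psi>)
  then obtain \<Delta> where "finite \<Delta>" "\<Delta> \<subseteq> insert \<phi> \<Gamma>" "\<Delta> \<turnstile> \<psi>" by blast
  moreover from this have "\<Delta> - {\<phi>} \<turnstile> (\<phi> \<^bold>\<longrightarrow> \<psi>)" by (auto intro!: proves.ImpI elim: weakening)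
  ultimately show ?case by (intro exI[of _ "\<Delta> - {\<phi>}"]) auto
next
  case (ImpE \<Gamma> \<phi> \<psi>)
  then obtain \<Delta> \<Delta>' where "finite \<Delta>" "\<Delta> \<subseteq> \<Gamma>" "\<Delta> \<turnstile> (\<phi> \<^bold>\<longrightarrow> \<psi>)" "finite \<Delta>'" "\<Delta>' \<subseteq> \<Gamma>" "\<Delta>' \<turnstile> \<phi>"
    by blast
  moreover from this have "\<Delta> \<union> \<Delta>' \<turnstile> \<psi>" by (meson Un_upper1 Un_upper2 proves.ImpE weakening)
  ultimately show ?case by (intro exI[of _ "\<Delta> \<union> \<Delta>'"]) auto
next
  case (Contr \<phi> \<Gamma>)
  then obtain \<Delta> where "finite \<Delta>" "\<Delta> \<subseteq> insert (\<^bold>\<not>\<phi>) \<Gamma>" "\<Delta> \<turnstile> \<^bold>\<bottom>" by blast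
  moreover from this have "insert (\<^bold>\<not>\<phi>) (\<Delta> - {\<^bold>\<not>\<phi>}) \<turnstile> \<^bold>\<bottom>" by (auto elim: weakening)
  then have "\<Delta> - {\<^bold>\<not>\<phi>} \<turnstile> \<phi>" by (rule proves.Contr)
  ultimately show ?case by (intro exI[of _ "\<Delta> - {\<^bold>\<not>\<phi>}"]) auto
next
  case (AllI \<Gamma> \<phi>)
  then obtain \<Delta> where "finite \<Delta>" "\<Delta> \<subseteq> lift ` \<Gamma>" "\<Delta> \<turnstile> \<phi>" by blast
  then show ?case by (metis finite_subset_image proves.AllI)
next
  case (SAllI \<Gamma> \<phi>)
  then obtain \<Delta> where "finite \<Delta>" "\<Delta> \<subseteq> slift ` \<Gamma>" "\<Delta> \<turnstile> \<phi>" by blast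
  then show ?case by (metis finite_subset_image proves.SAllI)
next
  case (EqSubst \<Gamma> s t \<phi>)
  then obtain \<Delta> \<Delta>' where "finite \<Delta>" "\<Delta> \<subseteq> \<Gamma>" "\<Delta> \<turnstile> (s \<^bold>= t)" "finite \<Delta>'" "\<Delta>' \<subseteq> \<Gamma>" "\<Delta>' \<turnstile> inst s \<phi>"
    by blast
  moreover from this have "\<Delta> \<union> \<Delta>' \<turnstile> inst t \<phi>" by (meson Un_upper1 Un_upper2 proves.EqSubst weakening)
  ultimately show ?case by (intro exI[of _ "\<Delta> \<union> \<Delta>'"]) auto
next
  case (AllE \<Gamma> \<phi> t)
  then show ?case by (meson proves.AllE)
next
  case (SAllE \<Gamma> \<phi> X)
  then show ?case by (meson proves.SAllE)
next
  case (EqRefl \<Gamma> t)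
  show ?case by (intro exI[of _ "{}"]) (simp add: proves.EqRefl)
qed

section \<open>Consistency and Henkin witnesses\<close>

definition consistent :: "fm set \<Rightarrow> bool" where
  "consistent \<Gamma> \<longleftrightarrow> \<not> (\<Gamma> \<turnstile> \<^bold>\<bottom>)"

lemma falsum_elim: "\<Gamma> \<turnstile> \<^bold>\<bottom> \<Longrightarrow> \<Gamma> \<turnstile> \<phi>"
  by (rule Contr) (rule weakening, auto)

text \<open>Meant for witness axioms: if adding one were inconsistent, the instance at the fresh
  variable would be provable and the universal formula refutable.\<close>

lemma deduct_neg_imp:
  assumes "insert (\<phi> \<^bold>\<longrightarrow> \<psi>) \<Gamma> \<turnstile> \<^bold>\<bottom>"
  shows "\<Gamma> \<turnstile> \<phi>" "\<Gamma> \<turnstile> \<^bold>\<not>\<psi>"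
proof -
  have n: "\<Gamma> \<turnstile> ((\<phi> \<^bold>\<longrightarrow> \<psi>) \<^bold>\<longrightarrow> \<^bold>\<bottom>)" using assms by (rule ImpI)
  show "\<Gamma> \<turnstile> \<phi>"
  proof (rule Contr)
    have "insert (\<^bold>\<not>\<phi>) \<Gamma> \<turnstile> (\<phi> \<^bold>\<longrightarrow> \<psi>)"
      by (rule ImpI, rule falsum_elim, rule ImpE[of _ \<phi>]) (auto simp: Neg_def intro: Assm)
    then show "insert (\<^bold>\<not>\<phi>) \<Gamma> \<turnstile> \<^bold>\<bottom>" using n by (meson ImpE subset_insertI weakening)
  qed
  have "insert \<psi> \<Gamma> \<turnstile> (\<phi> \<^bold>\<longrightarrow> \<psi>)" by (rule ImpI, rule Assm) simp
  then have "insert \<psi> \<Gamma> \<turnstile> \<^bold>\<bottom>" using n by (meson ImpE subset_insertI weakening)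
  then show "\<Gamma> \<turnstile> \<^bold>\<not>\<psi>" unfolding Neg_def by (rule ImpI)
qed

text \<open>An inconsistency would make the instance at the fresh \<open>x\<close> provable;
  generalising over \<open>x\<close> proves the universal formula, which the same inconsistency
  refutes.\<close>

lemma consistent_witness:
  assumes "consistent \<Gamma>" "\<And>\<gamma>. \<gamma> \<in> \<Gamma> \<Longrightarrow> \<exists>l. free_below x l \<gamma>" "free_below (Suc x) l \<psi>"
  shows "consistent (insert (inst (V x) \<psi> \<^bold>\<longrightarrow> \<^bold>\<forall>\<psi>) \<Gamma>)"
  unfolding consistent_def
proof
  assume a: "insert (inst (V x) \<psi> \<^bold>\<longrightarrow> \<^bold>\<forall>\<psi>) \<Gamma> \<turnstile> \<^bold>\<bottom>"
  \<comment> \<open>This renaming moves the fresh variable to index 0 and every other variable up by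
    one. On \<open>\<Gamma>\<close>, where \<open>x\<close> does not occur, it is
    \<open>lift\<close>, and it turns the instance back into \<open>\<psi>\<close>.\<close>
  define \<sigma> where "\<sigma> n = (if n = x then V 0 else V (Suc n))" for n
  have "subst \<sigma> (\<lambda>n. n) ` \<Gamma> \<turnstile> subst \<sigma> (\<lambda>n. n) (inst (V x) \<psi>)"
    using deduct_neg_imp(1)[OF a] by (rule proves_subst)
  moreover have "subst \<sigma> (\<lambda>n. n) \<gamma> = lift \<gamma>" if \<gamma>: "\<gamma> \<in> \<Gamma>" for \<gamma>
  proof -
    obtain l where "free_below x l \<gamma>" using assms(2)[OF \<gamma>] ..
    then show ?thesis unfolding lift_def by (rule subst_cong) (simp_all add: \<sigma>_def)
  qed
  then have "subst \<sigma> (\<lambda>n. n) ` \<Gamma> = lift ` \<Gamma>" by simp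
  moreover have "subst \<sigma> (\<lambda>n. n) (inst (V x) \<psi>) = subst V (\<lambda>n. n) \<psi>"
    unfolding inst_def subst_subst using assms(3)
    by (rule subst_cong) (auto simp: \<sigma>_def split: nat.split)
  ultimately have "\<Gamma> \<turnstile> \<^bold>\<forall>\<psi>" by (simp add: AllI)
  then have "\<Gamma> \<turnstile> \<^bold>\<bottom>" by (rule ImpE[OF deduct_neg_imp(2)[OF a, unfolded Neg_def]])
  then show False using assms(1) unfolding consistent_def by simp
qed

lemma consistent_set_witness:
  assumes "consistent \<Gamma>" "\<And>\<gamma>. \<gamma> \<in> \<Gamma> \<Longrightarrow> \<exists>k. free_below k x \<gamma>" "free_below k (Suc x) \<psi>"
  shows "consistent (insert (sinst x \<psi> \<^bold>\<longrightarrow> \<^bold>\<forall>\<^sub>s\<psi>) \<Gamma>)"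
  unfolding consistent_def
proof
  assume a: "insert (sinst x \<psi> \<^bold>\<longrightarrow> \<^bold>\<forall>\<^sub>s\<psi>) \<Gamma> \<turnstile> \<^bold>\<bottom>"
  define \<rho> where "\<rho> n = (if n = x then 0 else Suc n)" for n
  have "subst V \<rho> ` \<Gamma> \<turnstile> subst V \<rho> (sinst x \<psi>)"
    using deduct_neg_imp(1)[OF a] by (rule proves_subst)
  moreover have "subst V \<rho> \<gamma> = slift \<gamma>" if \<gamma>: "\<gamma> \<in> \<Gamma>" for \<gamma>
  proof -
    obtain k where "free_below k x \<gamma>" using assms(2)[OF \<gamma>] ..
    then show ?thesis unfolding slift_def by (rule subst_cong) (simp_all add: \<rho>_def)
  qed
  then have "subst V \<rho> ` \<Gamma> = slift ` \<Gamma>" by simp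
  moreover have "subst V \<rho> (sinst x \<psi>) = subst V (\<lambda>n. n) \<psi>"
    unfolding sinst_def subst_subst using assms(3)
    by (rule subst_cong) (auto simp: \<rho>_def split: nat.split)
  ultimately have "\<Gamma> \<turnstile> \<^bold>\<forall>\<^sub>s\<psi>" by (simp add: SAllI)
  then have "\<Gamma> \<turnstile> \<^bold>\<bottom>" by (rule ImpE[OF deduct_neg_imp(2)[OF a, unfolded Neg_def]])
  then show False using assms(1) unfolding consistent_def by simp
qed

instance tm :: countable by countable_datatype

instance fm :: countable by countable_datatype

definition bound :: "fm \<Rightarrow> nat" where
  "bound \<phi> = (SOME k. free_below k k \<phi>)"

lemma free_below_bound: "free_below (bound \<phi>) (bound \<phi>) \<phi>"
  unfolding bound_def using free_below_exists by (rule someI_ex)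

text \<open>Fresh for the first n formulas and for all earlier witness axioms.\<close>

definition witness_index :: "nat \<Rightarrow> nat" where
  "witness_index n = (\<Sum>m\<le>n. Suc (bound (from_nat m)))"

lemma witness_index_less: "m < n \<Longrightarrow> witness_index m < witness_index n"
  by (rule lift_Suc_mono_less[of witness_index]) (simp_all add: witness_index_def)

lemma bound_le_witness_index: "m \<le> n \<Longrightarrow> bound (from_nat m) \<le> witness_index n"
  unfolding witness_index_def using member_le_sum[of m "{..n}" "\<lambda>m. Suc (bound (from_nat m))"] by auto

text \<open>The Henkin axiom for the \<open>n\<close>-th formula: its own fresh variable is a
  counterexample whenever there is one. Set witnesses can share the index, as the two sorts have
  separate variables.\<close>

definition witness_axiom :: "nat \<Rightarrow> fm" where
  "witness_axiom n = (inst (V (witness_index n)) (from_nat n) \<^bold>\<longrightarrow> \<^bold>\<forall>(from_nat n))"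

definition set_witness_axiom :: "nat \<Rightarrow> fm" where
  "set_witness_axiom n = (sinst (witness_index n) (from_nat n) \<^bold>\<longrightarrow> \<^bold>\<forall>\<^sub>s(from_nat n))"

lemma free_below_from_nat: "m \<le> n \<Longrightarrow> free_below (witness_index n) (witness_index n) (from_nat m)"
  using free_below_bound bound_le_witness_index by (blast intro: free_below_mono)

lemma free_below_witness_axioms:
  assumes "m \<le> n"
  shows "free_below (Suc (witness_index n)) (witness_index n) (witness_axiom m)"
    "free_below (witness_index n) (Suc (witness_index n)) (set_witness_axiom m)"
proof -
  have mn: "witness_index m \<le> witness_index n" using assms witness_index_less by (cases "m = n") (auto simp: order_le_less)
  note fb = free_below_from_nat[OF assms]
  let ?x = "witness_index n"
  have "free_below (Suc ?x) ?x (inst (V (witness_index m)) (from_nat m))"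
    unfolding inst_def by (rule free_below_subst[OF fb]) (use mn in \<open>auto split: nat.split\<close>)
  moreover have "free_below (Suc (Suc ?x)) ?x (from_nat m)" by (rule free_below_mono[OF fb]) auto
  ultimately show "free_below (Suc ?x) ?x (witness_axiom m)" unfolding witness_axiom_def by simp
  have "free_below ?x (Suc ?x) (sinst (witness_index m) (from_nat m))"
    unfolding sinst_def by (rule free_below_subst[OF fb]) (use mn in \<open>auto split: nat.split\<close>)
  moreover have "free_below ?x (Suc (Suc ?x)) (from_nat m)" by (rule free_below_mono[OF fb]) auto
  ultimately show "free_below ?x (Suc ?x) (set_witness_axiom m)" unfolding set_witness_axiom_def by simp
qed

text \<open>The axioms are added in stages, each of whose indices is fresh for all earlier stages;
  by compactness an inconsistency of the union would already occur at a finite stage.\<close>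

lemma consistent_witness_axioms:
  assumes "consistent T" "\<And>\<phi>. \<phi> \<in> T \<Longrightarrow> free_below 0 0 \<phi>"
  shows "consistent (T \<union> range witness_axiom \<union> range set_witness_axiom)"
proof -
  define \<Gamma> where "\<Gamma> n = T \<union> witness_axiom ` {..<n} \<union> set_witness_axiom ` {..<n}" for n
  have fb: "free_below (witness_index n) (witness_index n) \<gamma>" if "\<gamma> \<in> \<Gamma> n" for n \<gamma>
  proof -
    have *: "free_below (witness_index n) (witness_index n) (witness_axiom m)"
       "free_below (witness_index n) (witness_index n) (set_witness_axiom m)" if "m < n" for m
      using witness_index_less[OF that]
      by (auto intro: free_below_mono[OF free_below_witness_axioms(1)[of m m]]
          free_below_mono[OF free_below_witness_axioms(2)[of m m]])
    show ?thesis using that * assms(2) free_below_mono[of 0 0 \<gamma>] unfolding \<Gamma>_def by auto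
  qed
  have cons: "consistent (\<Gamma> n)" for n
  proof (induction n)
    case 0
    then show ?case using assms(1) by (simp add: \<Gamma>_def)
  next
    case (Suc n)
    let ?x = "witness_index n"
    have c: "consistent (insert (witness_axiom n) (\<Gamma> n))"
      unfolding witness_axiom_def
    proof (rule consistent_witness[OF Suc])
      show "\<exists>l. free_below ?x l \<gamma>" if "\<gamma> \<in> \<Gamma> n" for \<gamma> using fb[OF that] ..
      show "free_below (Suc ?x) ?x (from_nat n)" by (rule free_below_mono[OF free_below_from_nat]) auto
    qed
    have "consistent (insert (set_witness_axiom n) (insert (witness_axiom n) (\<Gamma> n)))"
      unfolding set_witness_axiom_def
    proof (rule consistent_set_witness[OF c])
      show "\<exists>k. free_below k ?x \<gamma>" if "\<gamma> \<in> insert (witness_axiom n) (\<Gamma> n)" for \<gamma>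
        using that fb[of \<gamma> n] free_below_witness_axioms(1)[of n n] by auto
      show "free_below ?x (Suc ?x) (from_nat n)" by (rule free_below_mono[OF free_below_from_nat]) auto
    qed
    moreover have "insert (set_witness_axiom n) (insert (witness_axiom n) (\<Gamma> n)) = \<Gamma> (Suc n)"
      unfolding \<Gamma>_def by (auto simp: less_Suc_eq)
    ultimately show ?case by simp
  qed
  have mono: "\<Gamma> m \<subseteq> \<Gamma> n" if "m \<le> n" for m n
    using that unfolding \<Gamma>_def by (auto intro: less_le_trans)
  show ?thesis
    unfolding consistent_def
  proof
    assume "T \<union> range witness_axiom \<union> range set_witness_axiom \<turnstile> \<^bold>\<bottom>"
    then obtain \<Delta> where \<Delta>: "finite \<Delta>" "\<Delta> \<subseteq> T \<union> range witness_axiom \<union> range set_witness_axiom" "\<Delta> \<turnstile> \<^bold>\<bottom>"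
      using compactness by blast
    from \<Delta>(1,2) have "\<exists>n. \<Delta> \<subseteq> \<Gamma> n"
    proof (induction \<Delta> rule: finite_induct)
      case empty
      then show ?case by simp
    next
      case (insert \<phi> F)
      then obtain n where n: "F \<subseteq> \<Gamma> n" by auto
      obtain m where m: "\<phi> \<in> \<Gamma> m" using insert.prems unfolding \<Gamma>_def by (blast intro: lessI)
      show ?case using n m mono[of n "max n m"] mono[of m "max n m"] by (intro exI[of _ "max n m"]) auto
    qed
    then show False using cons \<Delta>(3) weakening unfolding consistent_def by blast
  qed
qed

text \<open>Zorn's lemma; compactness moves an inconsistency of the union of a chain into one of its
  members.\<close>

lemma maximal_consistent_extension:
  assumes "consistent \<Gamma>"
  obtains \<Delta> where "\<Gamma> \<subseteq> \<Delta>" "consistent \<Delta>" "\<And>\<phi>. \<phi> \<notin> \<Delta> \<Longrightarrow> \<not> consistent (insert \<phi> \<Delta>)"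
proof -
  let ?A = "{\<Delta>. \<Gamma> \<subseteq> \<Delta> \<and> consistent \<Delta>}"
  have "\<exists>\<Delta>\<in>?A. \<forall>\<Delta>'\<in>?A. \<Delta> \<subseteq> \<Delta>' \<longrightarrow> \<Delta>' = \<Delta>"
  proof (rule subset_Zorn_nonempty)
    show "?A \<noteq> {}" using assms by auto
    fix C assume C: "C \<noteq> {}" "subset.chain ?A C"
    have "consistent (\<Union>C)"
      unfolding consistent_def
    proof
      assume "\<Union>C \<turnstile> \<^bold>\<bottom>"
      then obtain \<Delta> where \<Delta>: "finite \<Delta>" "\<Delta> \<subseteq> \<Union>C" "\<Delta> \<turnstile> \<^bold>\<bottom>" using compactness by blast
      obtain B where B: "B \<in> C" "\<Delta> \<subseteq> B" using finite_subset_Union_chain[OF \<Delta>(1,2) C] by auto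
      have "consistent B" using C(2) B(1) unfolding subset_chain_def by auto
      then show False using weakening[OF \<Delta>(3) B(2)] unfolding consistent_def by simp
    qed
    moreover obtain B where "B \<in> C" using C(1) by auto
    moreover from this have "\<Gamma> \<subseteq> B" using C(2) unfolding subset_chain_def by auto
    ultimately show "\<Union>C \<in> ?A" by auto
  qed
  then obtain \<Delta> where \<Delta>: "\<Gamma> \<subseteq> \<Delta>" "consistent \<Delta>"
    and max: "\<And>\<Delta>'. \<Gamma> \<subseteq> \<Delta>' \<Longrightarrow> consistent \<Delta>' \<Longrightarrow> \<Delta> \<subseteq> \<Delta>' \<Longrightarrow> \<Delta>' = \<Delta>"
    by auto
  have "\<not> consistent (insert \<phi> \<Delta>)" if "\<phi> \<notin> \<Delta>" for \<phi>
    using max[of "insert \<phi> \<Delta>"] \<Delta>(1) that by auto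
  with \<Delta> show ?thesis by (rule that)
qed

section \<open>Structures and completeness\<close>

text \<open>Set quantifiers range over \<open>sets_of\<close> only and not over all subsets of the
  domain; for this semantics the calculus is complete.\<close>

datatype 'm struct =
  Struct (zero_of: 'm) (one_of: 'm) (add_of: "'m \<Rightarrow> 'm \<Rightarrow> 'm") (mul_of: "'m \<Rightarrow> 'm \<Rightarrow> 'm")
    (less_of: "'m \<Rightarrow> 'm \<Rightarrow> bool") (sets_of: "'m set set")

primrec tval :: "'m struct \<Rightarrow> (nat \<Rightarrow> 'm) \<Rightarrow> tm \<Rightarrow> 'm" where
  "tval M e (V n) = e n"
| "tval M e \<^bold>0 = zero_of M"
| "tval M e \<^bold>1 = one_of M"
| "tval M e (s \<^bold>+ t) = add_of M (tval M e s) (tval M e t)"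
| "tval M e (s \<^bold>* t) = mul_of M (tval M e s) (tval M e t)"

primrec sat :: "'m struct \<Rightarrow> (nat \<Rightarrow> 'm) \<Rightarrow> (nat \<Rightarrow> 'm set) \<Rightarrow> fm \<Rightarrow> bool" where
  "sat M e r (s \<^bold>= t) \<longleftrightarrow> tval M e s = tval M e t"
| "sat M e r (s \<^bold>< t) \<longleftrightarrow> less_of M (tval M e s) (tval M e t)"
| "sat M e r (t \<^bold>\<in> X) \<longleftrightarrow> tval M e t \<in> r X"
| "sat M e r \<^bold>\<bottom> \<longleftrightarrow> False"
| "sat M e r (\<phi> \<^bold>\<longrightarrow> \<psi>) \<longleftrightarrow> (sat M e r \<phi> \<longrightarrow> sat M e r \<psi>)"
| "sat M e r (\<^bold>\<forall>\<phi>) \<longleftrightarrow> (\<forall>a. sat M (case_nat a e) r \<phi>)"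
| "sat M e r (\<^bold>\<forall>\<^sub>s\<phi>) \<longleftrightarrow> (\<forall>A\<in>sets_of M. sat M e (case_nat A r) \<phi>)"

definition valid_in :: "'m struct \<Rightarrow> fm \<Rightarrow> bool" where
  "valid_in M \<phi> \<longleftrightarrow> (\<forall>e r. range r \<subseteq> sets_of M \<longrightarrow> sat M e r \<phi>)"

lemma sat_connectives [simp]:
  "sat M e r (\<^bold>\<not>\<phi>) \<longleftrightarrow> \<not> sat M e r \<phi>"
  "sat M e r (\<phi> \<^bold>\<and> \<psi>) \<longleftrightarrow> sat M e r \<phi> \<and> sat M e r \<psi>"
  "sat M e r (\<phi> \<^bold>\<or> \<psi>) \<longleftrightarrow> sat M e r \<phi> \<or> sat M e r \<psi>"
  "sat M e r (\<phi> \<^bold>\<longleftrightarrow> \<psi>) \<longleftrightarrow> (sat M e r \<phi> \<longleftrightarrow> sat M e r \<psi>)"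
  "sat M e r (\<^bold>\<exists>\<phi>) \<longleftrightarrow> (\<exists>a. sat M (case_nat a e) r \<phi>)"
  "sat M e r (\<^bold>\<exists>\<^sub>s\<phi>) \<longleftrightarrow> (\<exists>A\<in>sets_of M. sat M e (case_nat A r) \<phi>)"
  by (auto simp: Neg_def Conj_def Disj_def Iff_def Exists_def SExists_def)

lemma tval_cong:
  "free_below_tm k t \<Longrightarrow> (\<And>n. n < k \<Longrightarrow> e n = e' n) \<Longrightarrow> tval M e t = tval M e' t"
  by (induction t) auto

lemma sat_cong:
  assumes "free_below k l \<phi>" "\<And>n. n < k \<Longrightarrow> e n = e' n" "\<And>n. n < l \<Longrightarrow> r n = r' n"
  shows "sat M e r \<phi> \<longleftrightarrow> sat M e' r' \<phi>"
  using assms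
proof (induction \<phi> arbitrary: k l e e' r r')
  case (Eq s t)
  then show ?case by (simp add: tval_cong[of k s e e'] tval_cong[of k t e e'])
next
  case (Less s t)
  then show ?case by (simp add: tval_cong[of k s e e'] tval_cong[of k t e e'])
next
  case (Mem t X)
  then show ?case by (simp add: tval_cong[of k t e e'])
next
  case (Imp \<phi> \<psi>)
  have "sat M e r \<phi> \<longleftrightarrow> sat M e' r' \<phi>" using Imp.prems by (intro Imp.IH(1)[of k l]) auto
  moreover have "sat M e r \<psi> \<longleftrightarrow> sat M e' r' \<psi>" using Imp.prems by (intro Imp.IH(2)[of k l]) auto
  ultimately show ?case by simp
next
  case (Forall \<phi>)
  have "sat M (case_nat a e) r \<phi> \<longleftrightarrow> sat M (case_nat a e') r' \<phi>" for a
    by (rule Forall.IH[of "Suc k" l]) (use Forall.prems in \<open>auto split: nat.split\<close>)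
  then show ?case by simp
next
  case (SForall \<phi>)
  have "sat M e (case_nat A r) \<phi> \<longleftrightarrow> sat M e' (case_nat A r') \<phi>" for A
    by (rule SForall.IH[of k "Suc l"]) (use SForall.prems in \<open>auto split: nat.split\<close>)
  then show ?case by simp
qed simp

lemma tval_subst_tm: "tval M e (subst_tm \<sigma> t) = tval M (\<lambda>n. tval M e (\<sigma> n)) t"
  by (induction t) simp_all

lemma tval_lift [simp]: "tval M (case_nat a e) (\<up>t) = tval M e t"
  by (simp add: lift_tm_def tval_subst_tm)

lemma sat_subst: "sat M e r (subst \<sigma> \<rho> \<phi>) \<longleftrightarrow> sat M (\<lambda>n. tval M e (\<sigma> n)) (\<lambda>n. r (\<rho> n)) \<phi>"
proof (induction \<phi> arbitrary: \<sigma> \<rho> e r)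
  case (Forall \<phi>)
  have "(\<lambda>n. tval M (case_nat a e) (shift_subst \<sigma> n)) = case_nat a (\<lambda>n. tval M e (\<sigma> n))" for a
    by (rule ext) (simp add: shift_subst_def split: nat.split)
  then show ?case by (simp add: Forall.IH)
next
  case (SForall \<phi>)
  have "(\<lambda>n. case_nat A r (shift_ren \<rho> n)) = case_nat A (\<lambda>n. r (\<rho> n))" for A
    by (rule ext) (simp add: shift_ren_def split: nat.split)
  then show ?case by (simp add: SForall.IH)
qed (simp_all add: tval_subst_tm)

section \<open>Term models of maximal consistent theories with witnesses\<close>

locale henkin =
  fixes \<Delta> :: "fm set"
  assumes consistent: "consistent \<Delta>"
    and maximal: "\<phi> \<notin> \<Delta> \<Longrightarrow> \<not> consistent (insert \<phi> \<Delta>)"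
    and witness: "\<exists>x. (inst (V x) \<phi> \<^bold>\<longrightarrow> \<^bold>\<forall>\<phi>) \<in> \<Delta>"
    and set_witness: "\<exists>X. (sinst X \<phi> \<^bold>\<longrightarrow> \<^bold>\<forall>\<^sub>s\<phi>) \<in> \<Delta>"
begin

lemma closed: "\<Delta> \<turnstile> \<phi> \<Longrightarrow> \<phi> \<in> \<Delta>"
proof (rule ccontr)
  assume a: "\<Delta> \<turnstile> \<phi>" "\<phi> \<notin> \<Delta>"
  then have "insert \<phi> \<Delta> \<turnstile> \<^bold>\<bottom>" using maximal unfolding consistent_def by simp
  then have "\<Delta> \<turnstile> \<^bold>\<bottom>" using a(1) by (meson ImpE ImpI)
  then show False using consistent unfolding consistent_def by simp
qed

lemma imp_iff: "(\<phi> \<^bold>\<longrightarrow> \<psi>) \<in> \<Delta> \<longleftrightarrow> (\<phi> \<in> \<Delta> \<longrightarrow> \<psi> \<in> \<Delta>)"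
proof
  assume "(\<phi> \<^bold>\<longrightarrow> \<psi>) \<in> \<Delta>"
  then show "\<phi> \<in> \<Delta> \<longrightarrow> \<psi> \<in> \<Delta>" by (metis Assm ImpE closed)
next
  assume a: "\<phi> \<in> \<Delta> \<longrightarrow> \<psi> \<in> \<Delta>"
  show "(\<phi> \<^bold>\<longrightarrow> \<psi>) \<in> \<Delta>"
  proof (cases "\<phi> \<in> \<Delta>")
    case True
    then have "insert \<phi> \<Delta> \<turnstile> \<psi>" using a by (intro Assm) simp
    then show ?thesis by (rule closed[OF ImpI])
  next
    case False
    then have "insert \<phi> \<Delta> \<turnstile> \<^bold>\<bottom>" using maximal unfolding consistent_def by simp
    then show ?thesis by (rule closed[OF ImpI[OF falsum_elim]])
  qed
qed

lemma falsum_notin: "\<^bold>\<bottom> \<notin> \<Delta>"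
  using consistent Assm[of "\<^bold>\<bottom>" \<Delta>] unfolding consistent_def by auto

lemma forall_iff: "(\<^bold>\<forall>\<phi>) \<in> \<Delta> \<longleftrightarrow> (\<forall>t. inst t \<phi> \<in> \<Delta>)"
proof -
  have "inst t \<phi> \<in> \<Delta>" if "(\<^bold>\<forall>\<phi>) \<in> \<Delta>" for t using closed[OF AllE[OF Assm[OF that]]] .
  then show ?thesis using witness[of \<phi>] imp_iff by auto
qed

lemma sforall_iff: "(\<^bold>\<forall>\<^sub>s\<phi>) \<in> \<Delta> \<longleftrightarrow> (\<forall>X. sinst X \<phi> \<in> \<Delta>)"
proof -
  have "sinst X \<phi> \<in> \<Delta>" if "(\<^bold>\<forall>\<^sub>s\<phi>) \<in> \<Delta>" for X using closed[OF SAllE[OF Assm[OF that]]] .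
  then show ?thesis using set_witness[of \<phi>] imp_iff by auto
qed

lemma eq_refl: "(t \<^bold>= t) \<in> \<Delta>"
  by (rule closed) (rule EqRefl)

lemma eq_subst: "(s \<^bold>= t) \<in> \<Delta> \<Longrightarrow> inst s \<phi> \<in> \<Delta> \<Longrightarrow> inst t \<phi> \<in> \<Delta>"
  by (rule closed, rule EqSubst[of _ s], rule Assm, assumption, rule Assm, assumption)

lemma inst_lift_tm [simp]: "subst_tm (case_nat s V) (\<up>t) = t"
  by (simp add: lift_tm_def subst_tm_subst_tm)

lemma eq_sym: "(s \<^bold>= t) \<in> \<Delta> \<Longrightarrow> (t \<^bold>= s) \<in> \<Delta>"
  using eq_subst[of s t "V 0 \<^bold>= \<up>s"] eq_refl by (simp add: inst_def)

lemma eq_trans: "(s \<^bold>= t) \<in> \<Delta> \<Longrightarrow> (t \<^bold>= u) \<in> \<Delta> \<Longrightarrow> (s \<^bold>= u) \<in> \<Delta>"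
  using eq_subst[of t u "\<up>s \<^bold>= V 0"] by (simp add: inst_def)

lemma eq_cong:
  assumes "(s \<^bold>= s') \<in> \<Delta>" "(t \<^bold>= t') \<in> \<Delta>"
  shows "(s \<^bold>+ t \<^bold>= s' \<^bold>+ t') \<in> \<Delta>" "(s \<^bold>* t \<^bold>= s' \<^bold>* t') \<in> \<Delta>"
    "(s \<^bold>< t) \<in> \<Delta> \<Longrightarrow> (s' \<^bold>< t') \<in> \<Delta>" "(s \<^bold>\<in> X) \<in> \<Delta> \<Longrightarrow> (s' \<^bold>\<in> X) \<in> \<Delta>"
proof -
  have "(s \<^bold>+ t \<^bold>= s' \<^bold>+ t) \<in> \<Delta>"
    using eq_subst[OF assms(1), of "\<up>s \<^bold>+ \<up>t \<^bold>= V 0 \<^bold>+ \<up>t"] eq_refl by (simp add: inst_def)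
  moreover have "(s' \<^bold>+ t \<^bold>= s' \<^bold>+ t') \<in> \<Delta>"
    using eq_subst[OF assms(2), of "\<up>s' \<^bold>+ \<up>t \<^bold>= \<up>s' \<^bold>+ V 0"] eq_refl by (simp add: inst_def)
  ultimately show "(s \<^bold>+ t \<^bold>= s' \<^bold>+ t') \<in> \<Delta>" by (rule eq_trans)
  have "(s \<^bold>* t \<^bold>= s' \<^bold>* t) \<in> \<Delta>"
    using eq_subst[OF assms(1), of "\<up>s \<^bold>* \<up>t \<^bold>= V 0 \<^bold>* \<up>t"] eq_refl by (simp add: inst_def)
  moreover have "(s' \<^bold>* t \<^bold>= s' \<^bold>* t') \<in> \<Delta>"
    using eq_subst[OF assms(2), of "\<up>s' \<^bold>* \<up>t \<^bold>= \<up>s' \<^bold>* V 0"] eq_refl by (simp add: inst_def)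
  ultimately show "(s \<^bold>* t \<^bold>= s' \<^bold>* t') \<in> \<Delta>" by (rule eq_trans)
  show "(s' \<^bold>< t') \<in> \<Delta>" if "(s \<^bold>< t) \<in> \<Delta>"
    using eq_subst[OF assms(1), of "V 0 \<^bold>< \<up>t"] eq_subst[OF assms(2), of "\<up>s' \<^bold>< V 0"] that
    by (simp add: inst_def)
  show "(s' \<^bold>\<in> X) \<in> \<Delta>" if "(s \<^bold>\<in> X) \<in> \<Delta>"
    using eq_subst[OF assms(1), of "V 0 \<^bold>\<in> X"] that by (simp add: inst_def)
qed

text \<open>The quotient of the terms by provable equality, transported along \<open>f\<close> to a
  prescribed type; \<open>inv f\<close> picks representatives. This makes it possible to fix the
  domain type in advance.\<close>

definition quot_struct :: "(tm \<Rightarrow> 'm) \<Rightarrow> 'm struct" where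
  "quot_struct f = Struct (f \<^bold>0) (f \<^bold>1) (\<lambda>a b. f (inv f a \<^bold>+ inv f b)) (\<lambda>a b. f (inv f a \<^bold>* inv f b))
     (\<lambda>a b. (inv f a \<^bold>< inv f b) \<in> \<Delta>) (range (\<lambda>X. f ` {t. (t \<^bold>\<in> X) \<in> \<Delta>}))"

context
  fixes f :: "tm \<Rightarrow> 'm"
  assumes surj: "surj f" and f_eq: "f s = f t \<longleftrightarrow> (s \<^bold>= t) \<in> \<Delta>"
begin

lemma inv_f: "(inv f (f t) \<^bold>= t) \<in> \<Delta>"
  using f_eq surj by (metis surj_f_inv_f)

lemma tval_quot: "tval (quot_struct f) (\<lambda>n. f (\<sigma> n)) t = f (subst_tm \<sigma> t)"
  by (induction t) (auto simp: quot_struct_def f_eq intro: eq_cong inv_f)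

text \<open>The truth lemma. It is stated for all substitutions so that the induction passes under
  both kinds of quantifiers.\<close>

lemma sat_quot:
  "sat (quot_struct f) (\<lambda>n. f (\<sigma> n)) (\<lambda>X. f ` {t. (t \<^bold>\<in> \<rho> X) \<in> \<Delta>}) \<phi> \<longleftrightarrow> subst \<sigma> \<rho> \<phi> \<in> \<Delta>"
proof (induction \<phi> arbitrary: \<sigma> \<rho>)
  case (Eq s t)
  then show ?case by (simp add: tval_quot f_eq)
next
  case (Less s t)
  have "less_of (quot_struct f) (f s) (f t) \<longleftrightarrow> (s \<^bold>< t) \<in> \<Delta>" for s t
    using eq_cong(3)[OF inv_f[of s] inv_f[of t]]
      eq_cong(3)[OF eq_sym[OF inv_f[of s]] eq_sym[OF inv_f[of t]]]
    by (auto simp: quot_struct_def)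
  then show ?case by (simp add: tval_quot)
next
  case (Mem t X)
  have "f s \<in> f ` {t. (t \<^bold>\<in> Y) \<in> \<Delta>} \<longleftrightarrow> (s \<^bold>\<in> Y) \<in> \<Delta>" for s Y
  proof
    assume "f s \<in> f ` {t. (t \<^bold>\<in> Y) \<in> \<Delta>}"
    then obtain t where "(t \<^bold>= s) \<in> \<Delta>" "(t \<^bold>\<in> Y) \<in> \<Delta>" using f_eq[of s] eq_sym by auto
    then show "(s \<^bold>\<in> Y) \<in> \<Delta>" using eq_cong(4)[OF _ eq_refl] by simp
  qed auto
  then show ?case by (simp add: tval_quot)
next
  case Falsum
  show ?case by (simp add: falsum_notin)
next
  case (Imp \<phi> \<psi>)
  then show ?case by (simp add: imp_iff)
next
  case (Forall \<phi>)
  have s: "inst t (subst (shift_subst \<sigma>) \<rho> \<phi>) = subst (case_nat t \<sigma>) \<rho> \<phi>" for t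
  proof -
    have "(\<lambda>n. subst_tm (case_nat t V) (shift_subst \<sigma> n)) = case_nat t \<sigma>"
      by (rule ext) (simp add: shift_subst_def split: nat.split)
    then show ?thesis by (simp add: inst_def subst_subst)
  qed
  have e: "case_nat (f t) (\<lambda>n. f (\<sigma> n)) = (\<lambda>n. f (case_nat t \<sigma> n))" for t
    by (rule ext) (simp split: nat.split)
  have "(\<forall>a. Q a) \<longleftrightarrow> (\<forall>t. Q (f t))" for Q using surj by (metis surj_def)
  then show ?case by (simp add: forall_iff s e Forall.IH)
next
  case (SForall \<phi>)
  have s: "sinst X (subst \<sigma> (shift_ren \<rho>) \<phi>) = subst \<sigma> (case_nat X \<rho>) \<phi>" for X
  proof -
    have "(\<lambda>n. case_nat X (\<lambda>n. n) (shift_ren \<rho> n)) = case_nat X \<rho>"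
      by (rule ext) (simp add: shift_ren_def split: nat.split)
    then show ?thesis by (simp add: sinst_def subst_subst)
  qed
  have e: "case_nat (f ` {t. (t \<^bold>\<in> X) \<in> \<Delta>}) (\<lambda>X. f ` {t. (t \<^bold>\<in> \<rho> X) \<in> \<Delta>}) =
      (\<lambda>Y. f ` {t. (t \<^bold>\<in> case_nat X \<rho> Y) \<in> \<Delta>})" for X
    by (rule ext) (simp split: nat.split)
  have "sets_of (quot_struct f) = range (\<lambda>X. f ` {t. (t \<^bold>\<in> X) \<in> \<Delta>})" by (simp add: quot_struct_def)
  then show ?case by (simp add: sforall_iff s e SForall.IH)
qed

end

end

text \<open>Only models whose domain is the given countable type are considered. This suffices
  because the successor axioms make the term model infinite, so it can be copied bijectively to any
  countably infinite type.\<close>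

theorem completeness:
  fixes T :: "fm set" and \<chi> :: fm
  assumes sentences: "\<And>\<phi>. \<phi> \<in> T \<Longrightarrow> free_below 0 0 \<phi>" "free_below 0 0 \<chi>"
    and inf: "\<And>t. T \<turnstile> \<^bold>\<not>(t \<^bold>+ \<^bold>1 \<^bold>= \<^bold>0)" "\<And>s t. T \<turnstile> (s \<^bold>+ \<^bold>1 \<^bold>= t \<^bold>+ \<^bold>1 \<^bold>\<longrightarrow> s \<^bold>= t)"
    and valid: "\<And>M :: 'm :: countable struct. sets_of M \<noteq> {} \<Longrightarrow> (\<And>\<phi>. \<phi> \<in> T \<Longrightarrow> valid_in M \<phi>) \<Longrightarrow> valid_in M \<chi>"
    and univ: "infinite (UNIV :: 'm set)"
  shows "T \<turnstile> \<chi>"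
proof (rule ccontr)
  assume "\<not> (T \<turnstile> \<chi>)"
  then have "consistent (insert (\<^bold>\<not>\<chi>) T)" unfolding consistent_def using Contr[of \<chi> T] by auto
  then have "consistent (insert (\<^bold>\<not>\<chi>) T \<union> range witness_axiom \<union> range set_witness_axiom)"
    by (rule consistent_witness_axioms) (use sentences in \<open>auto simp: Neg_def\<close>)
  then obtain \<Delta> where \<Delta>: "insert (\<^bold>\<not>\<chi>) T \<union> range witness_axiom \<union> range set_witness_axiom \<subseteq> \<Delta>"
      "consistent \<Delta>" "\<And>\<phi>. \<phi> \<notin> \<Delta> \<Longrightarrow> \<not> consistent (insert \<phi> \<Delta>)"
    by (rule maximal_consistent_extension) (rule that; assumption)
  interpret henkin \<Delta>
  proof
    fix \<phi> :: fm
    have "witness_axiom (to_nat \<phi>) \<in> \<Delta>" "set_witness_axiom (to_nat \<phi>) \<in> \<Delta>" using \<Delta>(1) by auto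
    then show "\<exists>x. (inst (V x) \<phi> \<^bold>\<longrightarrow> \<^bold>\<forall>\<phi>) \<in> \<Delta>" "\<exists>X. (sinst X \<phi> \<^bold>\<longrightarrow> \<^bold>\<forall>\<^sub>s\<phi>) \<in> \<Delta>"
      by (auto simp: witness_axiom_def set_witness_axiom_def)
  qed (use \<Delta> in auto)
  have T: "T \<turnstile> \<phi> \<Longrightarrow> \<phi> \<in> \<Delta>" for \<phi> using \<Delta>(1) weakening[of T \<phi> \<Delta>] closed by auto
  define cls where "cls s = {t. (s \<^bold>= t) \<in> \<Delta>}" for s
  have cls_eq: "cls s = cls t \<longleftrightarrow> (s \<^bold>= t) \<in> \<Delta>" for s t
    unfolding cls_def set_eq_iff mem_Collect_eq using eq_refl eq_sym eq_trans by metis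
  \<comment> \<open>The numerals have pairwise distinct classes, which shows that the term model is
    infinite.\<close>
  define num where "num n = ((\<lambda>t. t \<^bold>+ \<^bold>1) ^^ n) \<^bold>0" for n
  have num_neq: "(num n \<^bold>= num m) \<notin> \<Delta>" if "m < n" for m n
    using that
  proof (induction m arbitrary: n)
    case 0
    then obtain k where "n = Suc k" using gr0_implies_Suc by blast
    then show ?case using T[OF inf(1)[of "num k"]] falsum_notin by (simp add: num_def Neg_def imp_iff)
  next
    case (Suc m)
    then obtain k where k: "n = Suc k" "m < k" by (metis Suc_lessE)
    then show ?case using T[OF inf(2)[of "num k" "num m"]] Suc.IH[of k] by (simp add: num_def imp_iff)
  qed
  have "inj (\<lambda>n. cls (num n))"
  proof (rule injI)
    fix m n assume "cls (num m) = cls (num n)"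
    then show "m = n" using num_neq[of m n] num_neq[of n m] eq_sym unfolding cls_eq
      by (metis linorder_neqE_nat)
  qed
  then have "infinite (range (\<lambda>n. cls (num n)))" by (rule range_inj_infinite)
  then have "infinite (range cls)" by (rule contrapos_nn) (rule finite_subset, auto)
  moreover have "countable (range cls)" by simp
  ultimately obtain g :: "tm set \<Rightarrow> nat" where g: "bij_betw g (range cls) UNIV"
    using countableE_infinite by blast
  obtain h :: "'m \<Rightarrow> nat" where h: "bij h" using countableE_infinite[OF _ univ] by auto
  define f where "f t = inv h (g (cls t))" for t
  have f_eq: "f s = f t \<longleftrightarrow> (s \<^bold>= t) \<in> \<Delta>" for s t
  proof -
    have "f s = f t \<longleftrightarrow> g (cls s) = g (cls t)"
      unfolding f_def using h by (metis bij_is_surj surj_f_inv_f)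
    also have "\<dots> \<longleftrightarrow> cls s = cls t" using g unfolding bij_betw_def by (metis inj_on_eq_iff rangeI)
    finally show ?thesis by (simp add: cls_eq)
  qed
  have surj: "surj f"
  proof (rule surj_def[THEN iffD2], rule allI)
    fix a
    have "h a \<in> g ` range cls" using g by (simp add: bij_betw_def)
    then obtain t where "h a = g (cls t)" by auto
    then have "f t = a" unfolding f_def using h by (metis bij_is_inj inv_f_f)
    then show "\<exists>t. a = f t" by blast
  qed
  let ?M = "quot_struct f" and ?r = "\<lambda>X. f ` {t. (t \<^bold>\<in> X) \<in> \<Delta>}"
  have sat: "sat ?M (\<lambda>n. f (V n)) ?r \<phi> \<longleftrightarrow> \<phi> \<in> \<Delta>" for \<phi>
    using sat_quot[of f V "\<lambda>X. X" \<phi>, OF surj f_eq] by simp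
  have "valid_in ?M \<phi>" if \<phi>: "\<phi> \<in> T" for \<phi>
  proof -
    have "sat ?M (\<lambda>n. f (V n)) ?r \<phi>" using sat \<phi> \<Delta>(1) by auto
    then have "sat ?M e r \<phi>" for e r
      using sat_cong[OF sentences(1)[OF \<phi>], of e "\<lambda>n. f (V n)" r ?r] by simp
    then show ?thesis by (simp add: valid_in_def)
  qed
  then have "valid_in ?M \<chi>" by (intro valid) (auto simp: quot_struct_def)
  then have "\<chi> \<in> \<Delta>" unfolding valid_in_def using sat[of \<chi>] by (auto simp: quot_struct_def)
  moreover have "(\<^bold>\<not>\<chi>) \<in> \<Delta>" using \<Delta>(1) by auto
  ultimately show False using falsum_notin by (simp add: Neg_def imp_iff)
qed

lemma range_case_nat: "A \<in> S \<Longrightarrow> range r \<subseteq> S \<Longrightarrow> range (case_nat A r) \<subseteq> S"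
  by (auto simp: image_subset_iff split: nat.split)

text \<open>Validity already quantifies over all assignments, so closing a formula changes nothing.
  This lets the axioms be used with their free variables.\<close>

lemma valid_closures_iff:
  "(\<forall>\<phi>\<in>closures T. valid_in M \<phi>) \<longleftrightarrow> (\<forall>\<phi>\<in>T. valid_in M \<phi>)"
proof -
  have num: "sat M e r ((Forall ^^ k) \<phi>)" if "\<And>e. sat M e r \<phi>" for k e r \<phi>
    by (induction k arbitrary: e) (use that in auto)
  have set: "sat M e r ((SForall ^^ l) \<phi>)"
    if "\<And>e r. range r \<subseteq> sets_of M \<Longrightarrow> sat M e r \<phi>" "range r \<subseteq> sets_of M" for l e r \<phi>
    using that(2)
  proof (induction l arbitrary: r)
    case 0
    then show ?case using that(1) by simp
  next
    case (Suc l)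
    have "sat M e (case_nat A r) ((SForall ^^ l) \<phi>)" if "A \<in> sets_of M" for A
      by (rule Suc.IH[OF range_case_nat[OF that Suc.prems]])
    then show ?case by simp
  qed
  \<comment> \<open>The closing quantifiers are instantiated with the first \<open>k\<close> values
    of the environment itself, starting with the outermost, which binds index
    \<open>k - 1\<close>.\<close>
  have num': "sat M (\<lambda>n. e (n + k)) r ((Forall ^^ k) \<phi>) \<Longrightarrow> sat M e r \<phi>" for k e r \<phi>
  proof (induction k)
    case (Suc k)
    have "case_nat (e k) (\<lambda>n. e (n + Suc k)) = (\<lambda>n. e (n + k))"
      by (rule ext) (simp split: nat.split)
    then show ?case using Suc by (metis funpow.simps(2) comp_apply sat.simps(6))
  qed simp
  have set': "sat M e (\<lambda>n. r (n + l)) ((SForall ^^ l) \<phi>) \<Longrightarrow> sat M e r \<phi>" if "range r \<subseteq> sets_of M" for l e r \<phi>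
  proof (induction l)
    case (Suc l)
    have "case_nat (r l) (\<lambda>n. r (n + Suc l)) = (\<lambda>n. r (n + l))"
      by (rule ext) (simp split: nat.split)
    moreover have "r l \<in> sets_of M" using that by auto
    ultimately show ?case using Suc by (metis funpow.simps(2) comp_apply sat.simps(7))
  qed simp
  show ?thesis
  proof (intro iffI ballI)
    fix \<phi> assume a: "\<forall>\<phi>\<in>closures T. valid_in M \<phi>" and "\<phi> \<in> T"
    then have "(SForall ^^ bound \<phi>) ((Forall ^^ bound \<phi>) \<phi>) \<in> closures T"
      unfolding closures_def using free_below_bound by blast
    then have v: "valid_in M ((SForall ^^ bound \<phi>) ((Forall ^^ bound \<phi>) \<phi>))" using a by blast
    show "valid_in M \<phi>"
      unfolding valid_in_def
    proof (intro allI impI)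
      fix e and r :: "nat \<Rightarrow> 'a set" assume r: "range r \<subseteq> sets_of M"
      then have "range (\<lambda>n. r (n + bound \<phi>)) \<subseteq> sets_of M" by auto
      then have "sat M (\<lambda>n. e (n + bound \<phi>)) (\<lambda>n. r (n + bound \<phi>)) ((SForall ^^ bound \<phi>) ((Forall ^^ bound \<phi>) \<phi>))"
        using v unfolding valid_in_def by simp
      then show "sat M e r \<phi>" by (rule num'[OF set'[OF r]])
    qed
  next
    fix \<phi> assume "\<forall>\<phi>\<in>T. valid_in M \<phi>" "\<phi> \<in> closures T"
    then obtain \<psi> k l where \<psi>: "\<psi> \<in> T" "\<phi> = (SForall ^^ l) ((Forall ^^ k) \<psi>)" "valid_in M \<psi>"
      unfolding closures_def by auto
    have "sat M e r ((Forall ^^ k) \<psi>)" if "range r \<subseteq> sets_of M" for e r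
      using \<psi>(3) that by (intro num) (simp add: valid_in_def)
    then show "valid_in M \<phi>" unfolding \<psi>(2) valid_in_def by (intro allI impI set)
  qed
qed

section \<open>Definable predicates\<close>

text \<open>A predicate on number environments is definable by formulas of a class with arbitrary
  parameters; each free number variable of the formula stands for a parameter (Inl) or a variable of
  the environment (Inr).\<close>

primrec ev :: "(nat \<Rightarrow> 'm) \<Rightarrow> 'm + nat \<Rightarrow> 'm" where
  "ev e (Inl a) = a"
| "ev e (Inr n) = e n"

definition definable :: "'m struct \<Rightarrow> fm set \<Rightarrow> ((nat \<Rightarrow> 'm) \<Rightarrow> bool) \<Rightarrow> bool" where
  "definable M K P \<longleftrightarrow>
     (\<exists>\<phi>\<in>K. \<exists>\<tau> r. range r \<subseteq> sets_of M \<and> (\<forall>e. P e \<longleftrightarrow> sat M (\<lambda>n. ev e (\<tau> n)) r \<phi>))"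

definition term_definable :: "'m struct \<Rightarrow> ((nat \<Rightarrow> 'm) \<Rightarrow> 'm) \<Rightarrow> bool" where
  "term_definable M t \<longleftrightarrow> (\<exists>s \<tau>. \<forall>e. t e = tval M (\<lambda>n. ev e (\<tau> n)) s)"

text \<open>Closure under renaming is what allows two formulas of a class to be moved to disjoint
  sets of variables before they are combined.\<close>

definition ren_closed :: "fm set \<Rightarrow> bool" where
  "ren_closed K \<longleftrightarrow> (\<forall>\<phi>\<in>K. \<forall>f g. subst (\<lambda>n. V (f n)) g \<phi> \<in> K)"

lemma ren_closedD: "ren_closed K \<Longrightarrow> \<phi> \<in> K \<Longrightarrow> subst (\<lambda>n. V (f n)) g \<phi> \<in> K"
  by (simp add: ren_closed_def)

lemma shift_subst_ren: "shift_subst (\<lambda>n. V (f n)) = (\<lambda>n. V (case_nat 0 (\<lambda>n. Suc (f n)) n))"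
  by (rule ext) (simp add: shift_subst_def lift_tm_def split: nat.split)

lemma subst_connectives [simp]:
  "subst \<sigma> \<rho> (\<phi> \<^bold>\<and> \<psi>) = (subst \<sigma> \<rho> \<phi> \<^bold>\<and> subst \<sigma> \<rho> \<psi>)"
  "subst \<sigma> \<rho> (\<phi> \<^bold>\<or> \<psi>) = (subst \<sigma> \<rho> \<phi> \<^bold>\<or> subst \<sigma> \<rho> \<psi>)"
  "subst \<sigma> \<rho> (\<phi> \<^bold>\<longleftrightarrow> \<psi>) = (subst \<sigma> \<rho> \<phi> \<^bold>\<longleftrightarrow> subst \<sigma> \<rho> \<psi>)"
  "subst \<sigma> \<rho> (\<^bold>\<exists>\<phi>) = (\<^bold>\<exists>(subst (shift_subst \<sigma>) \<rho> \<phi>))"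
  by (simp_all add: Conj_def Disj_def Iff_def Exists_def)

lemma subst_tm_shift_lift: "subst_tm (shift_subst \<sigma>) (\<up>t) = \<up>(subst_tm \<sigma> t)"
  by (simp add: lift_tm_def subst_tm_subst_tm)

lemma ren_closed_Delta0: "ren_closed Delta0"
proof -
  have "subst (\<lambda>n. V (f n)) g \<phi> \<in> Delta0" if "\<phi> \<in> Delta0" for \<phi> f g
    using that
  proof (induction arbitrary: f rule: Delta0.induct)
    case (6 \<phi> t)
    show ?case using 6(2)[of "case_nat 0 (\<lambda>n. Suc (f n))"]
      by (simp add: subst_tm_shift_lift) (simp add: shift_subst_ren Delta0.intros)
  next
    case (7 \<phi> t)
    show ?case using 7(2)[of "case_nat 0 (\<lambda>n. Suc (f n))"]
      by (simp add: subst_tm_shift_lift) (simp add: shift_subst_ren Delta0.intros)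
  qed (auto intro: Delta0.intros)
  then show ?thesis by (simp add: ren_closed_def)
qed

lemma ren_closed_Sigma1: "ren_closed Sigma1"
  using ren_closed_Delta0 unfolding ren_closed_def Sigma1_def by (auto simp: shift_subst_ren)

text \<open>Even and odd indices merge two assignments into one, so that two formulas with separate
  parameters can share a single assignment.\<close>

lemma interleave:
  fixes \<tau>\<^sub>1 \<tau>\<^sub>2 :: "nat \<Rightarrow> 'a"
  obtains \<tau> where "\<tau>\<^sub>1 = (\<lambda>n. \<tau> (2 * n))" "\<tau>\<^sub>2 = (\<lambda>n. \<tau> (2 * n + 1))" "range \<tau> \<subseteq> range \<tau>\<^sub>1 \<union> range \<tau>\<^sub>2"
  by (rule that[of "\<lambda>n. if even n then \<tau>\<^sub>1 (n div 2) else \<tau>\<^sub>2 (n div 2)"]) auto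

lemma definable_merge:
  assumes "definable M K P" "definable M L Q" "ren_closed K" "ren_closed L"
  obtains \<phi> \<psi> \<tau> r where "\<phi> \<in> K" "\<psi> \<in> L" "range r \<subseteq> sets_of M"
    "\<And>e. P e \<longleftrightarrow> sat M (\<lambda>n. ev e (\<tau> n)) r \<phi>" "\<And>e. Q e \<longleftrightarrow> sat M (\<lambda>n. ev e (\<tau> n)) r \<psi>"
proof -
  obtain \<phi> \<tau>\<^sub>1 r\<^sub>1 where 1: "\<phi> \<in> K" "range r\<^sub>1 \<subseteq> sets_of M" "\<And>e. P e \<longleftrightarrow> sat M (\<lambda>n. ev e (\<tau>\<^sub>1 n)) r\<^sub>1 \<phi>"
    using assms(1) unfolding definable_def by auto
  obtain \<psi> \<tau>\<^sub>2 r\<^sub>2 where 2: "\<psi> \<in> L" "range r\<^sub>2 \<subseteq> sets_of M" "\<And>e. Q e \<longleftrightarrow> sat M (\<lambda>n. ev e (\<tau>\<^sub>2 n)) r\<^sub>2 \<psi>"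
    using assms(2) unfolding definable_def by auto
  obtain \<tau> where \<tau>: "\<tau>\<^sub>1 = (\<lambda>n. \<tau> (2 * n))" "\<tau>\<^sub>2 = (\<lambda>n. \<tau> (2 * n + 1))" by (rule interleave)
  obtain r where r: "r\<^sub>1 = (\<lambda>n. r (2 * n))" "r\<^sub>2 = (\<lambda>n. r (2 * n + 1))" "range r \<subseteq> range r\<^sub>1 \<union> range r\<^sub>2"
    by (rule interleave)
  show ?thesis
  proof (rule that)
    show "subst (\<lambda>n. V (2 * n)) (\<lambda>n. 2 * n) \<phi> \<in> K" using assms(3) 1(1) by (rule ren_closedD)
    show "subst (\<lambda>n. V (2 * n + 1)) (\<lambda>n. 2 * n + 1) \<psi> \<in> L" using assms(4) 2(1) by (rule ren_closedD)
    show "range r \<subseteq> sets_of M" using r(3) 1(2) 2(2) by (meson Un_least order_trans)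
  qed (simp_all only: 1(3) 2(3) sat_subst \<tau> r(1,2) tval.simps)
qed

lemma definable_term_merge:
  assumes "term_definable M t" "\<And>e y. Q e y \<longleftrightarrow> sat M (case_nat y (\<lambda>n. ev e (\<tau>\<^sub>1 n))) r \<phi>"
    "\<phi> \<in> K" "ren_closed K"
  obtains s \<psi> \<tau> where "\<psi> \<in> K" "\<And>e. t e = tval M (\<lambda>n. ev e (\<tau> n)) s"
    "\<And>e y. Q e y \<longleftrightarrow> sat M (case_nat y (\<lambda>n. ev e (\<tau> n))) r \<psi>"
proof -
  obtain s \<tau>\<^sub>2 where t: "\<And>e. t e = tval M (\<lambda>n. ev e (\<tau>\<^sub>2 n)) s"
    using assms(1) unfolding term_definable_def by auto
  obtain \<tau> where \<tau>: "\<tau>\<^sub>1 = (\<lambda>n. \<tau> (2 * n))" "\<tau>\<^sub>2 = (\<lambda>n. \<tau> (2 * n + 1))" by (rule interleave)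
  have *: "(\<lambda>n. tval M (case_nat y (\<lambda>n. ev e (\<tau> n))) (V (case_nat 0 (\<lambda>n. Suc (2 * n)) n))) =
      case_nat y (\<lambda>n. ev e (\<tau>\<^sub>1 n))" for e y
    by (rule ext) (simp add: \<tau> split: nat.split)
  show ?thesis
  proof (rule that)
    show "subst (\<lambda>n. V (case_nat 0 (\<lambda>n. Suc (2 * n)) n)) (\<lambda>n. n) \<phi> \<in> K"
      using assms(4,3) by (rule ren_closedD)
    show "t e = tval M (\<lambda>n. ev e (\<tau> n)) (subst_tm (\<lambda>n. V (2 * n + 1)) s)" for e
      by (simp add: t tval_subst_tm \<tau>)
  qed (simp only: assms(2) sat_subst *)
qed

lemma definable_bind:
  assumes "definable M K (\<lambda>e. Q (\<lambda>n. e (Suc n)) (e 0))" "ren_closed K"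
  obtains \<phi> \<tau> r where "\<phi> \<in> K" "range r \<subseteq> sets_of M"
    "\<And>e y. Q e y \<longleftrightarrow> sat M (case_nat y (\<lambda>n. ev e (\<tau> n))) r \<phi>"
proof -
  obtain \<phi> \<tau> r where 1: "\<phi> \<in> K" "range r \<subseteq> sets_of M"
      "\<And>e. Q (\<lambda>n. e (Suc n)) (e 0) \<longleftrightarrow> sat M (\<lambda>n. ev e (\<tau> n)) r \<phi>"
    using assms(1) unfolding definable_def by auto
  \<comment> \<open>Several variables of the formula may stand for variable 0 of the environment.
    They are all identified with index 0, which a quantifier can then bind.\<close>
  define f where "f n = (if \<tau> n = Inr 0 then 0 else Suc n)" for n
  \<comment> \<open>If \<open>\<tau> n = Inr 0\<close>, the value \<open>Inr (0 - 1)\<close> is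
    never looked up, because \<open>f\<close> does not take the value \<open>Suc n\<close>.\<close>
  define \<tau>' :: "nat \<Rightarrow> 'a + nat" where "\<tau>' n = (case \<tau> n of Inl a \<Rightarrow> Inl a | Inr m \<Rightarrow> Inr (m - 1))" for n
  have *: "(\<lambda>n. tval M (case_nat y (\<lambda>n. ev e (\<tau>' n))) (V (f n))) = (\<lambda>n. ev (case_nat y e) (\<tau> n))" for e y
    by (rule ext) (auto simp: f_def \<tau>'_def split: sum.split nat.split)
  show ?thesis
  proof (rule that)
    show "subst (\<lambda>n. V (f n)) (\<lambda>n. n) \<phi> \<in> K" using assms(2) 1(1) by (rule ren_closedD)
    show "Q e y \<longleftrightarrow> sat M (case_nat y (\<lambda>n. ev e (\<tau>' n))) r (subst (\<lambda>n. V (f n)) (\<lambda>n. n) \<phi>)" for e y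
      using 1(3)[of "case_nat y e"] by (simp only: sat_subst * nat.case)
  qed (rule 1(2))
qed

text \<open>A formula mentions finitely many variables. This allows, over arithmetical
  comprehension, merging all relevant variables into one by pairing.\<close>

lemma definable_cong_vars:
  assumes "definable M K P"
  obtains k where "\<And>e e'. (\<And>n. n < k \<Longrightarrow> e n = e' n) \<Longrightarrow> P e \<longleftrightarrow> P e'"
proof -
  obtain \<phi> \<tau> r where 1: "\<And>e. P e \<longleftrightarrow> sat M (\<lambda>n. ev e (\<tau> n)) r \<phi>"
    using assms unfolding definable_def by auto
  define k where "k = Suc (Max ({0} \<union> {m. \<exists>n<bound \<phi>. \<tau> n = Inr m}))"
  have fin: "finite {m. \<exists>n<bound \<phi>. \<tau> n = Inr m}"
  proof (rule finite_subset)
    show "{m. \<exists>n<bound \<phi>. \<tau> n = Inr m} \<subseteq> projr ` \<tau> ` {..<bound \<phi>}" by force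
  qed simp
  show ?thesis
  proof (rule that)
    fix e e' :: "nat \<Rightarrow> 'a" assume e: "\<And>n. n < k \<Longrightarrow> e n = e' n"
    have "ev e (\<tau> n) = ev e' (\<tau> n)" if "n < bound \<phi>" for n
    proof (cases "\<tau> n")
      case (Inr m)
      then have "m \<le> Max ({0} \<union> {m. \<exists>n<bound \<phi>. \<tau> n = Inr m})" using fin that by (intro Max_ge) auto
      then show ?thesis using Inr e by (simp add: k_def)
    qed simp
    then show "P e \<longleftrightarrow> P e'" unfolding 1 by (rule sat_cong[OF free_below_bound]) simp_all
  qed
qed

lemma definable_rename:
  assumes "definable M K P" shows "definable M K (\<lambda>e. P (\<lambda>n. ev e (\<tau> n)))"
proof -
  obtain \<phi> \<tau>\<^sub>1 r where 1: "\<phi> \<in> K" "range r \<subseteq> sets_of M" "\<And>e. P e \<longleftrightarrow> sat M (\<lambda>n. ev e (\<tau>\<^sub>1 n)) r \<phi>"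
    using assms(1) unfolding definable_def by auto
  have "ev (\<lambda>n. ev e (\<tau> n)) v = ev e (case v of Inl a \<Rightarrow> Inl a | Inr n \<Rightarrow> \<tau> n)" for e v
    by (simp split: sum.split)
  then have "P (\<lambda>n. ev e (\<tau> n)) \<longleftrightarrow> sat M (\<lambda>n. ev e (case \<tau>\<^sub>1 n of Inl a \<Rightarrow> Inl a | Inr n \<Rightarrow> \<tau> n)) r \<phi>" for e
    using 1(3)[of "\<lambda>n. ev e (\<tau> n)"] by simp
  then show ?thesis unfolding definable_def using 1(1,2)
    by (intro bexI[of _ \<phi>] exI[of _ "\<lambda>n. case \<tau>\<^sub>1 n of Inl a \<Rightarrow> Inl a | Inr n \<Rightarrow> \<tau> n"] exI[of _ r]) auto
qed

lemma term_definable_var: "term_definable M (\<lambda>e. e n)"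
  unfolding term_definable_def by (rule exI[of _ "V n"], rule exI[of _ Inr]) simp

lemma term_definable_const: "term_definable M (\<lambda>e. a)"
  unfolding term_definable_def by (rule exI[of _ "V 0"], rule exI[of _ "\<lambda>n. Inl a"]) simp

lemma term_definable_merge:
  assumes "term_definable M s" "term_definable M t"
  obtains s' t' \<tau> where "\<And>e. s e = tval M (\<lambda>n. ev e (\<tau> n)) s'" "\<And>e. t e = tval M (\<lambda>n. ev e (\<tau> n)) t'"
proof -
  obtain s' \<tau>\<^sub>1 t' \<tau>\<^sub>2 where st: "\<And>e. s e = tval M (\<lambda>n. ev e (\<tau>\<^sub>1 n)) s'" "\<And>e. t e = tval M (\<lambda>n. ev e (\<tau>\<^sub>2 n)) t'"
    using assms unfolding term_definable_def by auto
  obtain \<tau> where \<tau>: "\<tau>\<^sub>1 = (\<lambda>n. \<tau> (2 * n))" "\<tau>\<^sub>2 = (\<lambda>n. \<tau> (2 * n + 1))" by (rule interleave)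
  show ?thesis
    by (rule that[of \<tau> "subst_tm (\<lambda>n. V (2 * n)) s'" "subst_tm (\<lambda>n. V (2 * n + 1)) t'"])
      (simp_all add: st tval_subst_tm \<tau>)
qed

lemma term_definable_add: "term_definable M s \<Longrightarrow> term_definable M t \<Longrightarrow> term_definable M (\<lambda>e. add_of M (s e) (t e))"
proof -
  assume "term_definable M s" "term_definable M t"
  then obtain s' t' \<tau> where "\<And>e. s e = tval M (\<lambda>n. ev e (\<tau> n)) s'" "\<And>e. t e = tval M (\<lambda>n. ev e (\<tau> n)) t'"
    by (rule term_definable_merge) (rule that; assumption)
  then show ?thesis unfolding term_definable_def by (intro exI[of _ "s' \<^bold>+ t'"] exI[of _ \<tau>]) simp
qed

lemma term_definable_mul: "term_definable M s \<Longrightarrow> term_definable M t \<Longrightarrow> term_definable M (\<lambda>e. mul_of M (s e) (t e))"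
proof -
  assume "term_definable M s" "term_definable M t"
  then obtain s' t' \<tau> where "\<And>e. s e = tval M (\<lambda>n. ev e (\<tau> n)) s'" "\<And>e. t e = tval M (\<lambda>n. ev e (\<tau> n)) t'"
    by (rule term_definable_merge) (rule that; assumption)
  then show ?thesis unfolding term_definable_def by (intro exI[of _ "s' \<^bold>* t'"] exI[of _ \<tau>]) simp
qed

lemma Delta0_Neg: "\<phi> \<in> Delta0 \<Longrightarrow> (\<^bold>\<not>\<phi>) \<in> Delta0"
  by (simp add: Neg_def Delta0.intros)

context
  fixes M :: "'m struct"
  assumes sets: "sets_of M \<noteq> {}"
begin

lemma some_sets: obtains A where "A \<in> sets_of M"
  using sets by blast

lemma Delta0_eq:
  assumes "term_definable M s" "term_definable M t"
  shows "definable M Delta0 (\<lambda>e. s e = t e)"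
proof -
  obtain s' t' \<tau> where *: "\<And>e. s e = tval M (\<lambda>n. ev e (\<tau> n)) s'" "\<And>e. t e = tval M (\<lambda>n. ev e (\<tau> n)) t'"
    by (rule term_definable_merge[OF assms]) (rule that; assumption)
  obtain A where "A \<in> sets_of M" by (rule some_sets)
  then show ?thesis unfolding definable_def
    by (intro bexI[of _ "s' \<^bold>= t'"] exI[of _ \<tau>] exI[of _ "\<lambda>n. A"]) (auto simp: * Delta0.intros)
qed

lemma Delta0_less:
  assumes "term_definable M s" "term_definable M t"
  shows "definable M Delta0 (\<lambda>e. less_of M (s e) (t e))"
proof -
  obtain s' t' \<tau> where *: "\<And>e. s e = tval M (\<lambda>n. ev e (\<tau> n)) s'" "\<And>e. t e = tval M (\<lambda>n. ev e (\<tau> n)) t'"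
    by (rule term_definable_merge[OF assms]) (rule that; assumption)
  obtain A where "A \<in> sets_of M" by (rule some_sets)
  then show ?thesis unfolding definable_def
    by (intro bexI[of _ "s' \<^bold>< t'"] exI[of _ \<tau>] exI[of _ "\<lambda>n. A"]) (auto simp: * Delta0.intros)
qed

lemma Delta0_mem:
  assumes "term_definable M t" "A \<in> sets_of M"
  shows "definable M Delta0 (\<lambda>e. t e \<in> A)"
proof -
  obtain t' \<tau> where *: "\<And>e. t e = tval M (\<lambda>n. ev e (\<tau> n)) t'"
    using assms(1) unfolding term_definable_def by auto
  then show ?thesis unfolding definable_def using assms(2)
    by (intro bexI[of _ "t' \<^bold>\<in> 0"] exI[of _ \<tau>] exI[of _ "\<lambda>n. A"]) (auto simp: * Delta0.intros)
qed

lemma Delta0_False: "definable M Delta0 (\<lambda>e. False)"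
proof -
  obtain A where "A \<in> sets_of M" by (rule some_sets)
  then show ?thesis unfolding definable_def
    by (intro bexI[of _ "\<^bold>\<bottom>"] exI[of _ "\<lambda>n. Inr n"] exI[of _ "\<lambda>n. A"]) (auto simp: Delta0.intros)
qed

lemma Delta0_imp:
  assumes "definable M Delta0 P" "definable M Delta0 Q"
  shows "definable M Delta0 (\<lambda>e. P e \<longrightarrow> Q e)"
proof -
  obtain \<phi> \<psi> \<tau> r where "\<phi> \<in> Delta0" "\<psi> \<in> Delta0" "range r \<subseteq> sets_of M"
    "\<And>e. P e \<longleftrightarrow> sat M (\<lambda>n. ev e (\<tau> n)) r \<phi>" "\<And>e. Q e \<longleftrightarrow> sat M (\<lambda>n. ev e (\<tau> n)) r \<psi>"
    by (rule definable_merge[OF assms ren_closed_Delta0 ren_closed_Delta0]) (rule that; assumption)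
  then show ?thesis unfolding definable_def
    by (intro bexI[of _ "\<phi> \<^bold>\<longrightarrow> \<psi>"] exI[of _ \<tau>] exI[of _ r]) (auto simp: Delta0.intros)
qed

lemma Delta0_not: "definable M Delta0 P \<Longrightarrow> definable M Delta0 (\<lambda>e. \<not> P e)"
  using Delta0_imp[of P "\<lambda>e. False"] Delta0_False by simp

lemma Delta0_disj: "definable M Delta0 P \<Longrightarrow> definable M Delta0 Q \<Longrightarrow> definable M Delta0 (\<lambda>e. P e \<or> Q e)"
  using Delta0_imp[of "\<lambda>e. \<not> P e" Q] Delta0_not by (simp add: imp_conv_disj)

lemma Delta0_conj: "definable M Delta0 P \<Longrightarrow> definable M Delta0 Q \<Longrightarrow> definable M Delta0 (\<lambda>e. P e \<and> Q e)"
  using Delta0_not[OF Delta0_disj[of "\<lambda>e. \<not> P e" "\<lambda>e. \<not> Q e"]] Delta0_not by simp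

text \<open>The convention of all quantifier rules to come: in the premise the bound variable is
  \<open>e 0\<close> and the old environment is \<open>e\<close> shifted by one. The conclusion is a
  higher-order pattern, so \<open>intro\<close> can apply the rules guided by the syntax of the
  predicate.\<close>

lemma Delta0_all:
  assumes "term_definable M t" "definable M Delta0 (\<lambda>e. Q (\<lambda>n. e (Suc n)) (e 0))"
  shows "definable M Delta0 (\<lambda>e. \<forall>y. less_of M y (t e) \<longrightarrow> Q e y)"
proof -
  obtain \<phi> \<tau>\<^sub>1 r where 1: "\<phi> \<in> Delta0" "range r \<subseteq> sets_of M"
    "\<And>e y. Q e y \<longleftrightarrow> sat M (case_nat y (\<lambda>n. ev e (\<tau>\<^sub>1 n))) r \<phi>"
    by (rule definable_bind[OF assms(2) ren_closed_Delta0]) (rule that; assumption)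
  obtain s \<psi> \<tau> where 2: "\<psi> \<in> Delta0" "\<And>e. t e = tval M (\<lambda>n. ev e (\<tau> n)) s"
    "\<And>e y. Q e y \<longleftrightarrow> sat M (case_nat y (\<lambda>n. ev e (\<tau> n))) r \<psi>"
    by (rule definable_term_merge[OF assms(1) 1(3,1) ren_closed_Delta0]) (rule that; assumption)
  show ?thesis unfolding definable_def
    by (intro bexI[of _ "\<^bold>\<forall>(V 0 \<^bold>< \<up>s \<^bold>\<longrightarrow> \<psi>)"] exI[of _ \<tau>] exI[of _ r])
      (auto simp: 1(2) 2 Delta0.intros)
qed

lemma Sigma1_iff:
  "definable M Sigma1 P \<longleftrightarrow>
    (\<exists>Q. definable M Delta0 (\<lambda>e. Q (\<lambda>n. e (Suc n)) (e 0)) \<and> (\<forall>e. P e \<longleftrightarrow> (\<exists>y. Q e y)))"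
proof
  assume "definable M Sigma1 P"
  then obtain \<theta> \<tau> r where 1: "\<theta> \<in> Delta0" "range r \<subseteq> sets_of M" "\<And>e. P e \<longleftrightarrow> sat M (\<lambda>n. ev e (\<tau> n)) r (\<^bold>\<exists>\<theta>)"
    unfolding definable_def Sigma1_def by auto
  define \<tau>' :: "nat \<Rightarrow> 'm + nat" where "\<tau>' = case_nat (Inr 0) (\<lambda>n. case \<tau> n of Inl a \<Rightarrow> Inl a | Inr m \<Rightarrow> Inr (Suc m))"
  have "(\<lambda>n. ev e (\<tau>' n)) = case_nat (e 0) (\<lambda>n. ev (\<lambda>n. e (Suc n)) (\<tau> n))" for e
    by (rule ext) (simp add: \<tau>'_def split: nat.split sum.split)
  then have "definable M Delta0 (\<lambda>e. sat M (case_nat (e 0) (\<lambda>n. ev (\<lambda>n. e (Suc n)) (\<tau> n))) r \<theta>)"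
    unfolding definable_def using 1(1,2) by (intro bexI[of _ \<theta>] exI[of _ \<tau>'] exI[of _ r]) auto
  then show "\<exists>Q. definable M Delta0 (\<lambda>e. Q (\<lambda>n. e (Suc n)) (e 0)) \<and> (\<forall>e. P e \<longleftrightarrow> (\<exists>y. Q e y))"
    using 1(3) by (intro exI[of _ "\<lambda>e y. sat M (case_nat y (\<lambda>n. ev e (\<tau> n))) r \<theta>"]) auto
next
  assume "\<exists>Q. definable M Delta0 (\<lambda>e. Q (\<lambda>n. e (Suc n)) (e 0)) \<and> (\<forall>e. P e \<longleftrightarrow> (\<exists>y. Q e y))"
  then obtain Q where Q: "definable M Delta0 (\<lambda>e. Q (\<lambda>n. e (Suc n)) (e 0))" "\<And>e. P e \<longleftrightarrow> (\<exists>y. Q e y)" by auto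
  obtain \<phi> \<tau> r where 1: "\<phi> \<in> Delta0" "range r \<subseteq> sets_of M"
    "\<And>e y. Q e y \<longleftrightarrow> sat M (case_nat y (\<lambda>n. ev e (\<tau> n))) r \<phi>"
    by (rule definable_bind[OF Q(1) ren_closed_Delta0]) (rule that; assumption)
  then show "definable M Sigma1 P"
    unfolding definable_def Sigma1_def using Q(2)
    by (intro bexI[of _ "\<^bold>\<exists>\<phi>"] exI[of _ \<tau>] exI[of _ r]) auto
qed

lemma Sigma1_exI:
  "definable M Delta0 (\<lambda>e. Q (\<lambda>n. e (Suc n)) (e 0)) \<Longrightarrow> definable M Sigma1 (\<lambda>e. \<exists>y. Q e y)"
  unfolding Sigma1_iff by auto

lemma Delta0_lift: "definable M Delta0 P \<Longrightarrow> definable M Delta0 (\<lambda>e. P (\<lambda>n. e (Suc n)))"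
  using definable_rename[of M Delta0 P "\<lambda>n. Inr (Suc n)"] by simp

lemma Delta0_Sigma1: "definable M Delta0 P \<Longrightarrow> definable M Sigma1 P"
  using Sigma1_exI[of "\<lambda>e y. P e"] Delta0_lift[of P] by simp

text \<open>Turns the axiom scheme on formulas into induction for a predicate of the metalogic, its
  parameters being absorbed by the assignment.\<close>

lemma Sigma1_induct:
  assumes ind: "\<And>\<phi>. \<phi> \<in> Sigma1 \<Longrightarrow> valid_in M (induction_for \<phi>)"
    and P: "definable M Sigma1 (\<lambda>e. P (e 0))" "P (zero_of M)"
    and step: "\<And>x. P x \<Longrightarrow> P (add_of M x (one_of M))"
  shows "P x"
proof -
  obtain \<phi> \<tau> r where 1: "\<phi> \<in> Sigma1" "range r \<subseteq> sets_of M"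
    "\<And>e y. P y \<longleftrightarrow> sat M (case_nat y (\<lambda>n. ev e (\<tau> n))) r \<phi>"
    by (rule definable_bind[of M Sigma1 "\<lambda>e. P", OF P(1) ren_closed_Sigma1]) (rule that; assumption)
  fix e :: "nat \<Rightarrow> 'm"
  let ?e = "\<lambda>n. ev e (\<tau> n)"
  have "sat M ?e r (induction_for \<phi>)" using ind[OF 1(1)] 1(2) unfolding valid_in_def by blast
  moreover have "sat M ?e r (inst t \<phi>) \<longleftrightarrow> P (tval M ?e t)" for t
  proof -
    have "(\<lambda>n. tval M ?e (case_nat t V n)) = case_nat (tval M ?e t) ?e"
      by (rule ext) (simp split: nat.split)
    then show ?thesis by (simp add: inst_def sat_subst 1(3)[of _ e])
  qed
  moreover have "sat M (case_nat a ?e) r (subst (case_nat (V 0 \<^bold>+ \<^bold>1) (\<lambda>n. V (Suc n))) (\<lambda>n. n) \<phi>) \<longleftrightarrow>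
      P (add_of M a (one_of M))" for a
  proof -
    have "(\<lambda>n. tval M (case_nat a ?e) (case_nat (V 0 \<^bold>+ \<^bold>1) (\<lambda>n. V (Suc n)) n)) =
        case_nat (add_of M a (one_of M)) ?e"
      by (rule ext) (simp split: nat.split)
    then show ?thesis by (simp add: sat_subst 1(3)[of _ e])
  qed
  ultimately show "P x" using P(2) step by (simp add: induction_for_def 1(3)[of _ e, symmetric])
qed

text \<open>The axiom asks for a Pi1 equivalent; it arises from the Sigma1 formula for the
  complement by moving the negation through its existential quantifier.\<close>

lemma Delta1_comprehension:
  assumes comp: "\<And>\<phi> \<psi>. \<phi> \<in> Sigma1 \<Longrightarrow> \<psi> \<in> Pi1 \<Longrightarrow> valid_in M ((\<^bold>\<forall>(\<phi> \<^bold>\<longleftrightarrow> \<psi>)) \<^bold>\<longrightarrow> comprehension_for \<phi>)"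
    and P: "definable M Sigma1 (\<lambda>e. P (e 0))" "definable M Sigma1 (\<lambda>e. \<not> P (e 0))"
  shows "{x. P x} \<in> sets_of M"
proof -
  obtain \<phi> \<psi> \<tau> r where 1: "\<phi> \<in> Sigma1" "\<psi> \<in> Sigma1" "range r \<subseteq> sets_of M"
    "\<And>e. P (e 0) \<longleftrightarrow> sat M (\<lambda>n. ev e (\<tau> n)) r \<phi>" "\<And>e. \<not> P (e 0) \<longleftrightarrow> sat M (\<lambda>n. ev e (\<tau> n)) r \<psi>"
    by (rule definable_merge[OF P ren_closed_Sigma1 ren_closed_Sigma1]) (rule that; assumption)
  fix e :: "nat \<Rightarrow> 'm"
  define f where "f n = (if \<tau> n = Inr 0 then 0 else Suc n)" for n
  define e' where "e' n = ev e (\<tau> n)" for n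
  have *: "(\<lambda>n. tval M (case_nat y e') (V (f n))) = (\<lambda>n. ev (e(0 := y)) (\<tau> n))" for y
  proof
    fix n show "tval M (case_nat y e') (V (f n)) = ev (e(0 := y)) (\<tau> n)"
      by (cases "\<tau> n") (auto simp: f_def e'_def)
  qed
  define \<phi>' \<psi>' where "\<phi>' = subst (\<lambda>n. V (f n)) (\<lambda>n. n) \<phi>" and "\<psi>' = subst (\<lambda>n. V (f n)) (\<lambda>n. n) \<psi>"
  have \<phi>': "\<phi>' \<in> Sigma1" "\<psi>' \<in> Sigma1"
    unfolding \<phi>'_def \<psi>'_def using 1(1,2) by (auto intro: ren_closedD[OF ren_closed_Sigma1])
  have s: "sat M (case_nat y e') r \<phi>' \<longleftrightarrow> P y" "sat M (case_nat y e') r \<psi>' \<longleftrightarrow> \<not> P y" for y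
    using 1(4)[of "e(0 := y)"] 1(5)[of "e(0 := y)"] by (simp_all only: \<phi>'_def \<psi>'_def sat_subst * fun_upd_same)
  obtain \<theta> where \<theta>: "\<theta> \<in> Delta0" "\<psi>' = (\<^bold>\<exists>\<theta>)" using \<phi>'(2) unfolding Sigma1_def by auto
  have "(\<^bold>\<forall>(\<^bold>\<not>\<theta>)) \<in> Pi1" unfolding Pi1_def using Delta0_Neg[OF \<theta>(1)] by blast
  then have "valid_in M ((\<^bold>\<forall>(\<phi>' \<^bold>\<longleftrightarrow> \<^bold>\<forall>(\<^bold>\<not>\<theta>))) \<^bold>\<longrightarrow> comprehension_for \<phi>')" using comp[OF \<phi>'(1)] by blast
  then have "sat M e' r ((\<^bold>\<forall>(\<phi>' \<^bold>\<longleftrightarrow> \<^bold>\<forall>(\<^bold>\<not>\<theta>))) \<^bold>\<longrightarrow> comprehension_for \<phi>')"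
    using 1(3) unfolding valid_in_def by blast
  moreover have "sat M e' r (\<^bold>\<forall>(\<phi>' \<^bold>\<longleftrightarrow> \<^bold>\<forall>(\<^bold>\<not>\<theta>)))" using s(2) by (auto simp: s(1) \<theta>(2))
  ultimately have "\<exists>A\<in>sets_of M. \<forall>y. y \<in> A \<longleftrightarrow> P y"
    by (simp add: comprehension_for_def slift_def sat_subst s)
  then obtain A where "A \<in> sets_of M" "\<forall>y. y \<in> A \<longleftrightarrow> P y" by (rule bexE)
  moreover from this(2) have "A = {x. P x}" by auto
  ultimately show ?thesis by simp
qed

end

section \<open>Arithmetic in models\<close>

definition rca0_model :: "'m struct \<Rightarrow> bool" where
  "rca0_model M \<longleftrightarrow> sets_of M \<noteq> {} \<and> (\<forall>\<phi>\<in>RCA0. valid_in M \<phi>)"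

text \<open>The theory PA without induction, that is, the nonnegative parts of discretely ordered
  rings. Being a condition on bare operations, it can be stated before the domain is made an
  instance of a class.\<close>

definition pa_minus :: "'m struct \<Rightarrow> bool" where
  "pa_minus M \<longleftrightarrow> (case M of Struct z i add mul lt _ \<Rightarrow>
     (\<forall>x y w. add (add x y) w = add x (add y w)) \<and> (\<forall>x y. add x y = add y x) \<and> (\<forall>x. add z x = x) \<and>
     (\<forall>x y w. mul (mul x y) w = mul x (mul y w)) \<and> (\<forall>x y. mul x y = mul y x) \<and> (\<forall>x. mul i x = x) \<and>
     (\<forall>x. mul z x = z) \<and> (\<forall>x y w. mul (add x y) w = add (mul x w) (mul y w)) \<and>
     (\<forall>x y w. add x y = add x w \<longrightarrow> y = w) \<and> (\<forall>x. add x i \<noteq> z) \<and> (\<forall>x. x = z \<or> (\<exists>y. x = add y i)) \<and>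
     (\<forall>x y. lt x y \<longleftrightarrow> (\<exists>d. y = add x (add d i))) \<and> (\<forall>x y. lt x y \<or> x = y \<or> lt y x))"

locale rca0_struct =
  fixes M :: "'m struct"
  assumes rca0: "rca0_model M"
begin

lemma sets_nonempty: "sets_of M \<noteq> {}"
  using rca0 by (simp add: rca0_model_def)

lemma valid:
  "\<phi> \<in> basic_axioms \<Longrightarrow> valid_in M \<phi>"
  "\<phi> \<in> Sigma1 \<Longrightarrow> valid_in M (induction_for \<phi>)"
  "\<phi> \<in> Sigma1 \<Longrightarrow> \<psi> \<in> Pi1 \<Longrightarrow> valid_in M ((\<^bold>\<forall>(\<phi> \<^bold>\<longleftrightarrow> \<psi>)) \<^bold>\<longrightarrow> comprehension_for \<phi>)"
proof -
  have *: "\<forall>\<phi>\<in>basic_axioms \<union> {induction_for \<phi> | \<phi>. \<phi> \<in> Sigma1}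
     \<union> {(\<^bold>\<forall>(\<phi> \<^bold>\<longleftrightarrow> \<psi>)) \<^bold>\<longrightarrow> comprehension_for \<phi> | \<phi> \<psi>. \<phi> \<in> Sigma1 \<and> \<psi> \<in> Pi1}. valid_in M \<phi>"
    using rca0 unfolding rca0_model_def RCA0_def valid_closures_iff by simp
  show "\<phi> \<in> basic_axioms \<Longrightarrow> valid_in M \<phi>" by (rule *[rule_format]) simp
  show "\<phi> \<in> Sigma1 \<Longrightarrow> valid_in M (induction_for \<phi>)" by (rule *[rule_format]) auto
  show "\<phi> \<in> Sigma1 \<Longrightarrow> \<psi> \<in> Pi1 \<Longrightarrow> valid_in M ((\<^bold>\<forall>(\<phi> \<^bold>\<longleftrightarrow> \<psi>)) \<^bold>\<longrightarrow> comprehension_for \<phi>)"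
    by (rule *[rule_format]) auto
qed

lemma sigma1_induct:
  assumes "definable M Sigma1 (\<lambda>e. P (e 0))" "P (zero_of M)" "\<And>x. P x \<Longrightarrow> P (add_of M x (one_of M))"
  shows "P x"
  by (rule Sigma1_induct[OF sets_nonempty valid(2), of P]) (use assms in auto)

lemma delta1_comprehension:
  assumes "definable M Sigma1 (\<lambda>e. P (e 0))" "definable M Sigma1 (\<lambda>e. \<not> P (e 0))"
  shows "{x. P x} \<in> sets_of M"
  by (rule Delta1_comprehension[OF sets_nonempty valid(3), of P]) (use assms in auto)

lemmas delta0_rules = Delta0_eq[OF sets_nonempty] Delta0_less[OF sets_nonempty] Delta0_mem[OF sets_nonempty]
  Delta0_imp[OF sets_nonempty] Delta0_not[OF sets_nonempty] Delta0_disj[OF sets_nonempty]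
  Delta0_conj[OF sets_nonempty] Delta0_all[OF sets_nonempty] term_definable_var
  term_definable_add term_definable_mul term_definable_const

lemmas sigma1_ex = Sigma1_exI[OF sets_nonempty]
lemmas delta0_sigma1 = Delta0_Sigma1[OF sets_nonempty]

abbreviation m_zero ("\<zero>") where "\<zero> \<equiv> zero_of M"
abbreviation m_one ("\<one>") where "\<one> \<equiv> one_of M"
abbreviation m_add (infixl "\<oplus>" 65) where "x \<oplus> y \<equiv> add_of M x y"
abbreviation m_mul (infixl "\<otimes>" 70) where "x \<otimes> y \<equiv> mul_of M x y"
abbreviation m_less (infix "\<prec>" 50) where "x \<prec> y \<equiv> less_of M x y"

lemma basic:
  "x \<oplus> \<one> \<noteq> \<zero>" "x \<oplus> \<one> = y \<oplus> \<one> \<Longrightarrow> x = y" "x \<oplus> \<zero> = x" "x \<oplus> (y \<oplus> \<one>) = (x \<oplus> y) \<oplus> \<one>"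
  "x \<otimes> \<zero> = \<zero>" "x \<otimes> (y \<oplus> \<one>) = (x \<otimes> y) \<oplus> x" "\<not> x \<prec> \<zero>" "x \<prec> y \<oplus> \<one> \<longleftrightarrow> x \<prec> y \<or> x = y"
proof -
  obtain A where A: "A \<in> sets_of M" using sets_nonempty by blast
  let ?e = "case_nat x (\<lambda>n. y)"
  have "range (\<lambda>n::nat. A) \<subseteq> sets_of M" using A by auto
  then have "\<forall>\<phi>\<in>basic_axioms. sat M ?e (\<lambda>n. A) \<phi>" using valid(1) unfolding valid_in_def by simp
  then have *: "x \<oplus> \<one> \<noteq> \<zero> \<and> (x \<oplus> \<one> = y \<oplus> \<one> \<longrightarrow> x = y) \<and> x \<oplus> \<zero> = x \<and> x \<oplus> (y \<oplus> \<one>) = (x \<oplus> y) \<oplus> \<one> \<and>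
      x \<otimes> \<zero> = \<zero> \<and> x \<otimes> (y \<oplus> \<one>) = (x \<otimes> y) \<oplus> x \<and> \<not> x \<prec> \<zero> \<and> (x \<prec> y \<oplus> \<one> \<longleftrightarrow> x \<prec> y \<or> x = y)"
    by (simp add: basic_axioms_def)
  show "x \<oplus> \<one> \<noteq> \<zero>" "x \<oplus> \<one> = y \<oplus> \<one> \<Longrightarrow> x = y" "x \<oplus> \<zero> = x" "x \<oplus> (y \<oplus> \<one>) = (x \<oplus> y) \<oplus> \<one>"
    "x \<otimes> \<zero> = \<zero>" "x \<otimes> (y \<oplus> \<one>) = (x \<otimes> y) \<oplus> x" "\<not> x \<prec> \<zero>" "x \<prec> y \<oplus> \<one> \<longleftrightarrow> x \<prec> y \<or> x = y"
    using * by (elim conjE, assumption | blast)+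
qed

lemmas basic_simps = basic(1,3-8)

lemma delta0_induct:
  assumes "definable M Delta0 (\<lambda>e. P (e 0))" "P \<zero>" "\<And>x. P x \<Longrightarrow> P (x \<oplus> \<one>)"
  shows "P x"
  by (rule sigma1_induct[of P]) (use delta0_sigma1[OF assms(1)] assms(2,3) in auto)

lemma zero_add: "\<zero> \<oplus> x = x"
proof (rule delta0_induct[of "\<lambda>x. \<zero> \<oplus> x = x"])
  show "definable M Delta0 (\<lambda>e. \<zero> \<oplus> e 0 = e 0)" by (intro delta0_rules)
qed (simp_all add: basic_simps)

lemma suc_add: "(x \<oplus> \<one>) \<oplus> y = (x \<oplus> y) \<oplus> \<one>"
proof (rule delta0_induct[of "\<lambda>y. (x \<oplus> \<one>) \<oplus> y = (x \<oplus> y) \<oplus> \<one>"])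
  show "definable M Delta0 (\<lambda>e. (x \<oplus> \<one>) \<oplus> e 0 = (x \<oplus> e 0) \<oplus> \<one>)" by (intro delta0_rules)
qed (simp_all add: basic_simps)

lemma add_comm: "x \<oplus> y = y \<oplus> x"
proof (rule delta0_induct[of "\<lambda>x. x \<oplus> y = y \<oplus> x"])
  show "definable M Delta0 (\<lambda>e. e 0 \<oplus> y = y \<oplus> e 0)" by (intro delta0_rules)
qed (simp_all add: basic_simps zero_add suc_add)

lemma add_assoc: "(x \<oplus> y) \<oplus> w = x \<oplus> (y \<oplus> w)"
proof (rule delta0_induct[of "\<lambda>w. (x \<oplus> y) \<oplus> w = x \<oplus> (y \<oplus> w)"])
  show "definable M Delta0 (\<lambda>e. (x \<oplus> y) \<oplus> e 0 = x \<oplus> (y \<oplus> e 0))" by (intro delta0_rules)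
qed (simp_all add: basic_simps)

lemma add_left_comm: "x \<oplus> (y \<oplus> w) = y \<oplus> (x \<oplus> w)"
  by (metis add_comm add_assoc)

lemmas add_ac = add_assoc add_comm add_left_comm

lemma zero_mul: "\<zero> \<otimes> x = \<zero>"
proof (rule delta0_induct[of "\<lambda>x. \<zero> \<otimes> x = \<zero>"])
  show "definable M Delta0 (\<lambda>e. \<zero> \<otimes> e 0 = \<zero>)" by (intro delta0_rules)
qed (simp_all add: basic_simps)

lemma suc_mul: "(x \<oplus> \<one>) \<otimes> y = (x \<otimes> y) \<oplus> y"
proof (rule delta0_induct[of "\<lambda>y. (x \<oplus> \<one>) \<otimes> y = (x \<otimes> y) \<oplus> y"])
  show "definable M Delta0 (\<lambda>e. (x \<oplus> \<one>) \<otimes> e 0 = (x \<otimes> e 0) \<oplus> e 0)" by (intro delta0_rules)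
  show "(x \<oplus> \<one>) \<otimes> (y \<oplus> \<one>) = (x \<otimes> (y \<oplus> \<one>)) \<oplus> (y \<oplus> \<one>)" if "(x \<oplus> \<one>) \<otimes> y = (x \<otimes> y) \<oplus> y" for y
    using that unfolding basic(6) by (simp add: add_ac)
qed (simp_all add: basic_simps)

lemma mul_comm: "x \<otimes> y = y \<otimes> x"
proof (rule delta0_induct[of "\<lambda>x. x \<otimes> y = y \<otimes> x"])
  show "definable M Delta0 (\<lambda>e. e 0 \<otimes> y = y \<otimes> e 0)" by (intro delta0_rules)
qed (simp_all add: basic_simps zero_mul suc_mul)

lemma distrib: "(x \<oplus> y) \<otimes> w = (x \<otimes> w) \<oplus> (y \<otimes> w)"
proof (rule delta0_induct[of "\<lambda>w. (x \<oplus> y) \<otimes> w = (x \<otimes> w) \<oplus> (y \<otimes> w)"])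
  show "definable M Delta0 (\<lambda>e. (x \<oplus> y) \<otimes> e 0 = (x \<otimes> e 0) \<oplus> (y \<otimes> e 0))" by (intro delta0_rules)
  show "(x \<oplus> y) \<otimes> (w \<oplus> \<one>) = (x \<otimes> (w \<oplus> \<one>)) \<oplus> (y \<otimes> (w \<oplus> \<one>))"
    if "(x \<oplus> y) \<otimes> w = (x \<otimes> w) \<oplus> (y \<otimes> w)" for w
    using that unfolding basic(6) by (simp add: add_ac)
qed (simp_all add: basic_simps)

lemma mul_assoc: "(x \<otimes> y) \<otimes> w = x \<otimes> (y \<otimes> w)"
proof (rule delta0_induct[of "\<lambda>w. (x \<otimes> y) \<otimes> w = x \<otimes> (y \<otimes> w)"])
  show "definable M Delta0 (\<lambda>e. (x \<otimes> y) \<otimes> e 0 = x \<otimes> (y \<otimes> e 0))" by (intro delta0_rules)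
  show "(x \<otimes> y) \<otimes> (w \<oplus> \<one>) = x \<otimes> (y \<otimes> (w \<oplus> \<one>))" if "(x \<otimes> y) \<otimes> w = x \<otimes> (y \<otimes> w)" for w
    using that distrib[of "y \<otimes> w" y x] unfolding basic(6) by (simp add: mul_comm)
qed (simp_all add: basic_simps)

lemma one_mul: "\<one> \<otimes> x = x"
  using suc_mul[of \<zero> x] by (simp add: zero_add zero_mul)

lemma add_cancel: "x \<oplus> y = x \<oplus> w \<Longrightarrow> y = w"
proof -
  have "x \<oplus> y = x \<oplus> w \<longrightarrow> y = w"
  proof (rule delta0_induct[of "\<lambda>x. x \<oplus> y = x \<oplus> w \<longrightarrow> y = w"])
    show "definable M Delta0 (\<lambda>e. e 0 \<oplus> y = e 0 \<oplus> w \<longrightarrow> y = w)" by (intro delta0_rules)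
  qed (auto simp: zero_add suc_add dest: basic(2))
  then show "x \<oplus> y = x \<oplus> w \<Longrightarrow> y = w" by simp
qed

lemma zero_or_suc: "x = \<zero> \<or> (\<exists>y. x = y \<oplus> \<one>)"
proof -
  \<comment> \<open>The quantifier is moved in front of the disjunction to obtain a Sigma1 formula
    to which the induction applies.\<close>
  have "\<exists>y. x = \<zero> \<or> x = y \<oplus> \<one>"
  proof (rule sigma1_induct[of "\<lambda>x. \<exists>y. x = \<zero> \<or> x = y \<oplus> \<one>"])
    show "definable M Sigma1 (\<lambda>e. \<exists>y. e 0 = \<zero> \<or> e 0 = y \<oplus> \<one>)" by (intro sigma1_ex delta0_rules)
  qed auto
  then show ?thesis by blast
qed

lemma less_add: "x \<prec> x \<oplus> (d \<oplus> \<one>)"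
proof (rule delta0_induct[of "\<lambda>d. x \<prec> x \<oplus> (d \<oplus> \<one>)"])
  show "definable M Delta0 (\<lambda>e. x \<prec> x \<oplus> (e 0 \<oplus> \<one>))" by (intro delta0_rules)
qed (simp_all add: zero_add basic_simps)

lemma less_imp_add: "x \<prec> y \<Longrightarrow> \<exists>d. y = x \<oplus> (d \<oplus> \<one>)"
proof -
  \<comment> \<open>Again the witness is quantified outside the implication, so that the induction
    formula is Sigma1.\<close>
  have "\<exists>d. x \<prec> y \<longrightarrow> y = x \<oplus> (d \<oplus> \<one>)"
  proof (rule sigma1_induct[of "\<lambda>y. \<exists>d. x \<prec> y \<longrightarrow> y = x \<oplus> (d \<oplus> \<one>)"])
    show "definable M Sigma1 (\<lambda>e. \<exists>d. x \<prec> e 0 \<longrightarrow> e 0 = x \<oplus> (d \<oplus> \<one>))" by (intro sigma1_ex delta0_rules)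
    show "\<exists>d. x \<prec> y \<oplus> \<one> \<longrightarrow> y \<oplus> \<one> = x \<oplus> (d \<oplus> \<one>)" if IH: "\<exists>d. x \<prec> y \<longrightarrow> y = x \<oplus> (d \<oplus> \<one>)" for y
    proof (cases "x = y")
      case True
      then show ?thesis by (intro exI[of _ \<zero>]) (simp add: zero_add)
    next
      case False
      obtain d where "x \<prec> y \<longrightarrow> y = x \<oplus> (d \<oplus> \<one>)" using IH by (rule exE)
      then show ?thesis using False by (intro exI[of _ "d \<oplus> \<one>"]) (simp add: basic_simps)
    qed
  qed (simp add: basic_simps)
  then show "x \<prec> y \<Longrightarrow> \<exists>d. y = x \<oplus> (d \<oplus> \<one>)" by blast
qed

lemma less_iff: "x \<prec> y \<longleftrightarrow> (\<exists>d. y = x \<oplus> (d \<oplus> \<one>))"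
  by (auto intro: less_add dest: less_imp_add)

lemma trichotomy: "x \<prec> y \<or> x = y \<or> y \<prec> x"
proof (rule delta0_induct[of "\<lambda>y. x \<prec> y \<or> x = y \<or> y \<prec> x"])
  show "definable M Delta0 (\<lambda>e. x \<prec> e 0 \<or> x = e 0 \<or> e 0 \<prec> x)" by (intro delta0_rules)
  show "x \<prec> \<zero> \<or> x = \<zero> \<or> \<zero> \<prec> x" using zero_or_suc[of x] less_add[of \<zero>] by (auto simp: zero_add)
  show "x \<prec> y \<oplus> \<one> \<or> x = y \<oplus> \<one> \<or> y \<oplus> \<one> \<prec> x" if "x \<prec> y \<or> x = y \<or> y \<prec> x" for y
  proof -
    have "x = y \<oplus> \<one> \<or> y \<oplus> \<one> \<prec> x" if yx: "y \<prec> x"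
    proof -
      obtain d where d: "x = y \<oplus> (d \<oplus> \<one>)" using less_imp_add[OF yx] by (rule exE)
      show ?thesis
      proof (cases "d = \<zero>")
        case True
        then show ?thesis using d by (simp add: zero_add)
      next
        case False
        then obtain d' where "d = d' \<oplus> \<one>" using zero_or_suc[of d] by auto
        then have "x = (y \<oplus> \<one>) \<oplus> (d' \<oplus> \<one>)" using d by (simp add: add_ac)
        then show ?thesis using less_add by simp
      qed
    qed
    then show ?thesis using that by (auto simp: basic_simps)
  qed
qed

lemma pa_minus: "pa_minus M"
proof -
  have "pa_minus (Struct \<zero> \<one> (add_of M) (mul_of M) (less_of M) (sets_of M))"
    unfolding pa_minus_def struct.case
    by (intro conjI allI impI add_assoc add_comm zero_add mul_assoc mul_comm one_mul zero_mul distrib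
        less_iff trichotomy zero_or_suc basic(1)) (rule add_cancel)
  then show ?thesis by simp
qed

end

section \<open>Number models as a type class\<close>

text \<open>The algebra of \<open>pa_minus\<close> in terms of library classes: discreteness turns
  \<open><\<close> into \<open>\<le>\<close> of the successor, and the canonical order provides
  differences.\<close>

class pnum = discrete_linordered_semidom + canonically_ordered_monoid_add

text \<open>Number models embed into their rings of differences, to which the linear arithmetic of ordered
  rings applies.\<close>

definition diff_eq :: "'m :: pnum \<times> 'm \<Rightarrow> 'm \<times> 'm \<Rightarrow> bool" where
  "diff_eq = (\<lambda>(a, b) (c, d). a + d = c + b)"

lemma equivp_diff_eq: "equivp (diff_eq :: 'm :: pnum \<times> 'm \<Rightarrow> _)"
proof (rule equivpI)
  show "reflp (diff_eq :: 'm \<times> 'm \<Rightarrow> _)" by (auto simp: reflp_def diff_eq_def)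
  show "symp (diff_eq :: 'm \<times> 'm \<Rightarrow> _)" by (auto simp: symp_def diff_eq_def)
  show "transp (diff_eq :: 'm \<times> 'm \<Rightarrow> _)"
  proof (rule transpI, unfold diff_eq_def, clarify)
    fix a b c d e f :: 'm assume "a + d = c + b" "c + f = e + d"
    then have "(a + f) + d = (e + b) + d" by (metis add.assoc add.commute)
    then show "a + f = e + b" by simp
  qed
qed

quotient_type (overloaded) 'm diffs = "'m :: pnum \<times> 'm" / diff_eq
  morphisms Rep_diffs Abs_diffs
  by (rule equivp_diff_eq)

instantiation diffs :: (pnum) comm_ring_1
begin

lift_definition zero_diffs :: "'a diffs" is "(0, 0)" .
lift_definition one_diffs :: "'a diffs" is "(1, 0)" .
lift_definition plus_diffs :: "'a diffs \<Rightarrow> 'a diffs \<Rightarrow> 'a diffs" is "\<lambda>(a, b) (c, d). (a + c, b + d)"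
  by (clarsimp simp: diff_eq_def) (metis (no_types, lifting) add.assoc add.left_commute)
lift_definition uminus_diffs :: "'a diffs \<Rightarrow> 'a diffs" is "\<lambda>(a, b). (b, a)"
  by (clarsimp simp: diff_eq_def add.commute)
lift_definition minus_diffs :: "'a diffs \<Rightarrow> 'a diffs \<Rightarrow> 'a diffs" is "\<lambda>(a, b) (c, d). (a + d, b + c)"
  by (clarsimp simp: diff_eq_def) (metis (no_types, lifting) add.assoc add.left_commute add.commute)
lift_definition times_diffs :: "'a diffs \<Rightarrow> 'a diffs \<Rightarrow> 'a diffs"
  is "\<lambda>(a, b) (c, d). (a * c + b * d, a * d + b * c)"
proof (unfold diff_eq_def, clarify)
  fix a b a' b' c d c' d' :: 'a
  assume 1: "a + b' = a' + b" and 2: "c + d' = c' + d"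
  \<comment> \<open>The left factor is exchanged for its equivalent first and the right factor
    second; the mixed products introduced on the way cancel at the end.\<close>
  have "(a * c + b * d) + (a' * d + b' * c) = (a + b') * c + (a' + b) * d" by (simp add: algebra_simps)
  also have "\<dots> = (a' + b) * c + (a + b') * d" by (simp add: 1)
  finally have 3: "(a * c + b * d) + (a' * d + b' * c) = (a' * c + b' * d) + (a * d + b * c)" by (simp add: algebra_simps)
  have "(a' * c + b' * d) + (a' * d' + b' * c') = a' * (c + d') + b' * (c' + d)" by (simp add: algebra_simps)
  also have "\<dots> = a' * (c' + d) + b' * (c + d')" by (simp add: 2)
  finally have 4: "(a' * c + b' * d) + (a' * d' + b' * c') = (a' * c' + b' * d') + (a' * d + b' * c)" by (simp add: algebra_simps)
  have "((a * c + b * d) + (a' * d' + b' * c')) + ((a' * d + b' * c) + (a' * c + b' * d)) =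
      ((a' * c' + b' * d') + (a * d + b * c)) + ((a' * d + b' * c) + (a' * c + b' * d))"
    using arg_cong2[OF 3 4, of "(+)"] by (simp add: ac_simps)
  then show "a * c + b * d + (a' * d' + b' * c') = a' * c' + b' * d' + (a * d + b * c)" by simp
qed

instance
  by (standard; transfer) (clarsimp simp: diff_eq_def algebra_simps)+

end

instantiation diffs :: (pnum) linordered_idom
begin

lift_definition less_eq_diffs :: "'a diffs \<Rightarrow> 'a diffs \<Rightarrow> bool" is "\<lambda>(a, b) (c, d). a + d \<le> c + b"
proof (unfold diff_eq_def, clarify)
  fix a b a' b' c d c' d' :: 'a
  assume 1: "a + b' = a' + b" and 2: "c + d' = c' + d"
  have "a + d \<le> c + b \<longleftrightarrow> (a + d) + (b' + d') \<le> (c + b) + (b' + d')" by simp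
  also have "(a + d) + (b' + d') = (a' + d') + (b + d)"
    using arg_cong[OF 1, of "\<lambda>t. t + (d + d')"] by (simp add: ac_simps)
  also have "(c + b) + (b' + d') = (c' + b') + (b + d)"
    using arg_cong[OF 2, of "\<lambda>t. t + (b + b')"] by (simp add: ac_simps)
  finally show "a + d \<le> c + b \<longleftrightarrow> a' + d' \<le> c' + b'" by simp
qed

lift_definition less_diffs :: "'a diffs \<Rightarrow> 'a diffs \<Rightarrow> bool" is "\<lambda>(a, b) (c, d). a + d < c + b"
proof (unfold diff_eq_def, clarify)
  fix a b a' b' c d c' d' :: 'a
  assume 1: "a + b' = a' + b" and 2: "c + d' = c' + d"
  have "a + d < c + b \<longleftrightarrow> (a + d) + (b' + d') < (c + b) + (b' + d')" by simp
  also have "(a + d) + (b' + d') = (a' + d') + (b + d)"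
    using arg_cong[OF 1, of "\<lambda>t. t + (d + d')"] by (simp add: ac_simps)
  also have "(c + b) + (b' + d') = (c' + b') + (b + d)"
    using arg_cong[OF 2, of "\<lambda>t. t + (b + b')"] by (simp add: ac_simps)
  finally show "a + d < c + b \<longleftrightarrow> a' + d' < c' + b'" by simp
qed

definition abs_diffs :: "'a diffs \<Rightarrow> 'a diffs" where
  "abs_diffs x = (if x < 0 then - x else x)"

definition sgn_diffs :: "'a diffs \<Rightarrow> 'a diffs" where
  "sgn_diffs x = (if x = 0 then 0 else if 0 < x then 1 else - 1)"

instance
proof
  fix x y z :: "'a diffs"
  show "x < y \<longleftrightarrow> x \<le> y \<and> \<not> y \<le> x" by transfer (clarsimp simp: less_le_not_le)
  show "x \<le> x" by transfer auto
  show "x \<le> z" if "x \<le> y" "y \<le> z"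
    using that
  proof (transfer, clarsimp)
    fix a b c d e f :: 'a assume "a + d \<le> c + b" "c + f \<le> e + d"
    then have "(a + d) + (c + f) \<le> (c + b) + (e + d)" by (rule add_mono)
    then have "(a + f) + (c + d) \<le> (e + b) + (c + d)" by (simp add: ac_simps)
    then show "a + f \<le> e + b" by simp
  qed
  show "x = y" if "x \<le> y" "y \<le> x" using that by transfer (clarsimp simp: diff_eq_def)
  show "x \<le> y \<or> y \<le> x" by transfer auto
  show "z + x \<le> z + y" if "x \<le> y"
    using that
  proof (transfer, clarsimp)
    fix a b c d e f :: 'a assume "c + f \<le> e + d"
    then have "(a + b) + (c + f) \<le> (a + b) + (e + d)" by simp
    then show "a + c + (b + f) \<le> a + e + (b + d)" by (simp add: ac_simps)
  qed
  show "z * x < z * y" if "x < y" "0 < z"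
    using that
  proof (transfer, clarsimp)
    fix a b c d e f :: 'a assume 1: "a + d < c + b" and 2: "f < e"
    obtain k where k: "e = f + k" using 2 by (metis le_iff_add less_imp_le)
    then have "0 < k" using 2 by (metis add.right_neutral less_irrefl zero_less_iff_neq_zero)
    then have "k * (a + d) < k * (c + b)" using 1 by (rule mult_strict_left_mono[rotated])
    then have "f * (a + b + c + d) + k * (a + d) < f * (a + b + c + d) + k * (c + b)" by simp
    then show "e * a + f * b + (e * d + f * c) < e * c + f * d + (e * b + f * a)"
      by (simp add: k algebra_simps)
  qed
  show "\<bar>x\<bar> = (if x < 0 then - x else x)" by (simp add: abs_diffs_def)
  show "sgn x = (if x = 0 then 0 else if 0 < x then 1 else - 1)" by (simp add: sgn_diffs_def)
qed

end

lift_definition emb :: "'m :: pnum \<Rightarrow> 'm diffs" is "\<lambda>a. (a, 0)" .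

lemma emb_0 [simp]: "emb 0 = 0" by transfer (simp add: diff_eq_def)
lemma emb_1 [simp]: "emb 1 = 1" by transfer (simp add: diff_eq_def)
lemma emb_add [simp]: "emb (a + b) = emb a + emb b" by transfer (simp add: diff_eq_def)
lemma emb_mult [simp]: "emb (a * b) = emb a * emb b" by transfer (simp add: diff_eq_def)
lemma emb_eq: "a = b \<longleftrightarrow> emb a = emb b" by transfer (simp add: diff_eq_def)
lemma emb_le: "a \<le> b \<longleftrightarrow> emb a \<le> emb b" by transfer simp
text \<open>Adding 1 makes the discreteness of the order visible to linear arithmetic over the ring
  of differences.\<close>

lemma emb_less: "a < b \<longleftrightarrow> emb a + 1 \<le> emb b"
  by transfer (simp add: less_iff_succ_less_eq)
lemma emb_numeral [simp]: "emb (numeral k) = numeral k"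
  by (induction k) (simp_all only: numeral.simps emb_add emb_1)
lemma emb_nonneg [simp]: "0 \<le> emb a" by transfer simp

text \<open>Unfolding these moves an equation or inequality between numbers into the ordered ring of
  differences.\<close>

lemmas emb_simps = emb_eq emb_le emb_less emb_0 emb_1 emb_add emb_mult emb_numeral

definition std :: "'m :: pnum set set \<Rightarrow> 'm struct" where
  "std S = Struct 0 1 (+) (*) (<) S"

text \<open>A copy of the natural numbers whose order and semiring operations are those of a countermodel
  to the equivalence with this domain, if there is one. So, in the proof by contradiction, the domain
  of the countermodel is an instance of the class of number models.\<close>

typedef mnum = "UNIV :: nat set" ..

instance mnum :: countable
  by standard (metis Rep_mnum_inject injI)

lemma infinite_mnum: "infinite (UNIV :: mnum set)"
proof -
  have "inj Abs_mnum" by (metis Abs_mnum_inject UNIV_I injI)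
  then show ?thesis using finite_subset[OF subset_UNIV] range_inj_infinite by blast
qed

definition countermodel :: "'m struct \<Rightarrow> bool" where
  "countermodel M \<longleftrightarrow> rca0_model M \<and> \<not> (valid_in M HT_ex_ge3_apart \<longleftrightarrow> (\<forall>\<phi>\<in>ACA0. valid_in M \<phi>))"

text \<open>The default structure for the case that there is no countermodel on
  \<open>mnum\<close>.\<close>

lemma pa_minus_nat_copy:
  "pa_minus (Struct (Abs_mnum 0) (Abs_mnum 1) (\<lambda>x y. Abs_mnum (Rep_mnum x + Rep_mnum y))
     (\<lambda>x y. Abs_mnum (Rep_mnum x * Rep_mnum y)) (\<lambda>x y. Rep_mnum x < Rep_mnum y) {})"
proof -
  have *: "(\<forall>x. Q x) \<longleftrightarrow> (\<forall>n. Q (Abs_mnum n))" "(\<exists>x. Q x) \<longleftrightarrow> (\<exists>n. Q (Abs_mnum n))" for Q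
    by (metis Rep_mnum_inverse)+
  show ?thesis
    unfolding pa_minus_def struct.case *
    by (simp add: Abs_mnum_inverse Abs_mnum_inject algebra_simps)
      (auto simp: less_iff_Suc_add intro: not0_implies_Suc, metis less_iff_Suc_add nat_neq_iff)
qed

text \<open>A class instance cannot depend on a hypothesis. This choice satisfies the semiring and
  order laws in any case and is a countermodel as soon as one exists.\<close>

definition chosen :: "mnum struct" where
  "chosen = (SOME M. pa_minus M \<and> ((\<exists>M' :: mnum struct. countermodel M') \<longrightarrow> countermodel M))"

lemma chosen: "pa_minus chosen" "countermodel (M' :: mnum struct) \<Longrightarrow> countermodel chosen"
proof -
  have "\<exists>M :: mnum struct. pa_minus M \<and> ((\<exists>M' :: mnum struct. countermodel M') \<longrightarrow> countermodel M)"
  proof (cases "\<exists>M' :: mnum struct. countermodel M'")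
    case True
    then obtain M' :: "mnum struct" where "countermodel M'" ..
    moreover from this have "pa_minus M'"
      using rca0_struct.pa_minus[of M'] by (simp add: countermodel_def rca0_struct_def)
    ultimately show ?thesis by blast
  next
    case False
    then show ?thesis using pa_minus_nat_copy by auto
  qed
  from someI_ex[OF this, folded chosen_def]
  show "pa_minus chosen" "countermodel (M' :: mnum struct) \<Longrightarrow> countermodel chosen"
    by auto
qed

instantiation mnum :: pnum
begin

definition "zero_mnum = zero_of chosen"
definition "one_mnum = one_of chosen"
definition "plus_mnum = add_of chosen"
definition "times_mnum = mul_of chosen"
definition "less_mnum = less_of chosen"
definition "less_eq_mnum x y \<longleftrightarrow> x < y \<or> x = (y :: mnum)"
definition "minus_mnum x y = (if x < y then 0 else THE d. x = y + (d :: mnum))"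


lemma mnum_axioms:
  fixes x y w :: mnum
  shows "(x + y) + w = x + (y + w)" "x + y = y + x" "0 + x = x"
    "(x * y) * w = x * (y * w)" "x * y = y * x" "1 * x = x" "0 * x = 0" "(x + y) * w = x * w + y * w"
    "x + y = x + w \<Longrightarrow> y = w" "x + 1 \<noteq> 0" "x = 0 \<or> (\<exists>y. x = y + 1)"
    "x < y \<longleftrightarrow> (\<exists>d. y = x + (d + 1))" "x < y \<or> x = y \<or> y < x"
proof -
  obtain z i ad mu lt S where c: "chosen = Struct z i ad mu lt S" by (cases chosen)
  note p = chosen(1)[unfolded c pa_minus_def struct.case]
  note d = zero_mnum_def[unfolded c struct.sel] one_mnum_def[unfolded c struct.sel] plus_mnum_def[unfolded c struct.sel]
     times_mnum_def[unfolded c struct.sel] less_mnum_def[unfolded c struct.sel]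
  have p': "(\<forall>x y w :: mnum. (x + y) + w = x + (y + w)) \<and> (\<forall>x y :: mnum. x + y = y + x) \<and> (\<forall>x :: mnum. 0 + x = x) \<and>
     (\<forall>x y w :: mnum. (x * y) * w = x * (y * w)) \<and> (\<forall>x y :: mnum. x * y = y * x) \<and> (\<forall>x :: mnum. 1 * x = x) \<and>
     (\<forall>x :: mnum. 0 * x = 0) \<and> (\<forall>x y w :: mnum. (x + y) * w = x * w + y * w) \<and>
     (\<forall>x y w :: mnum. x + y = x + w \<longrightarrow> y = w) \<and> (\<forall>x :: mnum. x + 1 \<noteq> 0) \<and> (\<forall>x :: mnum. x = 0 \<or> (\<exists>y. x = y + 1)) \<and>
     (\<forall>x y :: mnum. x < y \<longleftrightarrow> (\<exists>d. y = x + (d + 1))) \<and> (\<forall>x y :: mnum. x < y \<or> x = y \<or> y < x)"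
    unfolding d by (rule p)
  show "(x + y) + w = x + (y + w)" using p' by meson
  show "x + y = y + x" using p' by meson
  show "0 + x = x" using p' by meson
  show "(x * y) * w = x * (y * w)" using p' by meson
  show "x * y = y * x" using p' by meson
  show "1 * x = x" using p' by meson
  show "0 * x = 0" using p' by meson
  show "(x + y) * w = x * w + y * w" using p' by meson
  show "x + y = x + w \<Longrightarrow> y = w" using p' by meson
  show "x + 1 \<noteq> 0" using p' by meson
  show "x = 0 \<or> (\<exists>y. x = y + 1)" using p' by meson
  show "x < y \<longleftrightarrow> (\<exists>d. y = x + (d + 1))" using p' by meson
  show "x < y \<or> x = y \<or> y < x" using p' by meson
qed

lemma mnum_le_iff: "x \<le> y \<longleftrightarrow> (\<exists>d. y = x + (d :: mnum))"
proof -
  have "x < y \<or> x = y \<longleftrightarrow> (\<exists>d. y = x + d)"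
    using mnum_axioms(2,3,11,12) by metis
  then show ?thesis by (simp add: less_eq_mnum_def)
qed

lemma mnum_not_less: "\<not> x < (x :: mnum)"
  using mnum_axioms(2,3,9,10,12) by metis

lemma mnum_less_trans: "x < y \<Longrightarrow> y < w \<Longrightarrow> x < (w :: mnum)"
  using mnum_axioms(1,12) by metis

lemma mnum_minus: "(x + y) - x = (y :: mnum)"
proof -
  have "\<not> x + y < x" using mnum_axioms(1,2,3,9,10,12) by metis
  moreover have "(THE d. x + y = x + d) = y" using mnum_axioms(9) by (intro the_equality) auto
  ultimately show ?thesis by (simp add: minus_mnum_def)
qed

lemma mnum_minus_less: "x < y \<Longrightarrow> x - y = (0 :: mnum)"
  by (simp add: minus_mnum_def)

instance
proof
  fix a b c :: mnum
  show add_assoc: "a + b + c = a + (b + c)" for a b c :: mnum by (rule mnum_axioms)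
  show add_comm: "a + b = b + a" for a b :: mnum by (rule mnum_axioms)
  show "0 + a = a" by (rule mnum_axioms)
  show "a * b * c = a * (b * c)" by (rule mnum_axioms)
  show mul_comm: "a * b = b * a" for a b :: mnum by (rule mnum_axioms)
  show "1 * a = a" by (rule mnum_axioms)
  show "0 * a = 0" by (rule mnum_axioms)
  show "a * 0 = 0" using mnum_axioms(5,7) by metis
  show distrib: "(a + b) * c = a * c + b * c" for a b c :: mnum by (rule mnum_axioms)
  show "a * (b + c) = a * b + a * c" using mnum_axioms(5,8) by metis
  show "(0 :: mnum) \<noteq> 1" using mnum_axioms(3,10) by metis
  show "(a < b) = (a \<le> b \<and> \<not> b \<le> a)" unfolding less_eq_mnum_def using mnum_not_less mnum_less_trans by metis
  show "a \<le> a" by (simp add: less_eq_mnum_def)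
  show "a \<le> b \<Longrightarrow> b \<le> c \<Longrightarrow> a \<le> c" unfolding less_eq_mnum_def using mnum_less_trans by metis
  show "a \<le> b \<Longrightarrow> b \<le> a \<Longrightarrow> a = b" unfolding less_eq_mnum_def using mnum_not_less mnum_less_trans by metis
  show total: "a \<le> b \<or> b \<le> a" for a b :: mnum unfolding less_eq_mnum_def using mnum_axioms(13) by metis
  show "a \<le> b \<Longrightarrow> c + a \<le> c + b" unfolding mnum_le_iff using add_assoc by metis
  show "a < b \<Longrightarrow> 0 < c \<Longrightarrow> c * a < c * b"
  proof -
    assume "a < b" "0 < c"
    then obtain d e where "b = a + (d + 1)" "c = e + 1" using mnum_axioms(3,12) by metis
    then have "c * b = c * a + ((c * d + e) + 1)" using distrib mul_comm add_assoc mnum_axioms(6) by metis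
    then show "c * a < c * b" using mnum_axioms(12) by metis
  qed
  show "(0 :: mnum) < 1" using mnum_axioms(3,12) by metis
  show "(a < b) = (a + 1 \<le> b)" unfolding mnum_le_iff using mnum_axioms(1,2,12) by metis
  show le: "(a \<le> b) = (\<exists>c. b = a + c)" for a b :: mnum by (rule mnum_le_iff)
  show "a + b - a = b" by (rule mnum_minus)
  have minus_0: "a - b = 0" if "a \<le> b" for a b :: mnum
    using that mnum_minus[of a 0] mnum_minus_less mnum_axioms(2,3) unfolding less_eq_mnum_def by metis
  show "b \<le> a \<Longrightarrow> a - b + b = a" unfolding mnum_le_iff using mnum_minus add_comm by metis
  show "a - b - c = a - (b + c)"
  proof (cases "b + c \<le> a")
    case True
    then obtain d where "a = b + (c + d)" unfolding mnum_le_iff using add_assoc by metis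
    then show ?thesis using mnum_minus add_assoc by metis
  next
    case False
    then have 1: "a - (b + c) = 0" using minus_0 total by blast
    show ?thesis
    proof (cases "b \<le> a")
      case True
      then obtain d where d: "a = b + d" unfolding mnum_le_iff by blast
      have "\<not> c \<le> d" using False d add_assoc unfolding mnum_le_iff by metis
      then have "d - c = 0" using minus_0 total by blast
      then show ?thesis using 1 d mnum_minus by metis
    next
      case f: False
      have "0 \<le> c" unfolding mnum_le_iff using mnum_axioms(3) by metis
      then show ?thesis using 1 f minus_0 total by metis
    qed
  qed
  show "a * (b - c) = a * b - a * c"
  proof (cases "c \<le> b")
    case True
    then obtain d where "b = c + d" unfolding mnum_le_iff by blast
    moreover have "a * (c + d) = a * c + a * d" using distrib mul_comm by metis
    ultimately show ?thesis using mnum_minus by metis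
  next
    case False
    then obtain d where "c = b + d" using total unfolding mnum_le_iff by blast
    then have "a * c = a * b + a * d" using distrib mul_comm by metis
    then have "a * b \<le> a * c" unfolding mnum_le_iff by blast
    then have "a * b - a * c = 0" by (rule minus_0)
    moreover have "b - c = 0" using False total minus_0 by blast
    ultimately show ?thesis using mnum_axioms(5,7) by metis
  qed
  show "a \<noteq> 0 \<Longrightarrow> b \<noteq> 0 \<Longrightarrow> a * b \<noteq> 0"
  proof -
    assume "a \<noteq> 0" "b \<noteq> 0"
    then obtain d e where de: "a = d + 1" "b = e + 1" using mnum_axioms(11) by metis
    then have "a * b = (d * b + e) + 1" using distrib add_assoc mnum_axioms(6) by metis
    then show "a * b \<noteq> 0" using mnum_axioms(10) by metis
  qed
qed

end

text \<open>With the operations of the instance, the chosen structure is a standard one over its own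
  sets, so everything proved about \<open>std S\<close> applies to it.\<close>

lemma chosen_std: "chosen = std (sets_of chosen)"
proof -
  have "chosen = Struct (zero_of chosen) (one_of chosen) (add_of chosen) (mul_of chosen) (less_of chosen) (sets_of chosen)"
    by simp
  then show ?thesis
    by (simp add: std_def zero_mnum_def one_mnum_def plus_mnum_def times_mnum_def less_mnum_def)
qed

section \<open>Computable predicates in models of RCA0\<close>

locale rca =
  fixes S :: "'m :: pnum set set"
  assumes rca0_std: "rca0_model (std S)"

sublocale rca \<subseteq> rca0_struct "std S"
  by standard (rule rca0_std)

lemma std_sel [simp]:
  "zero_of (std S) = 0" "one_of (std S) = 1" "add_of (std S) = (+)" "mul_of (std S) = (*)"
  "less_of (std S) = (<)" "sets_of (std S) = S"
  by (simp_all add: std_def)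

lemma less_add_1_iff: "(x :: 'm :: pnum) < y + 1 \<longleftrightarrow> x \<le> y"
  by (simp add: less_eq_iff_succ_less)

context rca
begin

abbreviation d0 :: "((nat \<Rightarrow> 'm) \<Rightarrow> bool) \<Rightarrow> bool" where "d0 \<equiv> definable (std S) Delta0"
abbreviation sg :: "((nat \<Rightarrow> 'm) \<Rightarrow> bool) \<Rightarrow> bool" where "sg \<equiv> definable (std S) Sigma1"
abbreviation tdef :: "((nat \<Rightarrow> 'm) \<Rightarrow> 'm) \<Rightarrow> bool" where "tdef \<equiv> term_definable (std S)"

lemma tdef_add: "tdef s \<Longrightarrow> tdef t \<Longrightarrow> tdef (\<lambda>e. s e + t e)"
  using term_definable_add[of "std S"] by simp

lemma tdef_mul: "tdef s \<Longrightarrow> tdef t \<Longrightarrow> tdef (\<lambda>e. s e * t e)"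
  using term_definable_mul[of "std S"] by simp

lemmas tdef_rules = term_definable_var term_definable_const tdef_add tdef_mul

lemma d0_less: "tdef s \<Longrightarrow> tdef t \<Longrightarrow> d0 (\<lambda>e. s e < t e)"
  using Delta0_less[OF sets_nonempty] by simp

lemma d0_mem: "A \<in> S \<Longrightarrow> tdef t \<Longrightarrow> d0 (\<lambda>e. t e \<in> A)"
  using Delta0_mem[OF sets_nonempty] by simp

lemmas d0_eq = Delta0_eq[OF sets_nonempty]
lemmas d0_not = Delta0_not[OF sets_nonempty]
lemmas d0_disj = Delta0_disj[OF sets_nonempty]
lemmas d0_conj = Delta0_conj[OF sets_nonempty]

lemma d0_all_less:
  "tdef t \<Longrightarrow> d0 (\<lambda>e. Q (\<lambda>n. e (Suc n)) (e 0)) \<Longrightarrow> d0 (\<lambda>e. \<forall>y<t e. Q e y)"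
  using Delta0_all[OF sets_nonempty, of t Q] by simp

lemma d0_ex_less:
  assumes "tdef t" "d0 (\<lambda>e. Q (\<lambda>n. e (Suc n)) (e 0))"
  shows "d0 (\<lambda>e. \<exists>y<t e. Q e y)"
  using d0_not[OF d0_all_less[of t "\<lambda>e y. \<not> Q e y", OF assms(1) d0_not[OF assms(2)]]] by simp

lemma definable_ren: "definable M K P \<Longrightarrow> definable M K (\<lambda>e. P (\<lambda>n. e (g n)))"
  using definable_rename[of M K P "\<lambda>n. Inr (g n)"] by simp

text \<open>Position 2 holds the common bound of a contracted quantifier block, which
  \<open>R\<close> must not see.\<close>

lemma definable_env3:
  assumes "definable M K (\<lambda>e. R (\<lambda>n. e (Suc n)) (e 0))"
  shows "definable M K (\<lambda>e. R (case_nat (e 1) (\<lambda>n. e (Suc (Suc (Suc n))))) (e 0))"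
proof -
  have "(\<lambda>n. e (case_nat 1 (\<lambda>n. Suc (Suc (Suc n))) n)) = case_nat (e 1) (\<lambda>n. e (Suc (Suc (Suc n))))" for e :: "nat \<Rightarrow> 'a"
    by (rule ext) (simp split: nat.split)
  then show ?thesis
    using definable_ren[OF assms, of "case_nat 0 (case_nat 1 (\<lambda>n. Suc (Suc (Suc n))))"] by (simp only: nat.case)
qed

lemma sg_iff:
  "sg P \<longleftrightarrow> (\<exists>Q. d0 (\<lambda>e. Q (\<lambda>n. e (Suc n)) (e 0)) \<and> (\<forall>e. P e \<longleftrightarrow> (\<exists>y. Q e y)))"
  by (rule Sigma1_iff[OF sets_nonempty])

lemma d0_sg: "d0 P \<Longrightarrow> sg P"
  by (rule delta0_sigma1)

text \<open>Two existential quantifiers contract to a single unbounded one that bounds both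
  witnesses; the sum of the witnesses is large enough.\<close>

lemma sg_ex:
  assumes "sg (\<lambda>e. Q (\<lambda>n. e (Suc n)) (e 0))"
  shows "sg (\<lambda>e. \<exists>y. Q e y)"
proof -
  obtain R where R: "d0 (\<lambda>e. R (\<lambda>n. e (Suc n)) (e 0))" "\<And>e. Q (\<lambda>n. e (Suc n)) (e 0) \<longleftrightarrow> (\<exists>z. R e z)"
    using assms unfolding sg_iff by auto
  have Q: "Q e y \<longleftrightarrow> (\<exists>z. R (case_nat y e) z)" for e y
    using R(2)[of "case_nat y e"] by simp
  have "d0 (\<lambda>e. R (case_nat (e 1) (\<lambda>n. e (Suc (Suc (Suc n))))) (e 0))" using R(1) by (rule definable_env3)
  then have "d0 (\<lambda>e. \<exists>y<e 0 + 1. \<exists>z<e 0 + 1. R (case_nat y (\<lambda>n. e (Suc n))) z)"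
    by (intro d0_ex_less tdef_rules) simp
  then have "sg (\<lambda>e. \<exists>w. \<exists>y<w + 1. \<exists>z<w + 1. R (case_nat y e) z)"
    unfolding sg_iff by (intro exI[of _ "\<lambda>e w. \<exists>y<w + 1. \<exists>z<w + 1. R (case_nat y e) z"]) simp
  moreover have "(\<exists>w. \<exists>y<w + 1. \<exists>z<w + 1. R (case_nat y e) z) \<longleftrightarrow> (\<exists>y. Q e y)" for e
  proof
    assume "\<exists>y. Q e y"
    then obtain y z where "R (case_nat y e) z" unfolding Q by auto
    moreover have "y < (y + z) + 1" "z < (y + z) + 1" by (simp_all add: less_add_1_iff)
    ultimately show "\<exists>w. \<exists>y<w + 1. \<exists>z<w + 1. R (case_nat y e) z" by blast
  qed (use Q in auto)
  ultimately show ?thesis by simp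
qed

lemma sg_disj:
  assumes "sg P" "sg Q" shows "sg (\<lambda>e. P e \<or> Q e)"
proof -
  obtain R R' where R: "d0 (\<lambda>e. R (\<lambda>n. e (Suc n)) (e 0))" "\<And>e. P e \<longleftrightarrow> (\<exists>z. R e z)"
      "d0 (\<lambda>e. R' (\<lambda>n. e (Suc n)) (e 0))" "\<And>e. Q e \<longleftrightarrow> (\<exists>z. R' e z)"
    using assms unfolding sg_iff by auto
  have "sg (\<lambda>e. \<exists>z. R e z \<or> R' e z)" by (intro sg_ex d0_sg d0_disj R)
  then show ?thesis using R(2,4) by (simp add: ex_disj_distrib)
qed

lemma sg_conj:
  assumes "sg P" "sg Q" shows "sg (\<lambda>e. P e \<and> Q e)"
proof -
  obtain R R' where R: "d0 (\<lambda>e. R (\<lambda>n. e (Suc n)) (e 0))" "\<And>e. P e \<longleftrightarrow> (\<exists>z. R e z)"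
      "d0 (\<lambda>e. R' (\<lambda>n. e (Suc n)) (e 0))" "\<And>e. Q e \<longleftrightarrow> (\<exists>z. R' e z)"
    using assms unfolding sg_iff by auto
  have "d0 (\<lambda>e. R (\<lambda>n. e (Suc (Suc n))) (e 1))"
    using definable_ren[OF R(1), of "case_nat 1 (\<lambda>n. Suc (Suc n))"] by simp
  moreover have "d0 (\<lambda>e. R' (\<lambda>n. e (Suc (Suc n))) (e 0))"
    using definable_ren[OF R(3), of "case_nat 0 (\<lambda>n. Suc (Suc n))"] by simp
  ultimately have "sg (\<lambda>e. \<exists>z z'. R e z \<and> R' e z')" by (intro sg_ex d0_sg d0_conj) simp_all
  then show ?thesis using R(2,4) by simp
qed

lemma sg_induct:
  assumes "sg (\<lambda>e. P (e 0))" "P 0" "\<And>x. P x \<Longrightarrow> P (x + 1)"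
  shows "P x"
  by (rule sigma1_induct[of P]) (use assms in auto)

text \<open>Induction on the length of the initial segment that already has a common bound; one more
  witness is added to the bound at each step.\<close>

lemma collection:
  assumes "d0 (\<lambda>e. Q (e 1) (e 0))" "\<And>x. x < a \<Longrightarrow> \<exists>y. Q x y"
  shows "\<exists>b. \<forall>x<a. \<exists>y<b. Q x y"
proof -
  \<comment> \<open>The guard makes the claim trivial beyond \<open>a\<close>, where no witnesses
    are supplied.\<close>
  have "\<exists>b. c \<le> a \<longrightarrow> (\<forall>x<c. \<exists>y<b. Q x y)" for c
  proof (rule sg_induct[of "\<lambda>c. \<exists>b. c \<le> a \<longrightarrow> (\<forall>x<c. \<exists>y<b. Q x y)"])
    have "sg (\<lambda>e. \<exists>b. a < e 0 \<or> (\<forall>x<e 0. \<exists>y<b. Q x y))"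
      by (intro sg_ex d0_sg d0_disj d0_less tdef_rules d0_all_less d0_ex_less) (use assms(1) in simp)
    moreover have "a < x \<or> P \<longleftrightarrow> (x \<le> a \<longrightarrow> P)" for x P by (auto simp: not_le)
    ultimately show "sg (\<lambda>e. \<exists>b. e 0 \<le> a \<longrightarrow> (\<forall>x<e 0. \<exists>y<b. Q x y))" by (simp only:)
    show "\<exists>b. c + 1 \<le> a \<longrightarrow> (\<forall>x<c + 1. \<exists>y<b. Q x y)" if IH: "\<exists>b. c \<le> a \<longrightarrow> (\<forall>x<c. \<exists>y<b. Q x y)" for c
    proof (cases "c + 1 \<le> a")
      case True
      then have ca: "c < a" by (simp add: less_iff_succ_less_eq)
      then obtain b y where b: "\<forall>x<c. \<exists>y<b. Q x y" and y: "Q c y" using IH assms(2)[of c] by auto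
      have "\<exists>y'<b + y + 1. Q x y'" if "x < c + 1" for x
      proof (cases "x < c")
        case True
        then obtain y' where "y' < b" "Q x y'" using b by blast
        moreover have "b \<le> b + y + 1" by (simp add: add.assoc)
        ultimately show ?thesis by (meson less_le_trans)
      next
        case False
        then have "x = c" using that by (simp add: less_add_1_iff)
        then show ?thesis using y by (intro exI[of _ y]) (simp add: less_add_1_iff)
      qed
      then show ?thesis by blast
    qed auto
  qed simp
  from this[of a] show ?thesis by simp
qed

text \<open>By collection the witnesses for all \<open>y\<close> below \<open>t e\<close> have a
  common bound, which can be quantified first; a Delta0 matrix remains.\<close>

lemma sg_all_less:
  assumes "tdef t" "sg (\<lambda>e. Q (\<lambda>n. e (Suc n)) (e 0))"
  shows "sg (\<lambda>e. \<forall>y<t e. Q e y)"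
proof -
  obtain R where R: "d0 (\<lambda>e. R (\<lambda>n. e (Suc n)) (e 0))" "\<And>e. Q (\<lambda>n. e (Suc n)) (e 0) \<longleftrightarrow> (\<exists>z. R e z)"
    using assms(2) unfolding sg_iff by auto
  have Q: "Q e y \<longleftrightarrow> (\<exists>z. R (case_nat y e) z)" for e y
    using R(2)[of "case_nat y e"] by simp
  have 1: "(\<forall>y<t e. Q e y) \<longleftrightarrow> (\<exists>b. \<forall>y<t e. \<exists>z<b. R (case_nat y e) z)" for e
  proof
    assume "\<forall>y<t e. Q e y"
    \<comment> \<open>For the use of collection the environment \<open>e\<close> is frozen: its
      values become parameters.\<close>
    moreover have "d0 (\<lambda>e'. R (case_nat (e' 1) e) (e' 0))"
    proof -
      have "(\<lambda>n. ev e' (case_nat (Inr 0) (case_nat (Inr 1) (\<lambda>n. Inl (e n))) (Suc n))) = case_nat (e' 1) e" for e'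
        by (rule ext) (simp split: nat.split)
      then show ?thesis
        using definable_rename[OF R(1), of "case_nat (Inr 0) (case_nat (Inr 1) (\<lambda>n. Inl (e n)))"] by simp
    qed
    ultimately show "\<exists>b. \<forall>y<t e. \<exists>z<b. R (case_nat y e) z"
      using collection[of "\<lambda>y z. R (case_nat y e) z" "t e"] Q by simp
  qed (use Q in blast)
  have "tdef (\<lambda>e. t (\<lambda>n. e (Suc n)))"
  proof -
    obtain s \<tau> where "\<And>e. t e = tval (std S) (\<lambda>n. ev e (\<tau> n)) s" using assms(1) unfolding term_definable_def by auto
    moreover have "ev (\<lambda>n. e (Suc n)) v = ev e (case v of Inl a \<Rightarrow> Inl a | Inr n \<Rightarrow> Inr (Suc n))" for e :: "nat \<Rightarrow> 'm" and v
      by (simp split: sum.split)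
    ultimately show ?thesis unfolding term_definable_def
      by (intro exI[of _ s] exI[of _ "\<lambda>n. case \<tau> n of Inl a \<Rightarrow> Inl a | Inr n \<Rightarrow> Inr (Suc n)"]) simp
  qed
  moreover have "d0 (\<lambda>e. R (case_nat (e 1) (\<lambda>n. e (Suc (Suc (Suc n))))) (e 0))" using R(1) by (rule definable_env3)
  ultimately have "sg (\<lambda>e. \<exists>b. \<forall>y<t e. \<exists>z<b. R (case_nat y e) z)"
    by (intro sg_ex d0_sg d0_all_less d0_ex_less tdef_rules) simp_all
  then show ?thesis by (simp add: 1)
qed

text \<open>The function t has a \<open>\<Sigma>\<^sub>1\<close> graph, and the predicate P is \<open>\<Delta>\<^sub>1\<close>, both with parameters.\<close>

definition rt :: "((nat \<Rightarrow> 'm) \<Rightarrow> 'm) \<Rightarrow> bool" where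
  "rt t \<longleftrightarrow> sg (\<lambda>e. e 0 = t (\<lambda>n. e (Suc n)))"

definition d1 :: "((nat \<Rightarrow> 'm) \<Rightarrow> bool) \<Rightarrow> bool" where
  "d1 P \<longleftrightarrow> sg P \<and> sg (\<lambda>e. \<not> P e)"

lemma d1_sg: "d1 P \<Longrightarrow> sg P"
  by (simp add: d1_def)

lemma d0_d1: "d0 P \<Longrightarrow> d1 P"
  by (simp add: d1_def d0_sg d0_not)

lemma d1_not: "d1 P \<Longrightarrow> d1 (\<lambda>e. \<not> P e)"
  by (simp add: d1_def)

lemma d1_conj: "d1 P \<Longrightarrow> d1 Q \<Longrightarrow> d1 (\<lambda>e. P e \<and> Q e)"
  unfolding d1_def de_Morgan_conj by (intro conjI sg_conj sg_disj) simp_all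

lemma d1_disj: "d1 P \<Longrightarrow> d1 Q \<Longrightarrow> d1 (\<lambda>e. P e \<or> Q e)"
  unfolding d1_def de_Morgan_disj by (intro conjI sg_conj sg_disj) simp_all

lemma d1_imp: "d1 P \<Longrightarrow> d1 Q \<Longrightarrow> d1 (\<lambda>e. P e \<longrightarrow> Q e)"
  using d1_disj[OF d1_not[of P], of Q] by (simp only: imp_conv_disj)

lemma d1_iff: "d1 P \<Longrightarrow> d1 Q \<Longrightarrow> d1 (\<lambda>e. P e = Q e)"
  using d1_conj[OF d1_imp d1_imp, of P Q Q P] by (simp only: iff_conv_conj_imp)

lemma rt_tdef: "tdef t \<Longrightarrow> rt t"
proof -
  assume "tdef t"
  then obtain s \<tau> where "\<And>e. t e = tval (std S) (\<lambda>n. ev e (\<tau> n)) s" unfolding term_definable_def by auto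
  moreover have "ev (\<lambda>n. e (Suc n)) v = ev e (case v of Inl a \<Rightarrow> Inl a | Inr n \<Rightarrow> Inr (Suc n))" for e :: "nat \<Rightarrow> 'm" and v
    by (simp split: sum.split)
  ultimately have "tdef (\<lambda>e. t (\<lambda>n. e (Suc n)))" unfolding term_definable_def
    by (intro exI[of _ s] exI[of _ "\<lambda>n. case \<tau> n of Inl a \<Rightarrow> Inl a | Inr n \<Rightarrow> Inr (Suc n)"]) simp
  then show "rt t" unfolding rt_def by (intro d0_sg d0_eq tdef_rules)
qed

lemma sg_subst:
  assumes "rt t" "sg (\<lambda>e. Q (\<lambda>n. e (Suc n)) (e 0))"
  shows "sg (\<lambda>e. Q e (t e))"
proof -
  have "sg (\<lambda>e. \<exists>y. y = t e \<and> Q e y)"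
    by (intro sg_ex sg_conj assms) (use assms(1) in \<open>simp add: rt_def\<close>)
  then show ?thesis by simp
qed

text \<open>Since \<open>t\<close> is total with a Sigma1 graph, it can be substituted into the
  predicate and into its negation alike, and both stay Sigma1.\<close>

lemma d1_subst:
  assumes "rt t" "d1 (\<lambda>e. Q (\<lambda>n. e (Suc n)) (e 0))"
  shows "d1 (\<lambda>e. Q e (t e))"
  using assms sg_subst[of t Q] sg_subst[of t "\<lambda>e y. \<not> Q e y"] by (simp add: d1_def)

lemma d1_ren: "d1 P \<Longrightarrow> d1 (\<lambda>e. P (\<lambda>n. e (g n)))"
  unfolding d1_def using definable_ren[of "std S" Sigma1 P g] definable_ren[of "std S" Sigma1 "\<lambda>e. \<not> P e" g] by simp

lemma rt_ren: "rt t \<Longrightarrow> rt (\<lambda>e. t (\<lambda>n. e (g n)))"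
  unfolding rt_def using definable_ren[of "std S" Sigma1 "\<lambda>e. e 0 = t (\<lambda>n. e (Suc n))" "case_nat 0 (\<lambda>n. Suc (g n))"] by simp

lemma d1_subst2:
  assumes "rt s" "rt t" "d1 (\<lambda>e. Q (e 0) (e 1))"
  shows "d1 (\<lambda>e. Q (s e) (t e))"
proof (rule d1_subst[OF assms(1), of "\<lambda>e x. Q x (t e)"])
  show "d1 (\<lambda>e. Q (e 0) (t (\<lambda>n. e (Suc n))))"
    using d1_subst[OF rt_ren[OF assms(2), of Suc], of "\<lambda>e y. Q (e 0) y"] d1_ren[OF assms(3), of "case_nat 1 (\<lambda>n. 0)"] by simp
qed

lemma d1_eq: "rt s \<Longrightarrow> rt t \<Longrightarrow> d1 (\<lambda>e. s e = t e)"
  by (rule d1_subst2[of s t "(=)"]) (assumption | intro d0_d1 d0_eq tdef_rules)+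

lemma d1_less: "rt s \<Longrightarrow> rt t \<Longrightarrow> d1 (\<lambda>e. s e < t e)"
  by (rule d1_subst2[of s t "(<)"]) (assumption | intro d0_d1 d0_less tdef_rules)+

lemma d1_le: "rt s \<Longrightarrow> rt t \<Longrightarrow> d1 (\<lambda>e. s e \<le> t e)"
  using d1_not[OF d1_less[of t s]] by (simp add: not_less)

lemma d1_mem: "A \<in> S \<Longrightarrow> rt t \<Longrightarrow> d1 (\<lambda>e. t e \<in> A)"
  by (rule d1_subst[of t "\<lambda>e y. y \<in> A"]) (assumption | intro d0_d1 d0_mem tdef_rules)+

lemma d1_all_less:
  assumes "rt t" "d1 (\<lambda>e. Q (\<lambda>n. e (Suc n)) (e 0))"
  shows "d1 (\<lambda>e. \<forall>y<t e. Q e y)"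
proof (rule d1_subst[OF assms(1), of "\<lambda>e w. \<forall>y<w. Q e y"])
  have *: "d1 (\<lambda>e. Q (\<lambda>n. e (Suc (Suc n))) (e 0))"
    using d1_ren[OF assms(2), of "case_nat 0 (\<lambda>n. Suc (Suc n))"] by simp
  have "sg (\<lambda>e. \<forall>y<e 0. Q (\<lambda>n. e (Suc n)) y)"
    by (intro sg_all_less tdef_rules) (use * in \<open>simp add: d1_def\<close>)
  moreover have "sg (\<lambda>e. \<exists>y. y < e 0 \<and> \<not> Q (\<lambda>n. e (Suc n)) y)"
    by (rule sg_ex, rule sg_conj, intro d0_sg d0_less tdef_rules) (use * in \<open>simp add: d1_def\<close>)
  ultimately show "d1 (\<lambda>e. \<forall>y<e 0. Q (\<lambda>n. e (Suc n)) y)" by (simp add: d1_def)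
qed

lemma d1_ex_less:
  assumes "rt t" "d1 (\<lambda>e. Q (\<lambda>n. e (Suc n)) (e 0))"
  shows "d1 (\<lambda>e. \<exists>y<t e. Q e y)"
  using d1_not[OF d1_all_less[of t "\<lambda>e y. \<not> Q e y", OF assms(1) d1_not[OF assms(2)]]] by simp

lemma rt_var: "rt (\<lambda>e. e n)" and rt_const: "rt (\<lambda>e. a)"
  by (intro rt_tdef tdef_rules)+

lemma rt_subst2:
  assumes "rt (\<lambda>e. g (e 0) (e 1))" "rt s" "rt t" shows "rt (\<lambda>e. g (s e) (t e))"
proof -
  have g: "sg (\<lambda>e. e 2 = g (e 1) (e 0))"
    using definable_ren[OF assms(1)[unfolded rt_def], of "case_nat 2 (case_nat 1 (\<lambda>n. 0))"] by (simp add: numeral_2_eq_2)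
  have "sg (\<lambda>e. e 1 = g (e 0) (t (\<lambda>n. e (Suc (Suc n)))))"
    using sg_subst[OF rt_ren[OF assms(3), of "\<lambda>n. Suc (Suc n)"], of "\<lambda>e y. e 1 = g (e 0) y"] g
    by (simp add: numeral_2_eq_2)
  then show ?thesis
    unfolding rt_def using sg_subst[OF rt_ren[OF assms(2), of Suc], of "\<lambda>e x. e 0 = g x (t (\<lambda>n. e (Suc n)))"] by simp
qed

lemma rt_subst: "rt (\<lambda>e. g (e 0)) \<Longrightarrow> rt t \<Longrightarrow> rt (\<lambda>e. g (t e))"
  using rt_subst2[of "\<lambda>x y. g x" t t] by simp

lemma rt_add: "rt s \<Longrightarrow> rt t \<Longrightarrow> rt (\<lambda>e. s e + t e)"
  by (rule rt_subst2[of "(+)"]) (assumption | intro rt_tdef tdef_rules)+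

lemma rt_mul: "rt s \<Longrightarrow> rt t \<Longrightarrow> rt (\<lambda>e. s e * t e)"
  by (rule rt_subst2[of "(*)"]) (assumption | intro rt_tdef tdef_rules)+

lemma rt_if: "d1 P \<Longrightarrow> rt s \<Longrightarrow> rt t \<Longrightarrow> rt (\<lambda>e. if P e then s e else t e)"
proof -
  assume a: "d1 P" "rt s" "rt t"
  have "d1 (\<lambda>e. P (\<lambda>n. e (Suc n)))" using a(1) by (rule d1_ren)
  then have "sg (\<lambda>e. (P (\<lambda>n. e (Suc n)) \<and> e 0 = s (\<lambda>n. e (Suc n))) \<or> (\<not> P (\<lambda>n. e (Suc n)) \<and> e 0 = t (\<lambda>n. e (Suc n))))"
    using a(2,3) unfolding rt_def d1_def by (intro sg_disj sg_conj) auto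
  moreover have "(\<lambda>e. e 0 = (if P (\<lambda>n. e (Suc n)) then s (\<lambda>n. e (Suc n)) else t (\<lambda>n. e (Suc n)))) =
     (\<lambda>e. (P (\<lambda>n. e (Suc n)) \<and> e 0 = s (\<lambda>n. e (Suc n))) \<or> (\<not> P (\<lambda>n. e (Suc n)) \<and> e 0 = t (\<lambda>n. e (Suc n))))"
    by (rule ext) auto
  ultimately show ?thesis unfolding rt_def by simp
qed

lemma d1_all_le: "rt t \<Longrightarrow> d1 (\<lambda>e. Q (\<lambda>n. e (Suc n)) (e 0)) \<Longrightarrow> d1 (\<lambda>e. \<forall>y\<le>t e. Q e y)"
  using d1_all_less[OF rt_add[OF _ rt_const], of t Q 1] by (simp add: less_add_1_iff)

lemma d1_ex_le: "rt t \<Longrightarrow> d1 (\<lambda>e. Q (\<lambda>n. e (Suc n)) (e 0)) \<Longrightarrow> d1 (\<lambda>e. \<exists>y\<le>t e. Q e y)"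
  using d1_ex_less[OF rt_add[OF _ rt_const], of t Q 1] by (simp add: less_add_1_iff)

lemma d1_dvd: "rt s \<Longrightarrow> rt t \<Longrightarrow> d1 (\<lambda>e. s e dvd t e)"
proof -
  \<comment> \<open>The quotient is at most \<open>y\<close>; if \<open>x = 0\<close>, then
    \<open>y = 0\<close> as well and the quotient 0 does.\<close>
  have *: "x dvd y \<longleftrightarrow> (\<exists>k\<le>y. y = x * k)" for x y :: 'm
  proof
    assume "x dvd y"
    then obtain k where k: "y = x * k" ..
    show "\<exists>k\<le>y. y = x * k"
    proof (cases "x = 0")
      case True
      then show ?thesis using k by (intro exI[of _ 0]) simp
    next
      case False
      then have "1 \<le> x" by (metis add_0 less_iff_succ_less_eq zero_less_iff_neq_zero)
      then have "1 * k \<le> x * k" by (rule mult_right_mono) simp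
      then show ?thesis using k by auto
    qed
  qed auto
  assume "rt s" "rt t"
  moreover have "d1 (\<lambda>e. e 0 dvd e 1)" unfolding * by (intro d1_ex_le d1_eq rt_mul rt_var)
  ultimately show ?thesis by (rule d1_subst2)
qed

text \<open>Definability goals are discharged by \<open>intro\<close> with these rules, following
  the syntax of the predicate.\<close>

lemmas d1_rules = d1_not d1_conj d1_disj d1_imp d1_iff d1_eq d1_less d1_le d1_mem d1_all_less d1_ex_less
  d1_all_le d1_ex_le d1_dvd rt_var rt_const rt_add rt_mul rt_if

lemma comprehension: "d1 (\<lambda>e. P (e 0)) \<Longrightarrow> {x. P x} \<in> S"
  using delta1_comprehension[of P] by (simp add: d1_def)

lemma d1_induct:
  assumes "d1 (\<lambda>e. P (e 0))" "P 0" "\<And>x. P x \<Longrightarrow> P (x + 1)" shows "P x"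
  using d1_sg[OF assms(1)] assms(2,3) by (rule sg_induct)

lemma d1_less_induct:
  assumes "d1 (\<lambda>e. P (e 0))" and step: "\<And>x. (\<And>y. y < x \<Longrightarrow> P y) \<Longrightarrow> P x" shows "P x"
proof -
  have "\<forall>y<x. P y" for x
  proof (rule d1_induct[of "\<lambda>x. \<forall>y<x. P y"])
    show "d1 (\<lambda>e. \<forall>y<e 0. P y)" by (intro d1_rules assms(1))
    show "\<forall>y<x + 1. P y" if IH: "\<forall>y<x. P y" for x
    proof (intro allI impI)
      fix y assume "y < x + 1"
      then have "y < x \<or> y = x" by (simp add: less_add_1_iff le_less)
      then show "P y" using IH step[of x] by auto
    qed
  qed simp
  then show ?thesis using step[of x] by simp
qed

lemma d1_least:
  assumes "d1 (\<lambda>e. P (e 0))" "P x" shows "\<exists>y. P y \<and> (\<forall>z<y. \<not> P z)"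
proof (rule ccontr)
  assume *: "\<nexists>y. P y \<and> (\<forall>z<y. \<not> P z)"
  have "\<not> P x"
  proof (rule d1_less_induct[of "\<lambda>x. \<not> P x"])
    show "d1 (\<lambda>e. \<not> P (e 0))" using assms(1) by (rule d1_not)
    show "\<not> P x" if "\<And>y. y < x \<Longrightarrow> \<not> P y" for x using * that by auto
  qed
  then show False using assms(2) by simp
qed

end

section \<open>Coding and recursion\<close>

definition pr :: "'m :: pnum \<Rightarrow> 'm \<Rightarrow> 'm" where
  "pr x y = (x + y) * (x + y) + x"

lemma pos_iff: "0 < (x :: 'm :: pnum) \<longleftrightarrow> 1 \<le> x"
  using less_iff_succ_less_eq[of 0 x] by simp

lemma le_mult_self: "(x :: 'm :: pnum) \<le> x * x"
proof (cases "x = 0")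
  case False
  then have "1 \<le> x" by (simp add: pos_iff[symmetric] zero_less_iff_neq_zero)
  then have "1 * x \<le> x * x" by (rule mult_right_mono) simp
  then show ?thesis by simp
qed simp

text \<open>The code of a pair with sum \<open>s\<close> lies in the interval from the square of
  \<open>s\<close> up to, but excluding, the square of \<open>s + 1\<close>. So the sum can be read
  off the code, which gives injectivity.\<close>

lemma pr_less: "x + y < u + v \<Longrightarrow> pr x y < pr u (v :: 'm :: pnum)"
proof -
  assume "x + y < u + v"
  then have "(x + y) + 1 \<le> u + v" by (simp add: less_iff_succ_less_eq)
  then have "((x + y) + 1) * ((x + y) + 1) \<le> (u + v) * (u + v)" by (intro mult_mono) simp_all
  moreover have "(x + y) * (x + y) + x < ((x + y) + 1) * ((x + y) + 1)"
    using emb_nonneg[of x] emb_nonneg[of y] unfolding emb_simps by (simp add: algebra_simps)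
  moreover have "(u + v) * (u + v) \<le> pr u v" by (simp add: pr_def)
  ultimately show ?thesis unfolding pr_def[of x y] by (meson less_le_trans)
qed

lemma pr_inject [simp]: "pr x y = pr u v \<longleftrightarrow> x = u \<and> y = (v :: 'm :: pnum)"
proof
  assume a: "pr x y = pr u v"
  have s: "x + y = u + v" using pr_less[of x y u v] pr_less[of u v x y] a by (metis less_irrefl linorder_neqE)
  then have "x = u" using a by (simp add: pr_def)
  then show "x = u \<and> y = v" using s by simp
qed simp

lemma le_pr: "x \<le> pr x y" "y \<le> pr x (y :: 'm :: pnum)"
proof -
  show "x \<le> pr x y" by (simp add: pr_def)
  have "y \<le> x + y" by simp
  also have "\<dots> \<le> (x + y) * (x + y)" by (rule le_mult_self)
  also have "\<dots> \<le> pr x y" by (simp add: pr_def)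
  finally show "y \<le> pr x y" .
qed

lemma pr_less_pr: "y < y' \<Longrightarrow> pr x y < pr x (y' :: 'm :: pnum)"
  by (rule pr_less) simp

text \<open>The numbers m (i + 1) + 1 are pairwise coprime if m is divisible by all differences of the
  indices; the witnesses are explicit, so no induction is needed.\<close>

lemma code_modulus_dvd_cancel:
  fixes m i j q :: "'m :: pnum"
  assumes ij: "i \<noteq> j" and m: "\<And>D. 0 < D \<Longrightarrow> D \<le> i \<or> D \<le> j \<Longrightarrow> D dvd m"
    and dvd: "m * (i + 1) + 1 dvd q * (m * (j + 1) + 1)"
  shows "m * (i + 1) + 1 dvd q"
proof -
  let ?A = "m * (i + 1) + 1"
  have "\<exists>D. 0 < D \<and> D dvd m \<and> ?A dvd q * m * D"
  proof (cases "i < j")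
    case True
    then obtain D where D: "j = i + D" by (metis le_iff_add less_imp_le)
    then have "0 < D" using True by (metis add.right_neutral less_irrefl zero_less_iff_neq_zero)
    moreover have "q * (m * (j + 1) + 1) = q * ?A + q * m * D" by (simp add: D algebra_simps)
    then have "?A dvd q * m * D" using dvd by (metis dvd_add_right_iff dvd_triv_right)
    ultimately show ?thesis using m[of D] D by auto
  next
    case False
    then obtain D where D: "i = j + D" by (metis le_iff_add not_less)
    then have "0 < D" using ij by (metis add.right_neutral zero_less_iff_neq_zero)
    moreover have "q * ?A = q * (m * (j + 1) + 1) + q * m * D" by (simp add: D algebra_simps)
    then have "?A dvd q * m * D" using dvd by (metis dvd_add_right_iff dvd_triv_right)
    ultimately show ?thesis using m[of D] D by auto
  qed
  then obtain D e where D: "m = D * e" "?A dvd q * m * D" by auto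
  have "q * D * ?A = (i + 1) * (q * m * D) + q * D" by (simp add: algebra_simps)
  then have "?A dvd q * D" using D(2) by (metis dvd_add_right_iff dvd_mult dvd_triv_right)
  then have "?A dvd q * m" using D(1) by (metis dvd_mult2 mult.assoc)
  moreover have "q * ?A = (i + 1) * (q * m) + q" by (simp add: algebra_simps)
  ultimately show ?thesis by (metis dvd_add_right_iff dvd_mult dvd_triv_right)
qed

text \<open>Goedel's coding: \<open>pr m q\<close> codes the set of all x such that m (x + 1) + 1 divides q.\<close>

definition dec :: "'m :: pnum \<Rightarrow> 'm set" where
  "dec c = {x. \<exists>m\<le>c. \<exists>q\<le>c. c = pr m q \<and> m * (x + 1) + 1 dvd q}"

lemma dec_pr: "x \<in> dec (pr m q) \<longleftrightarrow> m * (x + 1) + 1 dvd q"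
  unfolding dec_def using le_pr[of m q] le_pr[of q m] by auto

context rca
begin

lemma rt_pr: "rt s \<Longrightarrow> rt t \<Longrightarrow> rt (\<lambda>e. pr (s e) (t e))"
  unfolding pr_def by (intro d1_rules)

lemma d1_dec: "rt s \<Longrightarrow> rt t \<Longrightarrow> d1 (\<lambda>e. s e \<in> dec (t e))"
proof -
  have "d1 (\<lambda>e. e 0 \<in> dec (e 1))" unfolding dec_def mem_Collect_eq by (intro d1_rules rt_pr)
  then show "rt s \<Longrightarrow> rt t \<Longrightarrow> d1 (\<lambda>e. s e \<in> dec (t e))"
    using d1_subst2[of s t "\<lambda>x c. x \<in> dec c"] by simp
qed

text \<open>Plays the part of the factorial: recursion is not yet available, but the existence of a
  multiple is a Sigma1 statement.\<close>

lemma common_multiple: "\<exists>m. 0 < m \<and> (\<forall>D\<le>(b :: 'm). 0 < D \<longrightarrow> D dvd m)"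
proof (rule sg_induct[of "\<lambda>b. \<exists>m. 0 < m \<and> (\<forall>D\<le>b. 0 < D \<longrightarrow> D dvd m)"])
  show "sg (\<lambda>e. \<exists>m. 0 < m \<and> (\<forall>D\<le>e 0. 0 < D \<longrightarrow> D dvd m))"
    by (rule sg_ex, rule d1_sg, intro d1_rules)
  show "\<exists>m. 0 < m \<and> (\<forall>D\<le>(0 :: 'm). 0 < D \<longrightarrow> D dvd m)" by (rule exI[of _ 1]) (auto simp: not_less[symmetric])
  fix b :: 'm assume "\<exists>m. 0 < m \<and> (\<forall>D\<le>b. 0 < D \<longrightarrow> D dvd m)"
  then obtain m where m: "0 < m" "\<And>D. D \<le> b \<Longrightarrow> 0 < D \<Longrightarrow> D dvd m" by auto
  have "D dvd m * (b + 1)" if "D \<le> b + 1" "0 < D" for D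
  proof (cases "D \<le> b")
    case True
    then show ?thesis using m(2) that by simp
  next
    case False
    then have "D = b + 1" using that by (simp add: less_iff_succ_less_eq not_le)
    then show ?thesis by simp
  qed
  moreover have "0 < m * (b + 1)" using m(1) by (simp add: zero_less_iff_neq_zero)
  ultimately show "\<exists>m. 0 < m \<and> (\<forall>D\<le>b + 1. 0 < D \<longrightarrow> D dvd m)" by (intro exI[of _ "m * (b + 1)"]) simp
qed

text \<open>The code is built by induction on \<open>j\<close>: an element \<open>j\<close> is added
  by multiplying \<open>q\<close> by its modulus, which by coprimality adds no other index below
  \<open>b\<close>. As \<open>m\<close> is positive, no modulus divides 1, and 1 codes the empty
  set.\<close>

lemma finite_code:
  assumes "X \<in> S" shows "\<exists>c. \<forall>i<b. i \<in> dec c \<longleftrightarrow> i \<in> X"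
proof -
  obtain m where m: "0 < m" "\<And>D. D \<le> b \<Longrightarrow> 0 < D \<Longrightarrow> D dvd m" using common_multiple[of b] by auto
  have "\<exists>q. \<forall>i<b. m * (i + 1) + 1 dvd q \<longleftrightarrow> i < j \<and> i \<in> X" for j
  proof (rule sg_induct[of "\<lambda>j. \<exists>q. \<forall>i<b. m * (i + 1) + 1 dvd q \<longleftrightarrow> i < j \<and> i \<in> X"])
    show "sg (\<lambda>e. \<exists>q. \<forall>i<b. m * (i + 1) + 1 dvd q \<longleftrightarrow> i < e 0 \<and> i \<in> X)"
      by (rule sg_ex, rule d1_sg, intro d1_rules assms)
    have "\<not> m * (i + 1) + 1 dvd 1" for i
    proof
      assume "m * (i + 1) + 1 dvd 1"
      then obtain k where k: "1 = (m * (i + 1) + 1) * k" ..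
      then have "1 \<le> k" by (metis mult_zero_right not_less pos_iff zero_less_iff_neq_zero zero_neq_one)
      then have "(m * (i + 1) + 1) * 1 \<le> (m * (i + 1) + 1) * k" by (rule mult_left_mono) simp
      then have "m * (i + 1) + 1 \<le> 1" using k by simp
      then show False using m(1) by (simp add: zero_less_iff_neq_zero)
    qed
    then show "\<exists>q. \<forall>i<b. m * (i + 1) + 1 dvd q \<longleftrightarrow> i < 0 \<and> i \<in> X" by (intro exI[of _ 1]) simp
    fix j assume "\<exists>q. \<forall>i<b. m * (i + 1) + 1 dvd q \<longleftrightarrow> i < j \<and> i \<in> X"
    then obtain q where q: "\<And>i. i < b \<Longrightarrow> m * (i + 1) + 1 dvd q \<longleftrightarrow> i < j \<and> i \<in> X" by auto
    show "\<exists>q. \<forall>i<b. m * (i + 1) + 1 dvd q \<longleftrightarrow> i < j + 1 \<and> i \<in> X"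
    proof (cases "j \<in> X \<and> j < b")
      case True
      have "m * (i + 1) + 1 dvd q * (m * (j + 1) + 1) \<longleftrightarrow> i < j + 1 \<and> i \<in> X" if i: "i < b" for i
      proof (cases "i = j")
        case i_j: True
        then show ?thesis using True by (simp add: less_add_1_iff)
      next
        case False
        have "m * (i + 1) + 1 dvd q * (m * (j + 1) + 1) \<longleftrightarrow> m * (i + 1) + 1 dvd q"
        proof
          assume "m * (i + 1) + 1 dvd q * (m * (j + 1) + 1)"
          then show "m * (i + 1) + 1 dvd q"
            by (rule code_modulus_dvd_cancel[OF False, rotated]) (use m(2) i True in \<open>auto intro: order_trans less_imp_le\<close>)
        qed simp
        then show ?thesis using q[OF i] False by (auto simp: less_add_1_iff)
      qed
      then show ?thesis by blast
    next
      case False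
      have "m * (i + 1) + 1 dvd q \<longleftrightarrow> i < j + 1 \<and> i \<in> X" if "i < b" for i
        using q[OF that] False that by (auto simp: less_add_1_iff le_less)
      then show ?thesis by blast
    qed
  qed
  from this[of b] obtain q where "\<forall>i<b. m * (i + 1) + 1 dvd q \<longleftrightarrow> i < b \<and> i \<in> X" by auto
  then show ?thesis by (intro exI[of _ "pr m q"]) (simp add: dec_pr)
qed

text \<open>Codes that follow the recursion up to a given length exist by Sigma1 induction, and any
  two agree where both are defined. So membership in \<open>H\<close> is decided by any long enough
  code, and both \<open>H\<close> and its complement are Sigma1.\<close>

lemma set_recursion:
  assumes P: "d1 (\<lambda>e. P (dec (e 0)) (e 1))"
    and local: "\<And>X Y y. (\<And>z. z < y \<Longrightarrow> z \<in> X \<longleftrightarrow> z \<in> Y) \<Longrightarrow> P X y \<longleftrightarrow> P Y y"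
  shows "\<exists>H\<in>S. \<forall>y. y \<in> H \<longleftrightarrow> P H y"
proof -
  have dP: "d1 (\<lambda>e. P (dec (s e)) (t e))" if "rt s" "rt t" for s t
    using d1_subst2[OF that, of "\<lambda>c. P (dec c)"] P by simp
  define good where "good c y \<longleftrightarrow> (\<forall>z<y. z \<in> dec c \<longleftrightarrow> P (dec c) z)" for c y
  have d_good: "d1 (\<lambda>e. good (s e) (t e))" if "rt s" "rt t" for s t
  proof -
    have "d1 (\<lambda>e. good (e 0) (e 1))" unfolding good_def by (intro d1_rules d1_dec dP)
    then show ?thesis using d1_subst2[OF that, of good] by simp
  qed
  have good_ex: "\<exists>c. good c y" for y
  proof (rule sg_induct[of "\<lambda>y. \<exists>c. good c y"])
    show "sg (\<lambda>e. \<exists>c. good c (e 0))" by (rule sg_ex, rule d1_sg, intro d_good d1_rules)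
    show "\<exists>c. good c 0" by (simp add: good_def)
    fix y assume "\<exists>c. good c y"
    then obtain c where c: "good c y" ..
    have "{z. (z < y \<and> z \<in> dec c) \<or> (z = y \<and> P (dec c) y)} \<in> S"
      by (rule comprehension) (intro d1_rules d1_dec dP)
    from finite_code[OF this, of "y + 1"] obtain c' where
      c': "\<And>z. z \<le> y \<Longrightarrow> z \<in> dec c' \<longleftrightarrow> (z < y \<and> z \<in> dec c) \<or> (z = y \<and> P (dec c) y)"
      by (auto simp: less_add_1_iff)
    have eq: "P (dec c') z \<longleftrightarrow> P (dec c) z" if "z \<le> y" for z
      by (rule local) (use that c' in auto)
    have "z \<in> dec c' \<longleftrightarrow> P (dec c') z" if "z < y + 1" for z
      using that c'[of z] eq[of z] c unfolding good_def by (auto simp: less_add_1_iff le_less)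
    then show "\<exists>c. good c (y + 1)" unfolding good_def by blast
  qed
  have unique: "z \<in> dec c \<longleftrightarrow> z \<in> dec c'" if "z < y" "z < y'" "good c y" "good c' y'" for c c' y y' z
  proof -
    have "z < y \<and> z < y' \<longrightarrow> (z \<in> dec c \<longleftrightarrow> z \<in> dec c')" for z
    proof (rule d1_less_induct[of "\<lambda>z. z < y \<and> z < y' \<longrightarrow> (z \<in> dec c \<longleftrightarrow> z \<in> dec c')"])
      show "d1 (\<lambda>e. e 0 < y \<and> e 0 < y' \<longrightarrow> (e 0 \<in> dec c \<longleftrightarrow> e 0 \<in> dec c'))" by (intro d1_rules d1_dec)
      fix z assume IH: "\<And>w. w < z \<Longrightarrow> w < y \<and> w < y' \<longrightarrow> (w \<in> dec c \<longleftrightarrow> w \<in> dec c')"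
      show "z < y \<and> z < y' \<longrightarrow> (z \<in> dec c \<longleftrightarrow> z \<in> dec c')"
      proof
        assume z: "z < y \<and> z < y'"
        have "w \<in> dec c \<longleftrightarrow> w \<in> dec c'" if "w < z" for w
          using IH[OF that] z that by (meson less_trans)
        then have "P (dec c) z \<longleftrightarrow> P (dec c') z" by (rule local)
        then show "z \<in> dec c \<longleftrightarrow> z \<in> dec c'" using z that(3,4) unfolding good_def by auto
      qed
    qed
    then show ?thesis using that(1,2) by simp
  qed
  define H where "H = {x. \<exists>c. good c (x + 1) \<and> x \<in> dec c}"
  have H: "x \<in> H \<longleftrightarrow> x \<in> dec c" if "good c y" "x < y" for x c y
  proof -
    have "z < y" if "z < x + 1" for z
      using that \<open>x < y\<close> unfolding less_add_1_iff by (rule le_less_trans)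
    then have g: "good c (x + 1)" using that(1) unfolding good_def by simp
    have x: "x < x + 1" by simp
    show ?thesis
    proof
      assume "x \<in> H"
      then obtain c' where "good c' (x + 1)" "x \<in> dec c'" unfolding H_def by auto
      then show "x \<in> dec c" using unique[OF x that(2) _ that(1), of c'] by simp
    next
      assume "x \<in> dec c"
      then show "x \<in> H" unfolding H_def using g by auto
    qed
  qed
  have "x \<notin> H \<longleftrightarrow> (\<exists>c. good c (x + 1) \<and> x \<notin> dec c)" for x
  proof -
    have x: "x < x + 1" by simp
    obtain c where c: "good c (x + 1)" using good_ex[of "x + 1"] by auto
    show ?thesis
    proof
      assume "x \<notin> H"
      then show "\<exists>c. good c (x + 1) \<and> x \<notin> dec c" using H[OF c x] c by auto
    next
      assume "\<exists>c. good c (x + 1) \<and> x \<notin> dec c"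
      then obtain c' where "good c' (x + 1)" "x \<notin> dec c'" by auto
      then show "x \<notin> H" using H[of c' "x + 1" x] x by simp
    qed
  qed
  then have "(\<lambda>e :: nat \<Rightarrow> 'm. \<not> (\<exists>c. good c (e 0 + 1) \<and> e 0 \<in> dec c)) = (\<lambda>e. \<exists>c. good c (e 0 + 1) \<and> e 0 \<notin> dec c)"
    unfolding H_def mem_Collect_eq by (simp only:)
  moreover have "sg (\<lambda>e. \<exists>c. good c (e 0 + 1) \<and> e 0 \<in> dec c)"
    by (rule sg_ex, rule d1_sg, intro d_good d1_dec d1_rules)
  moreover have "sg (\<lambda>e. \<exists>c. good c (e 0 + 1) \<and> e 0 \<notin> dec c)"
    by (rule sg_ex, rule d1_sg, intro d_good d1_dec d1_rules)
  ultimately have "d1 (\<lambda>e. \<exists>c. good c (e 0 + 1) \<and> e 0 \<in> dec c)" unfolding d1_def by simp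
  then have "H \<in> S" unfolding H_def by (rule comprehension)
  moreover have "y \<in> H \<longleftrightarrow> P H y" for y
  proof -
    obtain c where c: "good c (y + 1)" using good_ex by blast
    have "P H y \<longleftrightarrow> P (dec c) y"
      by (rule local) (use H[OF c] in \<open>simp add: less_add_1_iff\<close>)
    also have "\<dots> \<longleftrightarrow> y \<in> dec c" using c unfolding good_def by (simp add: less_add_1_iff)
    also have "\<dots> \<longleftrightarrow> y \<in> H" using H[OF c] by (simp add: less_add_1_iff)
    finally show ?thesis by simp
  qed
  ultimately show ?thesis by auto
qed

text \<open>Values that do not decrease make the graph definable by set recursion, as then
  \<open>pr p (pr n (V p n)) < pr p (pr (n + 1) (V p (n + 1)))\<close>.\<close>

lemma primitive_recursion:
  assumes C: "rt (\<lambda>e. C (e 0))" and F: "rt (\<lambda>e. F (e 0) (e 1) (e 2))" and mono: "\<And>p n w. w \<le> F p n w"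
  obtains V where "\<And>p. V p 0 = C p" "\<And>p n. V p (n + 1) = F p n (V p n)" "rt (\<lambda>e. V (e 0) (e 1))"
proof -
  have rtF: "rt (\<lambda>e. F (a e) (b e) (c e))" if "rt a" "rt b" "rt c" for a b c
  proof -
    have "rt (\<lambda>e. F (e 0) (e 1) (c (\<lambda>n. e (Suc (Suc n)))))"
    proof -
      have "sg (\<lambda>e. e 1 = F (e 2) (e 3) (e 0))"
        using definable_ren[OF F[unfolded rt_def], of "case_nat 1 (case_nat 2 (case_nat 3 (\<lambda>n. 0)))"]
        by (simp add: numeral_2_eq_2 numeral_3_eq_3)
      then show ?thesis
        unfolding rt_def
        using sg_subst[OF rt_ren[OF that(3), of "\<lambda>n. Suc (Suc (Suc n))"], of "\<lambda>e y. e 0 = F (e 1) (e 2) y"]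
        by (simp add: numeral_2_eq_2 numeral_3_eq_3)
    qed
    then have "sg (\<lambda>e. e 1 = F (e 2) (e 0) (c (\<lambda>n. e (Suc (Suc (Suc n))))))"
      using definable_ren[of "std S" Sigma1 "\<lambda>e. e 0 = F (e 1) (e 2) (c (\<lambda>n. e (Suc (Suc (Suc n)))))"
          "case_nat 1 (case_nat 2 (case_nat 0 (\<lambda>n. Suc (Suc (Suc n)))))"]
      unfolding rt_def by (simp add: numeral_2_eq_2 numeral_3_eq_3)
    then have "sg (\<lambda>e. e 0 = F (e 1) (b (\<lambda>n. e (Suc (Suc n)))) (c (\<lambda>n. e (Suc (Suc n)))))"
      using sg_subst[OF rt_ren[OF that(2), of "\<lambda>n. Suc (Suc n)"],
          of "\<lambda>e y. e 0 = F (e 1) y (c (\<lambda>n. e (Suc (Suc n))))"] by (simp add: numeral_2_eq_2 numeral_3_eq_3)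
    then have "sg (\<lambda>e. e 1 = F (e 0) (b (\<lambda>n. e (Suc (Suc n)))) (c (\<lambda>n. e (Suc (Suc n)))))"
      using definable_ren[of "std S" Sigma1 "\<lambda>e. e 0 = F (e 1) (b (\<lambda>n. e (Suc (Suc n)))) (c (\<lambda>n. e (Suc (Suc n))))"
          "case_nat 1 (case_nat 0 (\<lambda>n. Suc (Suc n)))"] by simp
    then show ?thesis
      unfolding rt_def
      using sg_subst[OF rt_ren[OF that(1), of Suc], of "\<lambda>e y. e 0 = F y (b (\<lambda>n. e (Suc n))) (c (\<lambda>n. e (Suc n)))"]
      by simp
  qed
  define P where "P X y \<longleftrightarrow> (\<exists>p\<le>y. \<exists>n\<le>y. \<exists>v\<le>y. y = pr p (pr n v) \<and>
      ((n = 0 \<and> v = C p) \<or> (\<exists>m<n. \<exists>w\<le>v. n = m + 1 \<and> v = F p m w \<and> pr p (pr m w) \<in> X)))" for X y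
  have P_pr: "P X (pr p (pr n v)) \<longleftrightarrow> (n = 0 \<and> v = C p) \<or>
      (\<exists>m w. n = m + 1 \<and> v = F p m w \<and> pr p (pr m w) \<in> X)" for X p n v
  proof -
    have "p \<le> pr p (pr n v)" "n \<le> pr p (pr n v)" "v \<le> pr p (pr n v)"
      using le_pr by (blast intro: order_trans)+
    then have "P X (pr p (pr n v)) \<longleftrightarrow> (n = 0 \<and> v = C p) \<or>
      (\<exists>m<n. \<exists>w\<le>v. n = m + 1 \<and> v = F p m w \<and> pr p (pr m w) \<in> X)"
      unfolding P_def by auto
    then show ?thesis using mono by (auto simp: less_add_1_iff)
  qed
  have "\<exists>H\<in>S. \<forall>y. y \<in> H \<longleftrightarrow> P H y"
  proof (rule set_recursion)
    show "d1 (\<lambda>e. P (dec (e 0)) (e 1))"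
      unfolding P_def by (intro d1_rules d1_dec rt_pr rtF rt_subst[OF C])
    fix X Y :: "'m set" and y assume XY: "\<And>z. z < y \<Longrightarrow> z \<in> X \<longleftrightarrow> z \<in> Y"
    have "pr p (pr m w) \<in> X \<longleftrightarrow> pr p (pr m w) \<in> Y" if "y = pr p (pr (m + 1) v)" "w \<le> v" for p m w v
    proof (rule XY)
      have "m + w < (m + 1) + v" using that(2) unfolding emb_simps by linarith
      then show "pr p (pr m w) < y" unfolding that(1) by (intro pr_less_pr pr_less)
    qed
    then have eq: "pr p (pr m w) \<in> X \<longleftrightarrow> pr p (pr m w) \<in> Y" if "y = pr p (pr (m + 1) (F p m w))" for p m w
      using that mono by simp
    show "P X y \<longleftrightarrow> P Y y"
    proof (cases "\<exists>p n v. y = pr p (pr n v)")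
      case True
      then obtain p n v where y: "y = pr p (pr n v)" by auto
      show ?thesis unfolding y P_pr using eq[of p] y by auto
    next
      case False
      then show ?thesis unfolding P_def by simp
    qed
  qed
  then obtain H where H: "H \<in> S" "\<And>y. y \<in> H \<longleftrightarrow> P H y" by auto
  note H_pr = H(2)[of "pr _ (pr _ _)", unfolded P_pr]
  have ex: "\<exists>v. pr p (pr n v) \<in> H" for p n
  proof (rule sg_induct[of "\<lambda>n. \<exists>v. pr p (pr n v) \<in> H"])
    show "sg (\<lambda>e. \<exists>v. pr p (pr (e 0) v) \<in> H)" by (rule sg_ex, rule d1_sg, intro d1_rules rt_pr H(1))
    show "\<exists>v. pr p (pr 0 v) \<in> H" using H_pr[of p 0 "C p"] by blast
    show "\<exists>v. pr p (pr (n + 1) v) \<in> H" if "\<exists>v. pr p (pr n v) \<in> H" for n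
      using that H_pr[of p "n + 1"] by blast
  qed
  have uniq: "v = v'" if "pr p (pr n v) \<in> H" "pr p (pr n v') \<in> H" for p n v v'
  proof -
    \<comment> \<open>Bounding both values by \<open>v + v'\<close> keeps the induction formula
      Delta1; the bound persists at predecessors because values do not decrease.\<close>
    have "\<forall>x\<le>v + v'. \<forall>y\<le>v + v'. pr p (pr n x) \<in> H \<and> pr p (pr n y) \<in> H \<longrightarrow> x = y" for n
    proof (rule d1_induct[of "\<lambda>n. \<forall>x\<le>v + v'. \<forall>y\<le>v + v'. pr p (pr n x) \<in> H \<and> pr p (pr n y) \<in> H \<longrightarrow> x = y"])
      show "d1 (\<lambda>e. \<forall>x\<le>v + v'. \<forall>y\<le>v + v'. pr p (pr (e 0) x) \<in> H \<and> pr p (pr (e 0) y) \<in> H \<longrightarrow> x = y)"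
        by (intro d1_rules rt_pr H(1))
      show "\<forall>x\<le>v + v'. \<forall>y\<le>v + v'. pr p (pr 0 x) \<in> H \<and> pr p (pr 0 y) \<in> H \<longrightarrow> x = y"
        using H_pr[of p 0] by simp
      fix n assume IH: "\<forall>x\<le>v + v'. \<forall>y\<le>v + v'. pr p (pr n x) \<in> H \<and> pr p (pr n y) \<in> H \<longrightarrow> x = y"
      show "\<forall>x\<le>v + v'. \<forall>y\<le>v + v'. pr p (pr (n + 1) x) \<in> H \<and> pr p (pr (n + 1) y) \<in> H \<longrightarrow> x = y"
      proof (intro allI impI)
        fix x y assume xy: "x \<le> v + v'" "y \<le> v + v'" "pr p (pr (n + 1) x) \<in> H \<and> pr p (pr (n + 1) y) \<in> H"
        obtain w w' where w: "x = F p n w" "pr p (pr n w) \<in> H" "y = F p n w'" "pr p (pr n w') \<in> H"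
          using xy(3) H_pr[of p "n + 1"] by auto
        have "w \<le> v + v'" "w' \<le> v + v'" using mono[of w p n] mono[of w' p n] w xy by auto
        then have "w = w'" using IH w(2,4) by blast
        then show "x = y" using w by simp
      qed
    qed
    then show ?thesis using that by simp
  qed
  define V where "V p n = (THE v. pr p (pr n v) \<in> H)" for p n
  have V: "pr p (pr n v) \<in> H \<longleftrightarrow> v = V p n" for p n v
  proof -
    obtain w where w: "pr p (pr n w) \<in> H" using ex by blast
    then have "V p n = w" unfolding V_def by (intro the_equality) (use uniq in auto)
    then show ?thesis using w uniq by auto
  qed
  show ?thesis
  proof (rule that)
    show "V p 0 = C p" for p using H_pr[of p 0 "C p"] V by simp
    show "V p (n + 1) = F p n (V p n)" for p n using H_pr[of p "n + 1" "F p n (V p n)"] V by auto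
    have "sg (\<lambda>e. pr (e 1) (pr (e 2) (e 0)) \<in> H)" by (intro d1_sg d1_rules rt_pr H(1))
    then show "rt (\<lambda>e. V (e 0) (e 1))" unfolding rt_def by (simp add: V numeral_2_eq_2)
  qed
qed

end

context rca
begin

lemma rt_fun_iff: "rt (\<lambda>e. A (e 0)) \<longleftrightarrow> {z. \<exists>x. z = pr x (A x)} \<in> S"
proof
  assume A: "rt (\<lambda>e. A (e 0))"
  have "{z. \<exists>x\<le>z. \<exists>y\<le>z. z = pr x y \<and> y = A x} \<in> S"
    by (rule comprehension) (intro d1_rules rt_pr rt_subst[OF A])
  moreover have "(\<exists>x\<le>z. \<exists>y\<le>z. z = pr x y \<and> y = A x) \<longleftrightarrow> (\<exists>x. z = pr x (A x))" for z
    using le_pr by auto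
  ultimately show "{z. \<exists>x. z = pr x (A x)} \<in> S" by simp
next
  assume A: "{z. \<exists>x. z = pr x (A x)} \<in> S"
  have "sg (\<lambda>e. pr (e 1) (e 0) \<in> {z. \<exists>x. z = pr x (A x)})" by (intro d1_sg d1_rules rt_pr A)
  then show "rt (\<lambda>e. A (e 0))" unfolding rt_def by simp
qed

lemma d1_subst3:
  assumes "rt a" "rt b" "rt c" "d1 (\<lambda>e. Q (e 0) (e 1) (e 2))"
  shows "d1 (\<lambda>e. Q (a e) (b e) (c e))"
proof -
  have "d1 (\<lambda>e. Q (e 0) (e 1) (c (\<lambda>n. e (Suc (Suc n)))))"
    using d1_subst[OF rt_ren[OF assms(3), of "\<lambda>n. Suc (Suc n)"], of "\<lambda>e y. Q (e 0) (e 1) y"]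
      d1_ren[OF assms(4), of "case_nat 1 (case_nat 2 (\<lambda>n. 0))"] by (simp add: numeral_2_eq_2)
  from d1_ren[OF this, of "case_nat 1 (case_nat 0 (\<lambda>n. Suc (Suc n)))"]
  have "d1 (\<lambda>e. Q (e 0) (b (\<lambda>n. e (Suc n))) (c (\<lambda>n. e (Suc n))))"
    using d1_subst[OF rt_ren[OF assms(2), of Suc], of "\<lambda>e y. Q (e 0) y (c (\<lambda>n. e (Suc n)))"] by simp
  then show ?thesis
    using d1_subst[OF assms(1), of "\<lambda>e y. Q y (b e) (c e)"] by simp
qed

text \<open>The normal form of an enumerable set as a projection of a set of the model;
  \<open>pr k t \<in> \<theta>\<close> is read as: \<open>k\<close> is enumerated at stage
  \<open>t\<close>.\<close>

lemma sg_set_of_pairs: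
  assumes "sg (\<lambda>e. Q (e 0))"
  obtains \<theta> where "\<theta> \<in> S" "\<And>k. Q k \<longleftrightarrow> (\<exists>t. pr k t \<in> \<theta>)"
proof -
  obtain R where R: "d0 (\<lambda>e. R (\<lambda>n. e (Suc n)) (e 0))" "\<And>e. Q (e 0) \<longleftrightarrow> (\<exists>z. R e z)"
    using assms unfolding sg_iff by auto
  have "d0 (\<lambda>e. R (\<lambda>n. e 1) (e 0))"
    using definable_ren[OF R(1), of "case_nat 0 (\<lambda>n. 1)"] by simp
  then have *: "d1 (\<lambda>e. R (\<lambda>n. t e) (s e))" if "rt s" "rt t" for s t
    using d1_subst2[OF that, of "\<lambda>x y. R (\<lambda>n. y) x"] d0_d1 by simp
  have "{z. \<exists>k\<le>z. \<exists>t\<le>z. z = pr k t \<and> R (\<lambda>n. k) t} \<in> S"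
    by (rule comprehension) (intro d1_rules rt_pr *)
  moreover have "Q k \<longleftrightarrow> (\<exists>t. pr k t \<in> {z. \<exists>k\<le>z. \<exists>t\<le>z. z = pr k t \<and> R (\<lambda>n. k) t})" for k
    using R(2)[of "\<lambda>n. k"] by (simp add: le_pr)
  ultimately show ?thesis by (rule that)
qed

lemma sequence_recursion:
  assumes "rt (\<lambda>e. F (e 0) (e 1))" "\<And>n w. w \<le> F n w"
  obtains V where "V 0 = c" "\<And>n. V (n + 1) = F n (V n)" "rt (\<lambda>e. V (e 0))"
proof -
  have *: "rt (\<lambda>e. F (e 1) (e 2))"
    using rt_subst2[of F "\<lambda>e. e 1" "\<lambda>e. e 2"] assms(1) by (simp add: rt_var)
  obtain V where "\<And>p. V p 0 = c" "\<And>p n. V p (n + 1) = F n (V p n)" "rt (\<lambda>e. V (e 0) (e 1))"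
    by (rule primitive_recursion[of "\<lambda>p. c" "\<lambda>p. F"]) (use assms(2) * rt_const in auto)
  then show ?thesis using that[of "V 0"] rt_subst2[of V "\<lambda>e. 0" "\<lambda>e. e 0"] rt_const rt_var by auto
qed

section \<open>Powers of two\<close>

definition pow2 :: "'m \<Rightarrow> 'm" where
  "pow2 = (SOME f. f 0 = 1 \<and> (\<forall>n. f (n + 1) = 2 * f n) \<and> rt (\<lambda>e. f (e 0)))"

lemma pow2_spec: "pow2 0 = 1 \<and> (\<forall>n. pow2 (n + 1) = 2 * pow2 n) \<and> rt (\<lambda>e. pow2 (e 0))"
proof -
  have "\<exists>f. f 0 = 1 \<and> (\<forall>n. f (n + 1) = 2 * f n) \<and> rt (\<lambda>e. f (e 0))"
  proof -
    have "rt (\<lambda>e. 2 * e 1)" by (intro d1_rules)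
    moreover have "w \<le> 2 * w" for w :: 'm using emb_nonneg[of w] unfolding emb_simps by linarith
    ultimately obtain V where "V 0 = 1" "\<And>n. V (n + 1) = 2 * V n" "rt (\<lambda>e. V (e 0))"
      by (rule sequence_recursion[of "\<lambda>n w. 2 * w" 1]) (rule that; assumption)
    then show ?thesis by blast
  qed
  then show ?thesis unfolding pow2_def by (rule someI_ex)
qed

lemma pow2_0 [simp]: "pow2 0 = 1" and pow2_add_1: "pow2 (n + 1) = 2 * pow2 n"
  using pow2_spec by auto

lemma rt_pow2: "rt t \<Longrightarrow> rt (\<lambda>e. pow2 (t e))"
  by (rule rt_subst[of pow2]) (use pow2_spec in auto)

lemma pow2_pos: "0 < pow2 n"
proof (rule d1_induct[of "\<lambda>n. 0 < pow2 n"])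
  show "d1 (\<lambda>e. 0 < pow2 (e 0))" by (intro d1_rules rt_pow2)
qed (simp_all add: pow2_add_1)

lemma less_pow2: "n < pow2 n"
proof (rule d1_induct[of "\<lambda>n. n < pow2 n"])
  show "d1 (\<lambda>e. e 0 < pow2 (e 0))" by (intro d1_rules rt_pow2)
  show "n + 1 < pow2 (n + 1)" if "n < pow2 n" for n
    using that pow2_pos[of n] unfolding pow2_add_1 emb_simps by simp
qed simp

lemma pow2_add: "pow2 (m + n) = pow2 m * pow2 n"
proof (rule d1_induct[of "\<lambda>n. pow2 (m + n) = pow2 m * pow2 n"])
  show "d1 (\<lambda>e. pow2 (m + e 0) = pow2 m * pow2 (e 0))" by (intro d1_rules rt_pow2)
  show "pow2 (m + (n + 1)) = pow2 m * pow2 (n + 1)" if "pow2 (m + n) = pow2 m * pow2 n" for n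
    using that pow2_add_1[of "m + n"] by (simp add: add.assoc pow2_add_1 mult.left_commute)
qed simp

definition Pw :: "'m set" where
  "Pw = range pow2"

lemma Pw_in_S: "Pw \<in> S"
proof -
  have "{y. \<exists>n\<le>y. y = pow2 n} \<in> S" by (rule comprehension) (intro d1_rules rt_pow2)
  moreover have "{y. \<exists>n\<le>y. y = pow2 n} = Pw" unfolding Pw_def using less_pow2 less_imp_le by auto
  ultimately show ?thesis by simp
qed

lemma d1_Pw: "rt t \<Longrightarrow> d1 (\<lambda>e. t e \<in> Pw)"
  by (rule d1_mem[OF Pw_in_S])

lemma Pw_pos: "q \<in> Pw \<Longrightarrow> 0 < q"
  unfolding Pw_def using pow2_pos by auto

lemma dvd_le: "q dvd x \<Longrightarrow> 0 < x \<Longrightarrow> q \<le> (x :: 'm)"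
proof -
  assume "q dvd x" "0 < x"
  then obtain k where k: "x = q * k" by auto
  then have "1 \<le> k" using \<open>0 < x\<close> by (metis mult_zero_right pos_iff zero_less_iff_neq_zero)
  then have "q * 1 \<le> q * k" by (rule mult_left_mono) simp
  then show ?thesis using k by simp
qed

lemma pow2_less_dvd: "m < n \<Longrightarrow> 2 * pow2 m dvd pow2 n"
proof -
  assume "m < n"
  then have "m + 1 \<le> n" by (simp add: less_iff_succ_less_eq)
  then obtain d where "n = (m + 1) + d" by (metis le_iff_add)
  then show ?thesis using pow2_add[of "m + 1" d] by (simp add: pow2_add_1)
qed

lemma pow2_less: "m < n \<Longrightarrow> pow2 m < pow2 n"
proof -
  assume "m < n"
  then have "2 * pow2 m \<le> pow2 n" using dvd_le pow2_less_dvd pow2_pos by blast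
  then show ?thesis using pow2_pos[of m] unfolding emb_simps by simp
qed

lemma pow2_less_iff: "pow2 m < pow2 n \<longleftrightarrow> m < n"
  using pow2_less by (metis less_asym linorder_neqE)

lemma Pw_less: "q \<in> Pw \<Longrightarrow> q' \<in> Pw \<Longrightarrow> q < q' \<Longrightarrow> 2 * q dvd q'"
  unfolding Pw_def using pow2_less_iff pow2_less_dvd by auto

lemma Pw_less_le: "q \<in> Pw \<Longrightarrow> q' \<in> Pw \<Longrightarrow> q < q' \<Longrightarrow> 2 * q \<le> q'"
  using Pw_less dvd_le Pw_pos by blast

lemma Pw_le_dvd: "q \<in> Pw \<Longrightarrow> q' \<in> Pw \<Longrightarrow> q \<le> q' \<Longrightarrow> q dvd q'"
  using Pw_less by (metis dvd_mult_right dvd_refl le_less)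

text \<open>\<open>u\<close> is the leading binary digit of \<open>x\<close>: half of the least
  power of two above \<open>x\<close>.\<close>

lemma Pw_top:
  assumes "0 < x" obtains u r where "u \<in> Pw" "r < u" "x = u + r"
proof -
  have "\<exists>n. x < pow2 n \<and> (\<forall>m<n. \<not> x < pow2 m)"
    by (rule d1_least[of "\<lambda>n. x < pow2 n" x]) (intro d1_rules rt_pow2, rule less_pow2)
  then obtain n where n: "x < pow2 n" "\<And>m. m < n \<Longrightarrow> \<not> x < pow2 m" by auto
  have "n \<noteq> 0" using n(1) assms pos_iff[of x] by (auto simp: not_le[symmetric])
  then obtain m where m: "n = m + 1" using zero_or_suc[of n] by auto
  have le: "pow2 m \<le> x" using n(2)[of m] m by (simp add: less_add_1_iff not_less)
  then obtain r where r: "x = pow2 m + r" by (metis le_iff_add)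
  have "r < pow2 m" using n(1) unfolding m pow2_add_1 r emb_simps by simp
  then show ?thesis using that[of "pow2 m" r] r by (simp add: Pw_def)
qed

lemma Pw_top_unique:
  assumes "u \<in> Pw" "u' \<in> Pw" "r < u" "r' < u'" "u + r = u' + r'" shows "u = u' \<and> r = r'"
proof -
  have *: "\<not> v < w" if "v \<in> Pw" "w \<in> Pw" "a < v" "v + a = w + b" for v w a b
  proof
    assume "v < w"
    then have "2 * v \<le> w" by (rule Pw_less_le[OF that(1,2)])
    then show False using that(3,4) emb_nonneg[of b] unfolding emb_simps by linarith
  qed
  have "u = u'" using *[of u u' r r'] *[of u' u r' r] assms by (metis linorder_neqE)
  then show ?thesis using assms by simp
qed

text \<open>The power of two with exponent \<lambda>(x), described by divisibility to avoid
  exponents.\<close>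

definition lowp :: "'m \<Rightarrow> 'm \<Rightarrow> bool" where
  "lowp x p \<longleftrightarrow> p \<in> Pw \<and> p dvd x \<and> \<not> 2 * p dvd x"

lemma d1_lowp: "rt s \<Longrightarrow> rt t \<Longrightarrow> d1 (\<lambda>e. lowp (s e) (t e))"
  unfolding lowp_def by (intro d1_rules d1_Pw)

lemma lowp_exists:
  assumes "0 < x" obtains p where "lowp x p"
proof -
  have "\<exists>n. \<not> pow2 n dvd x \<and> (\<forall>m<n. \<not> \<not> pow2 m dvd x)"
  proof (rule d1_least[of "\<lambda>n. \<not> pow2 n dvd x" x])
    show "d1 (\<lambda>e. \<not> pow2 (e 0) dvd x)" by (intro d1_rules rt_pow2)
    show "\<not> pow2 x dvd x" using dvd_le[of "pow2 x" x] assms less_pow2[of x] by auto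
  qed
  then obtain n where n: "\<not> pow2 n dvd x" "\<And>m. m < n \<Longrightarrow> pow2 m dvd x" by auto
  have "n \<noteq> 0" using n(1) by auto
  then obtain m where m: "n = m + 1" using zero_or_suc[of n] by auto
  then show ?thesis using n that[of "pow2 m"] by (simp add: lowp_def Pw_def pow2_add_1 less_add_1_iff)
qed

lemma lowp_ge: "lowp x p \<Longrightarrow> q \<in> Pw \<Longrightarrow> q dvd x \<Longrightarrow> q \<le> p"
proof (rule ccontr)
  assume a: "lowp x p" "q \<in> Pw" "q dvd x" "\<not> q \<le> p"
  then have "2 * p dvd q" by (intro Pw_less) (simp_all add: lowp_def)
  then show False using a(1,3) dvd_trans[of "2 * p" q x] by (simp add: lowp_def)
qed

lemma lowp_unique: "lowp x p \<Longrightarrow> lowp x p' \<Longrightarrow> p = p'"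
  using lowp_ge[of x p p'] lowp_ge[of x p' p] unfolding lowp_def by auto

text \<open>Twice the lowest digit of \<open>x\<close> still divides \<open>q\<close> and hence
  \<open>y\<close>. Consequently a sum of apart elements has the lowest digit of its smallest
  summand.\<close>

lemma lowp_add:
  assumes "lowp x p" "0 < x" "x < q" "q \<in> Pw" "q dvd y" shows "lowp (x + y) p"
proof -
  have p: "p \<in> Pw" "p dvd x" "\<not> 2 * p dvd x" using assms(1) by (simp_all add: lowp_def)
  have "p \<le> x" using dvd_le[OF p(2) assms(2)] .
  then have "p < q" using assms(3) by (rule le_less_trans)
  then have "2 * p dvd q" by (rule Pw_less[OF p(1) assms(4)])
  then have y: "2 * p dvd y" using assms(5) by (rule dvd_trans)
  then have "p dvd y" by (rule dvd_mult_right)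
  then have "p dvd x + y" using p(2) by (rule dvd_add[rotated])
  moreover have "\<not> 2 * p dvd x + y" using p(3) y by (simp add: dvd_add_left_iff)
  ultimately show ?thesis using p(1) by (simp add: lowp_def)
qed

lemma multiples_less:
  fixes q x y :: 'm
  assumes "q dvd x" "q dvd y" "x < y" shows "x + q \<le> y"
proof -
  obtain a where a: "x = q * a" using assms(1) by (rule dvdE)
  obtain b where b: "y = q * b" using assms(2) by (rule dvdE)
  note ab = a b
  have "a < b" using assms(3) unfolding ab by (metis mult_left_mono not_less zero_le)
  then have "a + 1 \<le> b" by (simp add: less_iff_succ_less_eq)
  then have "q * (a + 1) \<le> q * b" by (rule mult_left_mono) simp
  then show ?thesis unfolding ab by (simp add: algebra_simps)
qed

text \<open>The sum W b c of all \<open>2\<^sup>k\<close> for k < c enumerated before b is less than \<open>2\<^sup>c\<close>, so it cannot grow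
  forever.\<close>

lemma strong_bounding:
  assumes \<theta>: "\<theta> \<in> S"
  shows "\<exists>b. \<forall>k<c. (\<exists>t. pr k t \<in> \<theta>) \<longrightarrow> (\<exists>t<b. pr k t \<in> \<theta>)"
proof (rule ccontr)
  assume neg: "\<nexists>b. \<forall>k<c. (\<exists>t. pr k t \<in> \<theta>) \<longrightarrow> (\<exists>t<b. pr k t \<in> \<theta>)"
  have "rt (\<lambda>e. e 2 + (if \<exists>t<e 0. pr (e 1) t \<in> \<theta> then pow2 (e 1) else 0))"
    by (intro d1_rules rt_pr rt_pow2 \<theta>)
  moreover have "w \<le> w + (if \<exists>t<b. pr j t \<in> \<theta> then pow2 j else 0)" for b j w by simp
  ultimately obtain W where W: "\<And>b. W b 0 = 0"
      "\<And>b j. W b (j + 1) = W b j + (if \<exists>t<b. pr j t \<in> \<theta> then pow2 j else 0)" "rt (\<lambda>e. W (e 0) (e 1))"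
    by (rule primitive_recursion[of "\<lambda>p. 0" "\<lambda>b j w. w + (if \<exists>t<b. pr j t \<in> \<theta> then pow2 j else 0)", OF rt_const])
      (rule that; assumption)
  have rtW: "rt s \<Longrightarrow> rt t \<Longrightarrow> rt (\<lambda>e. W (s e) (t e))" for s t by (rule rt_subst2[OF W(3)])
  have W_less: "W b j < pow2 j" for b j
  proof (rule d1_induct[of "\<lambda>j. W b j < pow2 j"])
    show "d1 (\<lambda>e. W b (e 0) < pow2 (e 0))" by (intro d1_rules rtW rt_pow2)
    show "W b (j + 1) < pow2 (j + 1)" if "W b j < pow2 j" for j
      using that pow2_pos[of j] unfolding W pow2_add_1 emb_simps by auto
  qed (simp add: W)
  have W_mono: "W b j \<le> W b' j" if "b \<le> b'" for b b' j
  proof (rule d1_induct[of "\<lambda>j. W b j \<le> W b' j"])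
    show "d1 (\<lambda>e. W b (e 0) \<le> W b' (e 0))" by (intro d1_rules rtW)
    show "W b (j + 1) \<le> W b' (j + 1)" if IH: "W b j \<le> W b' j" for j
    proof -
      have "(if \<exists>t<b. pr j t \<in> \<theta> then pow2 j else 0) \<le> (if \<exists>t<b'. pr j t \<in> \<theta> then pow2 j else 0)"
        using \<open>b \<le> b'\<close> by (auto intro: less_le_trans)
      then show ?thesis unfolding W using IH by (rule add_mono[rotated])
    qed
  qed (simp add: W)
  have W_strict: "W b j < W b' j" if that: "b \<le> b'" "k < j" and new: "\<not> (\<exists>t<b. pr k t \<in> \<theta>)" "\<exists>t<b'. pr k t \<in> \<theta>" for b b' j k
  proof -
    have "k < j \<longrightarrow> W b j < W b' j"
    proof (rule d1_induct[of "\<lambda>j. k < j \<longrightarrow> W b j < W b' j"])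
      show "d1 (\<lambda>e. k < e 0 \<longrightarrow> W b (e 0) < W b' (e 0))" by (intro d1_rules rtW)
      show "k < j + 1 \<longrightarrow> W b (j + 1) < W b' (j + 1)" if IH: "k < j \<longrightarrow> W b j < W b' j" for j
      proof
        assume "k < j + 1"
        then consider "k < j" | "k = j" by (auto simp: less_add_1_iff le_less)
        then show "W b (j + 1) < W b' (j + 1)"
        proof cases
          case 1
          have "(if \<exists>t<b. pr j t \<in> \<theta> then pow2 j else 0) \<le> (if \<exists>t<b'. pr j t \<in> \<theta> then pow2 j else 0)"
            using \<open>b \<le> b'\<close> by (auto intro: less_le_trans)
          then show ?thesis unfolding W using IH 1 by (simp add: add_less_le_mono)
        next
          case 2
          have "W b (j + 1) = W b j" "W b' (j + 1) = W b' j + pow2 j" unfolding W using new 2 by auto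
          then show ?thesis using W_mono[OF \<open>b \<le> b'\<close>, of j] pow2_pos[of j]
            by (simp add: add_le_less_mono[of "W b j" _ 0, simplified])
        qed
      qed
    qed simp
    then show ?thesis using \<open>k < j\<close> by simp
  qed
  have "\<exists>b. w \<le> W b c" for w
  proof (rule sg_induct[of "\<lambda>w. \<exists>b. w \<le> W b c"])
    show "sg (\<lambda>e. \<exists>b. e 0 \<le> W b c)" by (rule sg_ex, rule d1_sg, intro d1_rules rtW)
    show "\<exists>b. w + 1 \<le> W b c" if IH: "\<exists>b. w \<le> W b c" for w
    proof -
      obtain b where b: "w \<le> W b c" using IH by auto
      obtain k t where kt: "k < c" "pr k t \<in> \<theta>" "\<not> (\<exists>t<b. pr k t \<in> \<theta>)" using neg by blast
      have "t < b + t + 1" by (simp add: less_add_1_iff)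
      then have "W b c < W (b + t + 1) c" using kt by (intro W_strict) (auto simp: add.assoc)
      then show ?thesis using b unfolding less_iff_succ_less_eq[symmetric] by (meson le_less_trans)
    qed
  qed simp
  from this[of "pow2 c"] show False using W_less[of _ c] by (auto simp: not_le[symmetric])
qed

section \<open>The Hindman principle yields arithmetical comprehension\<close>

text \<open>As \<open>a\<close> may be nonstandard, the summands \<open>A\<close> and the partial
  sums \<open>B\<close> have to be functions of the model.\<close>

definition is_sum :: "'m set \<Rightarrow> 'm \<Rightarrow> 'm \<Rightarrow> bool" where
  "is_sum H a x \<longleftrightarrow> (\<exists>A B. rt (\<lambda>e. A (e 0)) \<and> rt (\<lambda>e. B (e 0)) \<and> (\<forall>n<a. A n \<in> H) \<and>
     (\<forall>n<a. \<forall>m<a. A n = A m \<longrightarrow> n = m) \<and> B 0 = 0 \<and> (\<forall>n<a. B (n + 1) = B n + A n) \<and> B a = x)"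

text \<open>A power of two that exceeds \<open>x\<close> and divides \<open>y\<close> separates the
  exponents of the two; no exponents need to be mentioned.\<close>

definition apart :: "'m set \<Rightarrow> bool" where
  "apart H \<longleftrightarrow> (\<forall>x\<in>H. \<forall>y\<in>H. x < y \<longrightarrow> (\<exists>q\<in>Pw. x < q \<and> q dvd y))"

end

section \<open>The colouring that belongs to an enumeration\<close>

locale enumeration = rca S for S :: "'m :: pnum set set" +
  fixes \<theta> :: "'m set"
  assumes theta_in_S: "\<theta> \<in> S"
begin

definition enum_before :: "'m \<Rightarrow> 'm \<Rightarrow> bool" where
  "enum_before v k \<longleftrightarrow> (\<exists>t<v. pr k t \<in> \<theta>)"

text \<open>For \<open>u \<le> v\<close>: nothing below \<open>p\<close> is newly enumerated between
  the stages, so the gap from \<open>u\<close> to \<open>v\<close> is not important for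
  \<open>p\<close>.\<close>

definition same :: "'m \<Rightarrow> 'm \<Rightarrow> 'm \<Rightarrow> bool" where
  "same p u v \<longleftrightarrow> (\<forall>k<p. enum_before u k \<longleftrightarrow> enum_before v k)"

lemma d1_enum_before: "rt s \<Longrightarrow> rt t \<Longrightarrow> d1 (\<lambda>e. enum_before (s e) (t e))"
proof -
  have "d1 (\<lambda>e. enum_before (e 0) (e 1))" unfolding enum_before_def by (intro d1_rules rt_pr theta_in_S)
  then show "rt s \<Longrightarrow> rt t \<Longrightarrow> d1 (\<lambda>e. enum_before (s e) (t e))" using d1_subst2[of s t enum_before] by simp
qed

lemma d1_same: "rt a \<Longrightarrow> rt b \<Longrightarrow> rt c \<Longrightarrow> d1 (\<lambda>e. same (a e) (b e) (c e))"
proof -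
  have "d1 (\<lambda>e. same (e 0) (e 1) (e 2))" unfolding same_def by (intro d1_rules d1_enum_before)
  then show "rt a \<Longrightarrow> rt b \<Longrightarrow> rt c \<Longrightarrow> d1 (\<lambda>e. same (a e) (b e) (c e))" using d1_subst3[of a b c same] by simp
qed

lemma enum_before_mono: "u \<le> v \<Longrightarrow> enum_before u k \<Longrightarrow> enum_before v k"
  unfolding enum_before_def using less_le_trans by blast

lemma same_between:
  assumes "same p u w" "u \<le> v" "v \<le> w" shows "same p u v" "same p v w"
  unfolding same_def
proof -
  have "(enum_before u k \<longleftrightarrow> enum_before v k) \<and> (enum_before v k \<longleftrightarrow> enum_before w k)" if "k < p" for k
    using assms that enum_before_mono[of u v k] enum_before_mono[of v w k] unfolding same_def by auto
  then show "\<forall>k<p. enum_before u k \<longleftrightarrow> enum_before v k" "\<forall>k<p. enum_before v k \<longleftrightarrow> enum_before w k"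
    by auto
qed

lemma same_trans: "same p u v \<Longrightarrow> same p v w \<Longrightarrow> same p u w"
  by (simp add: same_def)

text \<open>The pairs \<open>pr p x\<close> such that an odd number of gaps of x is important for p. Removing the largest
  digit u of x = u + r removes the gap from r to u; measuring it from r instead of the largest digit of
  r makes no difference to the argument and avoids exponents.\<close>

definition parity_step :: "'m set \<Rightarrow> 'm \<Rightarrow> bool" where
  "parity_step X y \<longleftrightarrow> (\<exists>p\<le>y. \<exists>x\<le>y. y = pr p x \<and>
     (\<exists>u\<le>x. \<exists>r<u. u \<in> Pw \<and> x = u + r \<and> (pr p r \<in> X \<longleftrightarrow> same p r u)))"

lemma parity_exists: "\<exists>N\<in>S. \<forall>y. y \<in> N \<longleftrightarrow> parity_step N y"
proof (rule set_recursion)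
  show "d1 (\<lambda>e. parity_step (dec (e 0)) (e 1))"
    unfolding parity_step_def by (intro d1_rules d1_dec rt_pr d1_Pw d1_same)
  fix X Y :: "'m set" and y assume XY: "\<And>z. z < y \<Longrightarrow> z \<in> X \<longleftrightarrow> z \<in> Y"
  have "pr p r \<in> X \<longleftrightarrow> pr p r \<in> Y" if "y = pr p (u + r)" "r < u" for p u r
  proof (rule XY)
    have "r < u + r" using le_less_trans[OF zero_le that(2)] by simp
    then show "pr p r < y" unfolding that(1) by (rule pr_less_pr)
  qed
  then have "(y = pr p x \<and> (\<exists>u\<le>x. \<exists>r<u. u \<in> Pw \<and> x = u + r \<and> (pr p r \<in> X \<longleftrightarrow> same p r u))) \<longleftrightarrow>
     (y = pr p x \<and> (\<exists>u\<le>x. \<exists>r<u. u \<in> Pw \<and> x = u + r \<and> (pr p r \<in> Y \<longleftrightarrow> same p r u)))" for p x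
    by auto
  then show "parity_step X y \<longleftrightarrow> parity_step Y y" unfolding parity_step_def by simp
qed

definition parity_set :: "'m set" where
  "parity_set = (SOME N. N \<in> S \<and> (\<forall>y. y \<in> N \<longleftrightarrow> parity_step N y))"

lemma parity_set: "parity_set \<in> S" "y \<in> parity_set \<longleftrightarrow> parity_step parity_set y"
proof -
  have "parity_set \<in> S \<and> (\<forall>y. y \<in> parity_set \<longleftrightarrow> parity_step parity_set y)"
    unfolding parity_set_def by (rule someI_ex) (use parity_exists in auto)
  then show "parity_set \<in> S" "y \<in> parity_set \<longleftrightarrow> parity_step parity_set y" by auto
qed

definition N :: "'m \<Rightarrow> 'm \<Rightarrow> bool" where
  "N p x \<longleftrightarrow> pr p x \<in> parity_set"

lemma d1_N: "rt s \<Longrightarrow> rt t \<Longrightarrow> d1 (\<lambda>e. N (s e) (t e))"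
  unfolding N_def by (intro d1_rules rt_pr parity_set)

text \<open>A new leading digit keeps the parity if its gap is unimportant and flips it otherwise;
  this is what the equivalence with \<open>same\<close> expresses. Uniqueness of the leading digit
  removes the quantifiers of \<open>parity_step\<close>.\<close>

lemma N_top:
  assumes "u \<in> Pw" "r < u" shows "N p (u + r) \<longleftrightarrow> (N p r \<longleftrightarrow> same p r u)"
proof -
  have "N p (u + r) \<longleftrightarrow> (\<exists>u'\<le>u + r. \<exists>r'<u'. u' \<in> Pw \<and> u + r = u' + r' \<and> (N p r' \<longleftrightarrow> same p r' u'))"
    unfolding N_def parity_set(2)[of "pr p (u + r)"] parity_step_def by (simp add: le_pr)
  also have "\<dots> \<longleftrightarrow> (N p r \<longleftrightarrow> same p r u)"
  proof
    assume "\<exists>u'\<le>u + r. \<exists>r'<u'. u' \<in> Pw \<and> u + r = u' + r' \<and> (N p r' \<longleftrightarrow> same p r' u')"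
    then obtain u' r' where "r' < u'" "u' \<in> Pw" "u + r = u' + r'" "N p r' \<longleftrightarrow> same p r' u'" by blast
    then show "N p r \<longleftrightarrow> same p r u" using Pw_top_unique[OF assms(1) _ assms(2), of u' r'] by simp
  next
    assume "N p r \<longleftrightarrow> same p r u"
    moreover have "u \<le> u + r" by simp
    ultimately show "\<exists>u'\<le>u + r. \<exists>r'<u'. u' \<in> Pw \<and> u + r = u' + r' \<and> (N p r' \<longleftrightarrow> same p r' u')"
      using assms by blast
  qed
  finally show ?thesis .
qed

text \<open>All digits of \<open>h\<close> are at least \<open>q\<close>, and nothing below
  \<open>p\<close> is enumerated between \<open>q\<close> and \<open>z + h\<close>, so only the gap
  from \<open>z\<close> to the first digit of \<open>h\<close> can change the parity. The proof
  removes the leading digit \<open>u\<close> of \<open>h\<close> by induction.\<close>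

lemma N_add:
  assumes q: "q \<in> Pw" "z < q" "q dvd h" "0 < h" "same p q (z + h)"
  shows "N p (z + h) \<longleftrightarrow> (N p z \<longleftrightarrow> same p z q)"
proof -
  have "q dvd h \<and> 0 < h \<and> same p q (z + h) \<longrightarrow> (N p (z + h) \<longleftrightarrow> (N p z \<longleftrightarrow> same p z q))"
  proof (rule d1_less_induct[of "\<lambda>h. q dvd h \<and> 0 < h \<and> same p q (z + h) \<longrightarrow> (N p (z + h) \<longleftrightarrow> (N p z \<longleftrightarrow> same p z q))"])
    show "d1 (\<lambda>e. q dvd e 0 \<and> 0 < e 0 \<and> same p q (z + e 0) \<longrightarrow> (N p (z + e 0) \<longleftrightarrow> (N p z \<longleftrightarrow> same p z q)))"
      by (intro d1_rules d1_N d1_same)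
    fix h assume IH: "\<And>r. r < h \<Longrightarrow> q dvd r \<and> 0 < r \<and> same p q (z + r) \<longrightarrow> (N p (z + r) \<longleftrightarrow> (N p z \<longleftrightarrow> same p z q))"
    show "q dvd h \<and> 0 < h \<and> same p q (z + h) \<longrightarrow> (N p (z + h) \<longleftrightarrow> (N p z \<longleftrightarrow> same p z q))"
    proof
      assume h: "q dvd h \<and> 0 < h \<and> same p q (z + h)"
      obtain u r where u: "u \<in> Pw" "r < u" "h = u + r" using Pw_top[of h] h by blast
      have "q \<le> h" using h dvd_le by blast
      have qu: "q \<le> u"
      proof (rule ccontr)
        assume "\<not> q \<le> u"
        then have "2 * u \<le> q" using Pw_less_le[OF u(1) q(1)] by simp
        then show False using \<open>q \<le> h\<close> u(2,3) unfolding emb_simps by linarith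
      qed
      have "q dvd u" using Pw_le_dvd[OF q(1) u(1) qu] .
      then have "q dvd r" using h u(3) by (simp add: dvd_add_right_iff)
      have uh: "u \<le> z + h" unfolding u(3) using emb_nonneg[of z] emb_nonneg[of r] unfolding emb_simps by simp
      show "N p (z + h) \<longleftrightarrow> (N p z \<longleftrightarrow> same p z q)"
      \<comment> \<open>If \<open>r = 0\<close>, then \<open>h\<close> is a single digit and its gap
        is the one above \<open>z\<close>. Otherwise that gap already lies in \<open>z + r\<close>,
        and the new one is unimportant.\<close>
      proof (cases "r = 0")
        case True
        have "same p q u" using same_between(1)[OF _ qu uh] h by blast
        then have "same p z u \<longleftrightarrow> same p z q"
          using same_trans[of p z q u] same_between(1)[of p z u q] qu q(2) by auto
        moreover have "N p (u + z) \<longleftrightarrow> (N p z \<longleftrightarrow> same p z u)" using N_top[OF u(1)] q(2) qu by simp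
        ultimately show ?thesis using True u(3) by (simp add: add.commute)
      next
        case False
        then have "0 < r" by (simp add: zero_less_iff_neq_zero)
        \<comment> \<open>Distinct multiples of \<open>q\<close> differ by at least
          \<open>q\<close>, which leaves room for \<open>z\<close> below the digit
          \<open>u\<close>.\<close>
        have "r + q \<le> u" using multiples_less[OF \<open>q dvd r\<close> \<open>q dvd u\<close> u(2)] .
        then have zr: "z + r < u" using q(2) unfolding emb_simps by simp
        have qr: "q \<le> z + r" using dvd_le[OF \<open>q dvd r\<close> \<open>0 < r\<close>] by (metis add.commute add_increasing2 zero_le)
        have "z + r \<le> z + h" using u(3) by simp
        then have "same p (z + r) (z + h)" "same p q (z + r)"
          using same_between[of p q "z + h" "z + r"] h qr by blast+
        moreover from this have "same p (z + r) u" using same_between(1)[of p "z + r" "z + h" u] zr uh by auto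
        moreover have "z + h = u + (z + r)" using u(3) by (simp add: ac_simps)
        moreover have "r < h" using u(3) \<open>0 < r\<close> Pw_pos[OF u(1)] by simp
        ultimately show ?thesis using N_top[OF u(1) zr, of p] IH[OF \<open>r < h\<close>] \<open>q dvd r\<close> \<open>0 < r\<close> by simp
      qed
    qed
  qed
  then show ?thesis using q by simp
qed

definition colouring :: "'m set" where
  "colouring = {x. \<exists>p\<le>x. lowp x p \<and> N p x}"

lemma colouring_in_S: "colouring \<in> S"
  unfolding colouring_def by (rule comprehension) (intro d1_rules d1_lowp d1_N)

lemma mem_colouring: "lowp x p \<Longrightarrow> 0 < x \<Longrightarrow> x \<in> colouring \<longleftrightarrow> N p x"
proof -
  assume p: "lowp x p" and "0 < x"
  then have px: "p \<le> x" using dvd_le[of p x] by (simp add: lowp_def)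
  show ?thesis
  proof
    assume "x \<in> colouring"
    then obtain p' where "lowp x p'" "N p' x" unfolding colouring_def by blast
    then show "N p x" using lowp_unique[OF p] by simp
  next
    assume "N p x"
    then show "x \<in> colouring" unfolding colouring_def using p px by blast
  qed
qed

end

section \<open>Deciding the enumerated set from a homogeneous solution\<close>

locale apart_sums = enumeration S \<theta> for S :: "'m :: pnum set set" and \<theta> +
  fixes H :: "'m set" and a :: 'm
  assumes H_in_S: "H \<in> S" and H_pos: "\<And>x. x \<in> H \<Longrightarrow> 0 < x" and H_inf: "\<And>n. \<exists>x\<in>H. n < x"
    and H_apart: "apart H" and a_ge: "3 \<le> a"
    and mono_colour: "\<And>x y. is_sum H a x \<Longrightarrow> is_sum H a y \<Longrightarrow> x \<in> colouring \<longleftrightarrow> y \<in> colouring"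
begin

definition next_H :: "'m \<Rightarrow> 'm" where
  "next_H w = (THE y. y \<in> H \<and> w < y \<and> (\<forall>z<y. z \<in> H \<longrightarrow> z \<le> w))"

text \<open>Leastness is expressed by a bounded quantifier, so the successor function of
  \<open>H\<close> has a Delta1 graph and can be iterated.\<close>

lemma next_H_iff: "x' = next_H w \<longleftrightarrow> x' \<in> H \<and> w < x' \<and> (\<forall>z<x'. z \<in> H \<longrightarrow> z \<le> w)"
proof -
  obtain x where x: "x \<in> H \<and> w < x" using H_inf[of w] by auto
  have "\<exists>y. (y \<in> H \<and> w < y) \<and> (\<forall>z<y. \<not> (z \<in> H \<and> w < z))"
    by (rule d1_least[of "\<lambda>y. y \<in> H \<and> w < y", OF _ x]) (intro d1_rules H_in_S)
  then obtain y where y: "y \<in> H" "w < y" "\<And>z. z < y \<Longrightarrow> z \<in> H \<Longrightarrow> z \<le> w" by (auto simp: not_less)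
  have u: "y' = y" if "y' \<in> H" "w < y'" "\<And>z. z < y' \<Longrightarrow> z \<in> H \<Longrightarrow> z \<le> w" for y'
  proof -
    have "\<not> y' < y" using y(3)[of y'] that(1,2) by auto
    moreover have "\<not> y < y'" using that(3)[of y] y(1,2) by auto
    ultimately show ?thesis by simp
  qed
  have "(THE y. y \<in> H \<and> w < y \<and> (\<forall>z<y. z \<in> H \<longrightarrow> z \<le> w)) = y"
  proof (rule the_equality)
    show "y \<in> H \<and> w < y \<and> (\<forall>z<y. z \<in> H \<longrightarrow> z \<le> w)" using y by simp
    show "y' = y" if "y' \<in> H \<and> w < y' \<and> (\<forall>z<y'. z \<in> H \<longrightarrow> z \<le> w)" for y'
      using that by (intro u) simp_all
  qed
  then have nx: "next_H w = y" by (simp add: next_H_def)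
  show ?thesis
  proof
    assume "x' = next_H w"
    then show "x' \<in> H \<and> w < x' \<and> (\<forall>z<x'. z \<in> H \<longrightarrow> z \<le> w)" using nx y by simp
  next
    assume "x' \<in> H \<and> w < x' \<and> (\<forall>z<x'. z \<in> H \<longrightarrow> z \<le> w)"
    then show "x' = next_H w" unfolding nx by (intro u) simp_all
  qed
qed

lemma enumerate_H:
  obtains h where "rt (\<lambda>e. h (e 0))" "\<And>n. h n \<in> H" "\<And>n. h n < h (n + 1)"
proof -
  obtain c where c: "c \<in> H" using H_inf by blast
  have "sg (\<lambda>e. e 0 \<in> H \<and> e 2 < e 0 \<and> (\<forall>z<e 0. z \<in> H \<longrightarrow> z \<le> e 2))" by (intro d1_sg d1_rules H_in_S)
  then have "rt (\<lambda>e. next_H (e 1))" unfolding rt_def next_H_iff by (simp add: numeral_2_eq_2)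
  moreover have "w \<le> next_H w" for w using next_H_iff[of "next_H w" w] by (meson less_imp_le)
  ultimately obtain h where h: "h 0 = c" "\<And>n. h (n + 1) = next_H (h n)" "rt (\<lambda>e. h (e 0))"
    by (rule sequence_recursion[of "\<lambda>n w. next_H w" c]) (rule that; assumption)
  have "h n \<in> H" for n
  proof (rule d1_induct[of "\<lambda>n. h n \<in> H"])
    show "d1 (\<lambda>e. h (e 0) \<in> H)" by (intro d1_rules H_in_S h(3))
    show "h (n + 1) \<in> H" for n unfolding h(2) using next_H_iff[of "next_H (h n)" "h n"] by simp
  qed (simp add: h(1) c)
  moreover have "h n < h (n + 1)" for n unfolding h(2) using next_H_iff[of "next_H (h n)" "h n"] by simp
  ultimately show ?thesis by (rule that[OF h(3)])
qed

lemma range_in_S: "{k. \<exists>t. pr k t \<in> \<theta>} \<in> S"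
proof -
  obtain h where h: "rt (\<lambda>e. h (e 0))" "\<And>n. h n \<in> H" "\<And>n. h n < h (n + 1)" by (rule enumerate_H) blast
  have rt_h: "rt t \<Longrightarrow> rt (\<lambda>e. h (t e))" for t by (rule rt_subst[OF h(1)])
  have "rt (\<lambda>e. e 1 + h (e 0))" by (intro d1_rules h(1))
  moreover have "w \<le> w + h n" for n w by simp
  \<comment> \<open>\<open>s n\<close> is the sum of \<open>h m\<close> over all
    \<open>m < n\<close>; blocks of consecutive elements are differences of its values.\<close>
  ultimately obtain s where s: "s 0 = 0" "\<And>n. s (n + 1) = s n + h n" "rt (\<lambda>e. s (e 0))"
    by (rule sequence_recursion[of "\<lambda>n w. w + h n" 0]) (rule that; assumption)
  have rt_s: "rt t \<Longrightarrow> rt (\<lambda>e. s (t e))" for t by (rule rt_subst[OF s(3)])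
  have h_less: "h m < h n" if "m < n" for m n
  proof -
    have "m < n \<longrightarrow> h m < h n"
    proof (rule d1_induct[of "\<lambda>n. m < n \<longrightarrow> h m < h n"])
      show "d1 (\<lambda>e. m < e 0 \<longrightarrow> h m < h (e 0))" by (intro d1_rules rt_h)
      show "m < n + 1 \<longrightarrow> h m < h (n + 1)" if "m < n \<longrightarrow> h m < h n" for n
        using that h(3)[of n] by (auto simp: less_add_1_iff le_less)
    qed simp
    then show ?thesis using that by simp
  qed
  have h_le: "h m \<le> h n" if "m \<le> n" for m n using h_less that by (cases "m = n") (auto simp: le_less)
  have le_h: "n \<le> h n" for n
  proof (rule d1_induct[of "\<lambda>n. n \<le> h n"])
    show "d1 (\<lambda>e. e 0 \<le> h (e 0))" by (intro d1_rules rt_h)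
    show "n + 1 \<le> h (n + 1)" if "n \<le> h n" for n
      using that h(3)[of n] unfolding less_iff_succ_less_eq[symmetric] by (rule le_less_trans)
  qed simp
  have h_pos: "0 < h n" for n using h(2) H_pos by blast
  have h_apart: "\<exists>q\<in>Pw. h m < q \<and> q dvd h n" if "m < n" for m n
    using H_apart h(2) h_less[OF that] unfolding apart_def by blast
  \<comment> \<open>\<open>b\<close> is the number of summands in \<open>z\<close>, and
    \<open>b'\<close> below is the number of those after the first.\<close>
  obtain b where b: "a = b + 1" "2 \<le> b"
  proof -
    have "a \<noteq> 0" using a_ge by auto
    then obtain b where b: "a = b + 1" using zero_or_suc[of a] by auto
    have "2 \<le> b" using a_ge unfolding b emb_simps by linarith
    then show ?thesis using that b by blast
  qed
  obtain b' where b': "b = b' + 1" using zero_or_suc[of b] b(2) by auto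
  have b'_pos: "1 \<le> b'" using b(2) unfolding b' emb_simps by linarith

  \<comment> \<open>This says that \<open>z\<close> is \<open>h i\<close> plus the
    \<open>b - 1\<close> elements from \<open>h (j + 1)\<close> to \<open>h (j + b')\<close>,
    written without subtraction. The index \<open>i\<close> will fix \<open>p\<close>, and
    \<open>j\<close> will make \<open>z\<close> late.\<close>
  define ok where "ok i j z \<longleftrightarrow> i < j \<and> z + s (j + 1) = h i + s (j + b)" for i j z
  have sums: "0 < z \<and> (\<forall>p. lowp (h i) p \<longrightarrow> lowp z p) \<and> (\<exists>q\<in>Pw. z < q \<and> q dvd h (j + b)) \<and> h (j + b') \<le> z \<and>
      (\<forall>l\<ge>j + b. is_sum H a (z + h l))"
    if ok: "ok i j z" for i j z
  proof -
    have ij: "i < j" using ok by (simp add: ok_def)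
    define A where "A n = (if n = 0 then h i else h (j + n))" for n
    have rtA: "rt t \<Longrightarrow> rt (\<lambda>e. A (t e))" for t
      unfolding A_def by (intro d1_rules rt_h)
    have "rt (\<lambda>e. e 1 + A (e 0))" by (intro d1_rules rtA)
    moreover have "w \<le> w + A n" for n w by simp
    ultimately obtain B where B: "B 0 = 0" "\<And>n. B (n + 1) = B n + A n" "rt (\<lambda>e. B (e 0))"
      by (rule sequence_recursion[of "\<lambda>n w. w + A n" 0]) (rule that; assumption)
    have rtB: "rt t \<Longrightarrow> rt (\<lambda>e. B (t e))" for t by (rule rt_subst[OF B(3)])
    have A_0: "A 0 = h i" and A_Suc: "A (n + 1) = h (j + (n + 1))" for n by (simp_all add: A_def)
    have B1: "B 1 = h i" using B(2)[of 0] B(1) A_0 by simp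
    have B_s: "B (n + 1) + s (j + 1) = h i + s (j + (n + 1))" for n
    proof (rule d1_induct[of "\<lambda>n. B (n + 1) + s (j + 1) = h i + s (j + (n + 1))"])
      show "d1 (\<lambda>e. B (e 0 + 1) + s (j + 1) = h i + s (j + (e 0 + 1)))" by (intro d1_rules rtB rt_s)
      show "B (0 + 1) + s (j + 1) = h i + s (j + (0 + 1))" using B1 by simp
      show "B (n + 1 + 1) + s (j + 1) = h i + s (j + (n + 1 + 1))"
        if IH: "B (n + 1) + s (j + 1) = h i + s (j + (n + 1))" for n
      proof -
        have 1: "s (j + (n + 1 + 1)) = s (j + (n + 1)) + h (j + (n + 1))"
          using s(2)[of "j + (n + 1)"] by (simp add: add.assoc)
        have 2: "B (n + 1 + 1) = B (n + 1) + h (j + (n + 1))" using B(2)[of "n + 1"] A_Suc[of n] by simp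
        show ?thesis using IH unfolding 1 2 emb_simps by linarith
      qed
    qed
    have "z + s (j + 1) = B b + s (j + 1)" using B_s[of b'] ok unfolding b' ok_def by argo
    then have z: "z = B b" by (simp only: add_right_cancel)
    obtain p where p: "lowp (h i) p" using lowp_exists[OF h_pos] by blast
    \<comment> \<open>Each partial sum keeps the lowest digit of \<open>h i\<close> and is separated
      by a power of two from the next summand. Bounding \<open>q\<close> by that summand makes the
      invariant Delta1.\<close>
    have inv: "0 < B (n + 1) \<and> lowp (B (n + 1)) p \<and> (\<exists>q\<le>h (j + (n + 1)). q \<in> Pw \<and> B (n + 1) < q \<and> q dvd h (j + (n + 1)))" for n
    proof (rule d1_induct[of "\<lambda>n. 0 < B (n + 1) \<and> lowp (B (n + 1)) p \<and>
          (\<exists>q\<le>h (j + (n + 1)). q \<in> Pw \<and> B (n + 1) < q \<and> q dvd h (j + (n + 1)))"])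
      show "d1 (\<lambda>e. 0 < B (e 0 + 1) \<and> lowp (B (e 0 + 1)) p \<and>
          (\<exists>q\<le>h (j + (e 0 + 1)). q \<in> Pw \<and> B (e 0 + 1) < q \<and> q dvd h (j + (e 0 + 1))))"
        by (intro d1_rules rtB rt_h d1_lowp d1_Pw)
      have "i < j + 1" using ij by (simp add: less_add_1_iff)
      then obtain q where "q \<in> Pw" "h i < q" "q dvd h (j + 1)" using h_apart by blast
      then show "0 < B (0 + 1) \<and> lowp (B (0 + 1)) p \<and> (\<exists>q\<le>h (j + (0 + 1)). q \<in> Pw \<and> B (0 + 1) < q \<and> q dvd h (j + (0 + 1)))"
        using p h_pos dvd_le[of q "h (j + 1)"] by (auto simp: B1)
      fix n assume IH: "0 < B (n + 1) \<and> lowp (B (n + 1)) p \<and> (\<exists>q\<le>h (j + (n + 1)). q \<in> Pw \<and> B (n + 1) < q \<and> q dvd h (j + (n + 1)))"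
      then obtain q where q: "q \<le> h (j + (n + 1))" "q \<in> Pw" "B (n + 1) < q" "q dvd h (j + (n + 1))" by auto
      have Bn: "B (n + 1 + 1) = B (n + 1) + h (j + (n + 1))" using B(2)[of "n + 1"] A_Suc[of n] by simp
      have "j + (n + 1) < j + (n + 1 + 1)" by simp
      then obtain q' where q': "q' \<in> Pw" "h (j + (n + 1)) < q'" "q' dvd h (j + (n + 1 + 1))" using h_apart by blast
      have "q dvd q'" using Pw_le_dvd[OF q(2) q'(1)] q(1) q'(2) by auto
      then have "h (j + (n + 1)) + q \<le> q'" using multiples_less q(4) q'(2) by blast
      then have "B (n + 1 + 1) < q'" using q(3) unfolding Bn emb_simps by simp
      moreover have "lowp (B (n + 1 + 1)) p" unfolding Bn using lowp_add[OF _ _ q(3,2,4)] IH by blast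
      moreover have "0 < B (n + 1 + 1)" unfolding Bn using h_pos by (simp add: add_nonneg_pos)
      moreover have "q' \<le> h (j + (n + 1 + 1))" using dvd_le[OF q'(3) h_pos] .
      ultimately show "0 < B (n + 1 + 1) \<and> lowp (B (n + 1 + 1)) p \<and>
          (\<exists>q\<le>h (j + (n + 1 + 1)). q \<in> Pw \<and> B (n + 1 + 1) < q \<and> q dvd h (j + (n + 1 + 1)))"
        using q' by blast
    qed
    have "is_sum H a (z + h l)" if l: "j + b \<le> l" for l
      unfolding is_sum_def
    proof (intro exI conjI)
      \<comment> \<open>The \<open>b\<close> summands of \<open>z\<close> receive the indices below
        \<open>b\<close>, and the last index \<open>b = a - 1\<close> goes to
        \<open>h l\<close>.\<close>
      let ?A = "\<lambda>n. if n < b then A n else h l" and ?B = "\<lambda>n. if n \<le> b then B n else z + h l"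
      show "rt (\<lambda>e. ?A (e 0))" by (intro d1_rules rtA)
      show "rt (\<lambda>e. ?B (e 0))" by (intro d1_rules rtB)
      show "\<forall>n<a. ?A n \<in> H" using h(2) by (simp add: A_def)
      have less: "?A n < ?A m" if "n < m" "m < a" for n m
      proof -
        have mb: "m \<le> b" using that(2) unfolding b(1) less_add_1_iff .
        then have nb: "n < b" using that(1) by (rule less_le_trans[rotated])
        have m0: "m \<noteq> 0" using that(1) by auto
        have im: "i < j + m" using ij by (rule less_le_trans) simp
        have nm: "j + n < j + m" using that(1) by simp
        have "j + n < j + b" using nb by simp
        then have nl: "j + n < l" using l by (rule less_le_trans)
        have "j \<le> l" using l by (rule order_trans[rotated]) simp
        then have il: "i < l" by (rule less_le_trans[OF ij])
        have "A n < h (j + m)" "A n < h l"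
          using h_less[OF im] h_less[OF nm] h_less[OF nl] h_less[OF il] unfolding A_def by simp_all
        then show ?thesis using nb m0 by (simp add: A_def)
      qed
      show "\<forall>n<a. \<forall>m<a. ?A n = ?A m \<longrightarrow> n = m"
      proof (intro allI impI)
        fix n m assume nm: "n < a" "m < a" "?A n = ?A m"
        have "\<not> n < m" using less[of n m] nm by (auto simp only: less_irrefl)
        moreover have "\<not> m < n" using less[of m n] nm by (auto simp only: less_irrefl)
        ultimately show "n = m" by simp
      qed
      show "?B 0 = 0" using B(1) by simp
      show "\<forall>n<a. ?B (n + 1) = ?B n + ?A n"
      proof (intro allI impI)
        fix n assume "n < a"
        then have nb: "n \<le> b" unfolding b(1) less_add_1_iff .
        show "?B (n + 1) = ?B n + ?A n"
        proof (cases "n < b")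
          case True
          then have "n + 1 \<le> b" by (simp add: less_iff_succ_less_eq)
          then show ?thesis using True nb B(2) by simp
        next
          case False
          then have "n = b" using nb by simp
          then show ?thesis using z by (simp add: not_le)
        qed
      qed
      show "?B a = z + h l" unfolding b(1) by (simp add: not_le)
    qed
    \<comment> \<open>As \<open>b'\<close> is positive, \<open>h (j + b')\<close> is the last
      summand of \<open>z\<close>. This is where \<open>a \<ge> 3\<close> enters: \<open>z\<close>
      grows with \<open>j\<close> while \<open>i\<close> stays fixed.\<close>
    moreover have "h (j + b') \<le> z"
    proof -
      obtain b'' where b'': "b' = b'' + 1" using zero_or_suc[of b'] b'_pos by auto
      show ?thesis unfolding z b' B(2) using A_Suc[of b''] by (simp add: b'')
    qed
    moreover have "lowp z p'" if "lowp (h i) p'" for p'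
      using inv[of b'] lowp_unique[OF p that] z b' by simp
    ultimately show ?thesis using inv[of b'] z b' by blast
  qed
  have ok_ex: "\<exists>z. ok i j z" if "i < j" for i j
  proof -
    have "s (j + 1) \<le> s (j + (n + 1))" for n
    proof (rule d1_induct[of "\<lambda>n. s (j + 1) \<le> s (j + (n + 1))"])
      show "d1 (\<lambda>e. s (j + 1) \<le> s (j + (e 0 + 1)))" by (intro d1_rules rt_s)
      show "s (j + 1) \<le> s (j + (n + 1 + 1))" if "s (j + 1) \<le> s (j + (n + 1))" for n
        using that s(2)[of "j + (n + 1)"] by (simp add: ac_simps add_increasing)
    qed simp
    from this[of b'] obtain d where "s (j + b) = s (j + 1) + d" unfolding b' by (metis le_iff_add)
    then show ?thesis using that unfolding ok_def by (intro exI[of _ "h i + d"]) (simp add: ac_simps)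
  qed
  \<comment> \<open>Strong bounding yields a stage after which nothing below \<open>p\<close> is
    enumerated, even for nonstandard \<open>p\<close>.\<close>
  have bounded: "\<exists>c. \<forall>v\<ge>c. \<forall>k<p. enum_before v k \<longleftrightarrow> (\<exists>t. pr k t \<in> \<theta>)" for p
  proof -
    obtain c where c: "\<forall>k<p. (\<exists>t. pr k t \<in> \<theta>) \<longrightarrow> (\<exists>t<c. pr k t \<in> \<theta>)" using strong_bounding[OF theta_in_S] by blast
    then show ?thesis unfolding enum_before_def by (intro exI[of _ c]) (meson less_le_trans)
  qed
  \<comment> \<open>What the search looks for. It mentions the enumeration only up to stage
    \<open>z + h l\<close>, so it is Delta1.\<close>
  define good where "good i j l z p \<longleftrightarrow> ok i j z \<and> j + b \<le> l \<and> lowp (h i) p \<and> same p z (z + h l)" for i j l z p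
  \<comment> \<open>Two sums with the same \<open>z\<close> are compared: adding \<open>h l\<close>
    keeps the parity of \<open>z\<close>, and adding a very late element keeps it only if nothing
    below \<open>p\<close> is enumerated after \<open>z\<close>. As the colours agree, stage
    \<open>z\<close> is final for the numbers below \<open>p\<close>.\<close>
  have correct: "enum_before z k \<longleftrightarrow> (\<exists>t. pr k t \<in> \<theta>)" if g: "good i j l z p" and k: "k < p" for i j l z p k
  proof -
    have z: "0 < z" "lowp z p" "\<exists>q\<in>Pw. z < q \<and> q dvd h (j + b)" "\<And>l. j + b \<le> l \<Longrightarrow> is_sum H a (z + h l)"
      using sums[of i j z] g unfolding good_def by auto
    have l: "j + b \<le> l" and same_l: "same p z (z + h l)" using g by (simp_all add: good_def)
    obtain q0 where q0: "q0 \<in> Pw" "z < q0" "q0 dvd h (j + b)" using z(3) by blast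
    have z_h: "z < h (j + b)" using dvd_le[OF q0(3) h_pos] q0(2) by simp
    have div: "\<exists>q\<in>Pw. z < q \<and> q dvd h l'" if l': "j + b \<le> l'" for l'
    proof (cases "l' = j + b")
      case True
      then show ?thesis using q0 by blast
    next
      case False
      then have "j + b < l'" using l' by simp
      then obtain q where "q \<in> Pw" "h (j + b) < q" "q dvd h l'" using h_apart by blast
      then show ?thesis using z_h by (meson less_trans)
    qed
    have colour: "z + h l' \<in> colouring \<longleftrightarrow> N p (z + h l')" if l': "j + b \<le> l'" for l'
    proof -
      obtain q where "q \<in> Pw" "z < q" "q dvd h l'" using div[OF l'] by blast
      then have "lowp (z + h l') p" using lowp_add[OF z(2,1)] by blast
      then show ?thesis by (rule mem_colouring) (simp add: z(1) add_pos_nonneg)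
    qed
    obtain q where q: "q \<in> Pw" "z < q" "q dvd h l" using div[OF l] by blast
    have "q \<le> z + h l" using dvd_le[OF q(3) h_pos] by (simp add: add_increasing)
    then have "same p z q" "same p q (z + h l)" using same_between[OF same_l, of q] q(2) by auto
    then have N_l: "N p (z + h l) \<longleftrightarrow> N p z" using N_add[OF q h_pos] by simp
    obtain c where c: "\<And>v k. c \<le> v \<Longrightarrow> k < p \<Longrightarrow> enum_before v k \<longleftrightarrow> (\<exists>t. pr k t \<in> \<theta>)" using bounded[of p] by auto
    \<comment> \<open>Late enough for \<open>h l1\<close> to be past the stage \<open>c\<close>, and
      still at least \<open>j + b\<close>, so that \<open>z + h (l1 + 1)\<close> is again a sum of
      \<open>a\<close> elements.\<close>
    define l1 where "l1 = l + c"
    have l1: "j + b \<le> l1" "c \<le> l1" using l unfolding l1_def by (simp_all add: add_increasing2)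
    have "l1 < l1 + 1" by simp
    then obtain q' where q': "q' \<in> Pw" "h l1 < q'" "q' dvd h (l1 + 1)" using h_apart by blast
    have "c \<le> h l1" using l1(2) le_h[of l1] by (rule order_trans)
    then have c_q: "c \<le> q'" using q'(2) by simp
    have z_q: "z < q'" using z_h h_le[OF l1(1)] q'(2) by simp
    have "q' \<le> z + h (l1 + 1)" using dvd_le[OF q'(3) h_pos] by (simp add: add_increasing)
    then have "same p q' (z + h (l1 + 1))" unfolding same_def using c c_q by (meson order_trans)
    then have "N p (z + h (l1 + 1)) \<longleftrightarrow> (N p z \<longleftrightarrow> same p z q')" by (rule N_add[OF q'(1) z_q q'(3) h_pos])
    moreover have l1': "j + b \<le> l1 + 1" using l1(1) by (simp add: add_increasing2)
    moreover have "z + h l \<in> colouring \<longleftrightarrow> z + h (l1 + 1) \<in> colouring"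
      using mono_colour[OF z(4)[OF l] z(4)[OF l1']] .
    ultimately have "same p z q'" using N_l colour[OF l] colour[OF l1'] by auto
    then show ?thesis using c[OF c_q k] k unfolding same_def by auto
  qed
  \<comment> \<open>The first summand \<open>h (k + 1)\<close> is apart from
    \<open>h k \<ge> k\<close>, hence its lowest digit exceeds \<open>k\<close>. Adding
    \<open>c\<close> in \<open>j\<close> then puts \<open>z\<close> past the last enumeration below
    \<open>p\<close>, so the gap up to \<open>z + h (j + b)\<close> is unimportant.\<close>
  have good_ex: "\<exists>i j l z p. good i j l z p \<and> k < p" for k
  proof -
    have "k < k + 1" by simp
    then obtain q where q: "q \<in> Pw" "h k < q" "q dvd h (k + 1)" using h_apart by blast
    obtain p where p: "lowp (h (k + 1)) p" using lowp_exists[OF h_pos] by blast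
    have "k < p" using le_h[of k] q(2) lowp_ge[OF p q(1,3)] by (meson le_less_trans less_le_trans)
    obtain c where c: "\<And>v k. c \<le> v \<Longrightarrow> k < p \<Longrightarrow> enum_before v k \<longleftrightarrow> (\<exists>t. pr k t \<in> \<theta>)" using bounded[of p] by auto
    define j where "j = (k + 1) + c + 1"
    have kj: "k + 1 < j" unfolding j_def by (simp add: less_add_1_iff)
    obtain z where z: "ok (k + 1) j z" using ok_ex[OF kj] by blast
    have "c \<le> j + b'" unfolding j_def using emb_nonneg[of k] emb_nonneg[of b'] unfolding emb_simps by linarith
    also have "\<dots> \<le> h (j + b')" by (rule le_h)
    also have "\<dots> \<le> z" using sums[OF z] by blast
    finally have "c \<le> z" .
    moreover have "z \<le> z + h (j + b)" by simp
    ultimately have "same p z (z + h (j + b))" unfolding same_def using c by (meson order_trans)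
    then have "good (k + 1) j (j + b) z p" using z p by (simp add: good_def)
    then show ?thesis using \<open>k < p\<close> by blast
  qed
  have d1_ok: "d1 (\<lambda>e. ok (x e) (y e) (z e))" if "rt x" "rt y" "rt z" for x y z
    unfolding ok_def using that by (intro d1_rules rt_s rt_h)
  have d1_good: "d1 (\<lambda>e. good (x e) (y e) (l e) (z e) (p e))" if "rt x" "rt y" "rt l" "rt z" "rt p" for x y l z p
    unfolding good_def using that by (intro d1_rules d1_ok d1_lowp d1_same rt_h)
  \<comment> \<open>A good tuple with \<open>k < p\<close> exists and answers correctly at stage
    \<open>z\<close>, so being enumerated and not being enumerated are both Sigma1.\<close>
  have "(\<exists>t. pr k t \<in> \<theta>) \<longleftrightarrow> (\<exists>i j l z p. good i j l z p \<and> k < p \<and> enum_before z k)" for k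
    using good_ex[of k] correct by blast
  moreover have "sg (\<lambda>e. \<exists>i j l z p. good i j l z p \<and> e 0 < p \<and> enum_before z (e 0))"
    by (rule sg_ex)+ (rule d1_sg, intro d1_rules d1_good d1_enum_before)
  moreover have "\<not> (\<exists>t. pr k t \<in> \<theta>) \<longleftrightarrow> (\<exists>i j l z p. good i j l z p \<and> k < p \<and> \<not> enum_before z k)" for k
    using good_ex[of k] correct by blast
  moreover have "sg (\<lambda>e. \<exists>i j l z p. good i j l z p \<and> e 0 < p \<and> \<not> enum_before z (e 0))"
    by (rule sg_ex)+ (rule d1_sg, intro d1_rules d1_good d1_enum_before)
  ultimately have "d1 (\<lambda>e. \<exists>t. pr (e 0) t \<in> \<theta>)" unfolding d1_def by (simp only:)
  then show ?thesis by (rule comprehension)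
qed

end

section \<open>Models of arithmetical comprehension\<close>

locale aca = rca S for S :: "'m :: pnum set set" +
  assumes sigma1_comprehension: "sg (\<lambda>e. P (e 0)) \<Longrightarrow> {x. P x} \<in> S"
begin

text \<open>Comprehension concerns predicates of one variable; two variables are merged by pairing.\<close>

lemma sg_d1_finitely_many_vars:
  "(\<And>e e'. (\<And>n. n < k \<Longrightarrow> e n = e' n) \<Longrightarrow> P e \<longleftrightarrow> P e') \<Longrightarrow> sg P \<Longrightarrow> d1 P"
proof (induction k arbitrary: P)
  case 0
  have "P = (\<lambda>e. (0 :: 'm) = 0) \<or> P = (\<lambda>e. (0 :: 'm) = 1)" using 0(1) by (auto simp: fun_eq_iff)
  moreover have "d1 (\<lambda>e. (0 :: 'm) = 0)" "d1 (\<lambda>e. (0 :: 'm) = 1)" by (intro d1_eq rt_const)+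
  ultimately show ?case by auto
next
  case (Suc k)
  show ?case
  proof (cases k)
    case 0
    have "sg (\<lambda>e. P (\<lambda>n. e 0))" using definable_ren[OF Suc.prems(2), of "\<lambda>n. 0"] by simp
    then have "{x. P (\<lambda>n. x)} \<in> S" by (rule sigma1_comprehension)
    then have "d1 (\<lambda>e. e 0 \<in> {x. P (\<lambda>n. x)})" by (intro d1_mem rt_var)
    moreover have "P e \<longleftrightarrow> P (\<lambda>n. e 0)" for e by (rule Suc.prems(1)) (simp add: 0)
    ultimately show ?thesis by simp
  next
    case (Suc k')
    define P' where "P' e \<longleftrightarrow> (\<exists>a b. e 0 = pr a b \<and> P (case_nat a (case_nat b (\<lambda>n. e (Suc n)))))" for e
    have "d1 P'"
    proof (rule Suc.IH)
      fix e e' :: "nat \<Rightarrow> 'm" assume ee: "\<And>n. n < k \<Longrightarrow> e n = e' n"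
      have "P (case_nat a (case_nat b (\<lambda>n. e (Suc n)))) \<longleftrightarrow> P (case_nat a (case_nat b (\<lambda>n. e' (Suc n))))" for a b
        by (rule Suc.prems(1)) (use ee Suc in \<open>auto split: nat.split\<close>)
      then show "P' e \<longleftrightarrow> P' e'" unfolding P'_def using ee[of 0] Suc by simp
    next
      have *: "(\<lambda>n. e (case_nat 1 (case_nat 0 (\<lambda>n. Suc (Suc (Suc n)))) n)) =
          case_nat (e 1) (case_nat (e 0) (\<lambda>n. e (Suc (Suc (Suc n)))))" for e :: "nat \<Rightarrow> 'm"
        by (rule ext) (simp split: nat.split)
      have "sg (\<lambda>e. P (case_nat (e 1) (case_nat (e 0) (\<lambda>n. e (Suc (Suc (Suc n)))))))"
        using definable_ren[OF Suc.prems(2), of "case_nat 1 (case_nat 0 (\<lambda>n. Suc (Suc (Suc n))))"] by (simp only: *)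
      moreover have "sg (\<lambda>e. e 2 = pr (e 1) (e 0))" by (intro d1_sg d1_rules rt_pr)
      ultimately show "sg P'"
        unfolding P'_def by (rule_tac sg_ex, rule_tac sg_ex, rule_tac sg_conj) (simp_all add: numeral_2_eq_2)
    qed
    have 1: "(\<lambda>n. e (case_nat 0 (\<lambda>n. Suc (Suc (Suc n))) n)) = case_nat (e 0) (\<lambda>n. e (Suc (Suc (Suc n))))" for e :: "nat \<Rightarrow> 'm"
      by (rule ext) (simp split: nat.split)
    have "d1 (\<lambda>e. P' (case_nat (e 0) (\<lambda>n. e (Suc (Suc (Suc n))))))"
      using d1_ren[OF \<open>d1 P'\<close>, of "case_nat 0 (\<lambda>n. Suc (Suc (Suc n)))"] by (simp only: 1)
    then have "d1 (\<lambda>e. P' (case_nat (pr (e 0) (e 1)) (\<lambda>n. e (Suc (Suc n)))))"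
      using d1_subst[of "\<lambda>e. pr (e 0) (e 1)" "\<lambda>e y. P' (case_nat y (\<lambda>n. e (Suc (Suc n))))"] rt_pr[OF rt_var rt_var] by simp
    moreover have "case_nat (e 0) (case_nat (e (Suc 0)) (\<lambda>n. e (Suc (Suc n)))) = e" for e :: "nat \<Rightarrow> 'm"
      by (rule ext) (simp split: nat.split)
    ultimately show ?thesis by (simp add: P'_def)
  qed
qed

text \<open>Sigma1 and Delta1 coincide here, so the class is closed under all number quantifiers and
  contains every arithmetical predicate.\<close>

lemma sg_d1:
  assumes "sg P" shows "d1 P"
proof (rule definable_cong_vars[OF assms])
  fix k assume "\<And>e e'. (\<And>n. n < k \<Longrightarrow> e n = e' n) \<Longrightarrow> P e \<longleftrightarrow> P e'"
  then show "d1 P" using assms by (rule sg_d1_finitely_many_vars)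
qed

lemma d1_ex: "d1 (\<lambda>e. Q (\<lambda>n. e (Suc n)) (e 0)) \<Longrightarrow> d1 (\<lambda>e. \<exists>y. Q e y)"
  by (rule sg_d1, rule sg_ex, erule d1_sg)

lemma d1_all:
  assumes "d1 (\<lambda>e. Q (\<lambda>n. e (Suc n)) (e 0))" shows "d1 (\<lambda>e. \<forall>y. Q e y)"
  using d1_not[OF d1_ex[of "\<lambda>e y. \<not> Q e y", OF d1_not[OF assms]]] by simp

lemma d1_rename: "d1 P \<Longrightarrow> d1 (\<lambda>e. P (\<lambda>n. ev e (\<tau> n)))"
  using definable_rename[of "std S" Sigma1 P \<tau>] definable_rename[of "std S" Sigma1 "\<lambda>e. \<not> P e" \<tau>] by (simp add: d1_def)

lemma rt_tval: "rt (\<lambda>e. tval (std S) e t)"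
  by (rule rt_tdef) (auto simp: term_definable_def intro!: exI[of _ t] exI[of _ Inr])

lemma arithmetical_d1: "arithmetical \<phi> \<Longrightarrow> range r \<subseteq> S \<Longrightarrow> d1 (\<lambda>e. sat (std S) e r \<phi>)"
proof (induction \<phi>)
  case (Eq s t)
  then show ?case by (simp add: d1_eq rt_tval)
next
  case (Less s t)
  then show ?case by (simp add: d1_less rt_tval)
next
  case (Mem t X)
  then have "r X \<in> S" by auto
  then show ?case by (simp add: d1_mem rt_tval)
next
  case Falsum
  have "d1 (\<lambda>e. (0 :: 'm) = 1)" by (intro d1_eq rt_const)
  then show ?case by simp
next
  case (Imp \<phi> \<psi>)
  then show ?case by (simp add: d1_imp)
next
  case (Forall \<phi>)
  have "case_nat (e 0) (\<lambda>n. e (Suc n)) = e" for e :: "nat \<Rightarrow> 'm"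
    by (rule ext) (simp split: nat.split)
  then have "d1 (\<lambda>e. sat (std S) (case_nat (e 0) (\<lambda>n. e (Suc n))) r \<phi>)" using Forall by simp
  then have "d1 (\<lambda>e. \<forall>a. sat (std S) (case_nat a e) r \<phi>)" by (rule d1_all)
  then show ?case by simp
qed simp

lemma valid_ACA0: "\<forall>\<phi>\<in>ACA0. valid_in (std S) \<phi>"
  unfolding ACA0_def valid_closures_iff
proof
  fix \<phi> assume "\<phi> \<in> basic_axioms \<union> {induction_for (V 0 \<^bold>\<in> 0)} \<union> {comprehension_for \<phi> | \<phi>. arithmetical \<phi>}"
  then consider "\<phi> \<in> basic_axioms" | "\<phi> = induction_for (V 0 \<^bold>\<in> 0)" | \<psi> where "\<phi> = comprehension_for \<psi>" "arithmetical \<psi>"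
    by auto
  then show "valid_in (std S) \<phi>"
  proof cases
    case 1
    then show ?thesis by (rule valid(1))
  next
    case 2
    have "sat (std S) e r (induction_for (V 0 \<^bold>\<in> 0))" if "range r \<subseteq> S" for e r
    proof -
      have "r 0 \<in> S" using that by auto
      then have "0 \<in> r 0 \<Longrightarrow> (\<And>x. x \<in> r 0 \<Longrightarrow> x + 1 \<in> r 0) \<Longrightarrow> x \<in> r 0" for x
        by (rule_tac d1_induct[of "\<lambda>x. x \<in> r 0"]) (simp_all add: d1_mem rt_var)
      then show ?thesis by (simp add: induction_for_def inst_def)
    qed
    then show ?thesis unfolding 2 valid_in_def by simp
  next
    case 3
    have "sat (std S) e r (comprehension_for \<psi>)" if "range r \<subseteq> S" for e r
    proof -
      have *: "(\<lambda>n. ev e' (case_nat (Inr 0) (\<lambda>n. Inl (e n)) n)) = case_nat (e' 0) e" for e'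
        by (rule ext) (simp split: nat.split)
      have "d1 (\<lambda>e'. sat (std S) (case_nat (e' 0) e) r \<psi>)"
        using d1_rename[OF arithmetical_d1[OF 3(2) that], of "case_nat (Inr 0) (\<lambda>n. Inl (e n))"] by (simp only: *)
      then have "{a. sat (std S) (case_nat a e) r \<psi>} \<in> S" by (rule comprehension)
      then show ?thesis by (auto simp: comprehension_for_def slift_def sat_subst intro!: bexI[of _ "{a. sat (std S) (case_nat a e) r \<psi>}"])
    qed
    then show ?thesis unfolding 3(1) valid_in_def by simp
  qed
qed

end

lemma arithmetical_Sigma1: "\<phi> \<in> Sigma1 \<Longrightarrow> arithmetical \<phi>"
proof -
  have "arithmetical \<theta>" if "\<theta> \<in> Delta0" for \<theta>
    using that by (induction rule: Delta0.induct) (simp_all add: Exists_def Conj_def Neg_def)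
  then show "\<phi> \<in> Sigma1 \<Longrightarrow> arithmetical \<phi>" by (auto simp: Sigma1_def Exists_def Neg_def)
qed

lemma (in rca) aca_if_valid:
  assumes "\<forall>\<phi>\<in>ACA0. valid_in (std S) \<phi>" shows "aca S"
proof
  fix P assume P: "sg (\<lambda>e. P (e 0))"
  obtain \<phi> \<tau> r where 1: "\<phi> \<in> Sigma1" "range r \<subseteq> sets_of (std S)"
    "\<And>e y. P y \<longleftrightarrow> sat (std S) (case_nat y (\<lambda>n. ev e (\<tau> n))) r \<phi>"
    by (rule definable_bind[of "std S" Sigma1 "\<lambda>e. P", OF P ren_closed_Sigma1]) (rule that; assumption)
  have "\<forall>\<phi>\<in>basic_axioms \<union> {induction_for (V 0 \<^bold>\<in> 0)} \<union> {comprehension_for \<phi> | \<phi>. arithmetical \<phi>}. valid_in (std S) \<phi>"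
    using assms unfolding ACA0_def valid_closures_iff .
  then have "valid_in (std S) (comprehension_for \<phi>)" using arithmetical_Sigma1[OF 1(1)] by auto
  then have "sat (std S) (\<lambda>n. ev (\<lambda>n. 0) (\<tau> n)) r (comprehension_for \<phi>)" using 1(2) unfolding valid_in_def by simp
  then have "\<exists>A\<in>S. \<forall>y. y \<in> A \<longleftrightarrow> P y"
    unfolding comprehension_for_def slift_def by (simp add: sat_subst 1(3)[of _ "\<lambda>n. 0"])
  then obtain A where "A \<in> S" "\<forall>y. y \<in> A \<longleftrightarrow> P y" by (rule bexE)
  moreover from this(2) have "A = {x. P x}" by auto
  ultimately show "{x. P x} \<in> S" by simp
qed

section \<open>The formulas of the Hindman principle in models\<close>

context rca
begin

definition graph :: "('m \<Rightarrow> 'm) \<Rightarrow> 'm set" where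
  "graph A = {z. \<exists>x. z = pr x (A x)}"

lemma mem_graph [simp]: "pr x y \<in> graph A \<longleftrightarrow> y = A x"
  by (auto simp: graph_def)

lemma graph_in_S: "graph A \<in> S \<longleftrightarrow> rt (\<lambda>e. A (e 0))"
  by (simp add: graph_def rt_fun_iff)

lemma tval_pair [simp]: "tval (std S) e (pair_code s t) = pr (tval (std S) e s) (tval (std S) e t)"
  by (simp add: pair_code_def pr_def)

lemma sat_Val [simp]: "sat (std S) e r (Val F s t) \<longleftrightarrow> pr (tval (std S) e s) (tval (std S) e t) \<in> r F"
  by (simp add: Val_def)

lemma sat_Fun_NN: "sat (std S) e r (Fun F NN NN) \<longleftrightarrow> (\<exists>A. r F = graph A)"
proof
  assume "sat (std S) e r (Fun F NN NN)"
  then have 1: "\<And>z. z \<in> r F \<Longrightarrow> \<exists>x y. z = pr x y" and 2: "\<And>x. \<exists>y. pr x y \<in> r F \<and> (\<forall>y'. pr x y' \<in> r F \<longrightarrow> y' = y)"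
    by (simp_all add: Fun_def numeral_2_eq_2)
  define A where "A x = (THE y. pr x y \<in> r F)" for x
  have A: "pr x y \<in> r F \<longleftrightarrow> y = A x" for x y
  proof -
    obtain w where w: "pr x w \<in> r F" "\<And>y'. pr x y' \<in> r F \<Longrightarrow> y' = w" using 2[of x] by auto
    have "A x = w" unfolding A_def by (rule the_equality) (rule w(1), rule w(2))
    then show ?thesis using w(1) w(2)[of y] by metis
  qed
  have "z \<in> r F \<longleftrightarrow> z \<in> graph A" for z
  proof
    assume "z \<in> r F"
    moreover from this obtain x y where "z = pr x y" using 1 by blast
    ultimately show "z \<in> graph A" using A by simp
  next
    assume "z \<in> graph A"
    then show "z \<in> r F" unfolding graph_def using A by auto
  qed
  then show "\<exists>A. r F = graph A" by blast
next
  assume "\<exists>A. r F = graph A"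
  then obtain A where A: "r F = graph A" ..
  have "\<exists>x y. z = pr x y" if "z \<in> graph A" for z using that by (auto simp: graph_def)
  then show "sat (std S) e r (Fun F NN NN)" by (simp add: Fun_def numeral_2_eq_2 A)
qed

text \<open>The set quantifier in the formula is harmless: the graph of \<open>pow2\<close> belongs
  to the model, and by induction every function obeying the recursion agrees with it.\<close>

lemma sat_Pow2 [simp]: "sat (std S) e r (Pow2 i p) \<longleftrightarrow> tval (std S) e p = pow2 (tval (std S) e i)"
proof
  assume "sat (std S) e r (Pow2 i p)"
  then obtain F where F: "F \<in> S" "\<exists>A. F = graph A" "pr 0 1 \<in> F" "\<forall>x y. pr x y \<in> F \<longrightarrow> pr (x + 1) (2 * y) \<in> F"
      "pr (tval (std S) e i) (tval (std S) e p) \<in> F"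
    unfolding Pow2_def by (simp add: sat_Fun_NN) blast
  then obtain A where FA: "F = graph A" by blast
  have A: "graph A \<in> S" "A 0 = 1" "\<And>x. A (x + 1) = 2 * A x" "A (tval (std S) e i) = tval (std S) e p"
    using F(1,3,4,5) unfolding FA by simp_all
  have "A n = pow2 n" for n
  proof (rule d1_induct[of "\<lambda>n. A n = pow2 n"])
    show "d1 (\<lambda>e. A (e 0) = pow2 (e 0))" by (intro d1_eq rt_pow2 rt_var graph_in_S[THEN iffD1, OF A(1)])
  qed (simp_all add: A pow2_add_1)
  then show "tval (std S) e p = pow2 (tval (std S) e i)" using A(4) by simp
next
  assume "tval (std S) e p = pow2 (tval (std S) e i)"
  moreover have "graph pow2 \<in> S" using graph_in_S rt_pow2[OF rt_var] by blast
  ultimately show "sat (std S) e r (Pow2 i p)"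
    unfolding Pow2_def sat_connectives by (intro bexI[of _ "graph pow2"]) (simp_all add: sat_Fun_NN pow2_add_1, blast)
qed

definition bit_of :: "'m \<Rightarrow> 'm \<Rightarrow> bool" where
  "bit_of m i \<longleftrightarrow> (\<exists>q r. m = pow2 i * (2 * q + 1) + r \<and> r < pow2 i)"

lemma sat_Exponent [simp]: "sat (std S) e r (Exponent i m) \<longleftrightarrow> bit_of (tval (std S) e m) (tval (std S) e i)"
  by (simp add: Exponent_def bit_of_def numeral_2_eq_2)

lemma sat_Le [simp]: "sat (std S) e r (s \<^bold>\<le> t) \<longleftrightarrow> tval (std S) e s \<le> tval (std S) e t"
  by (auto simp: Le_def)

definition sat_apart :: "'m set \<Rightarrow> bool" where
  "sat_apart H \<longleftrightarrow> (\<forall>x y. x \<in> H \<and> y \<in> H \<and> x < y \<longrightarrow> (\<exists>i j. (bit_of x i \<and> (\<forall>k. bit_of x k \<longrightarrow> k \<le> i)) \<and>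
     (bit_of y j \<and> (\<forall>k. bit_of y k \<longrightarrow> j \<le> k)) \<and> i < j))"

lemma sat_Apart [simp]: "sat (std S) e r (Apart X) \<longleftrightarrow> sat_apart (r X)"
  by (simp add: Apart_def sat_apart_def Mu_def Lambda_def numeral_2_eq_2 numeral_3_eq_3)

lemma even_or_odd: "\<exists>q. c = 2 * q \<or> c = 2 * q + (1 :: 'm)"
proof (rule sg_induct[of "\<lambda>c. \<exists>q. c = 2 * q \<or> c = 2 * q + 1"])
  show "sg (\<lambda>e. \<exists>q. e 0 = 2 * q \<or> e 0 = 2 * q + 1)" by (rule sg_ex, rule d1_sg, intro d1_rules)
  show "\<exists>q. (0 :: 'm) = 2 * q \<or> 0 = 2 * q + 1" by (rule exI[of _ 0]) simp
  fix c :: 'm assume "\<exists>q. c = 2 * q \<or> c = 2 * q + 1"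
  then obtain q where q: "c = 2 * q \<or> c = 2 * q + 1" ..
  show "\<exists>q. c + 1 = 2 * q \<or> c + 1 = 2 * q + 1"
  proof (cases "c = 2 * q")
    case False
    then have "c = 2 * q + 1" using q by simp
    then have "c + 1 = 2 * (q + 1)" unfolding emb_simps by (simp add: algebra_simps)
    then show ?thesis by blast
  qed auto
qed

text \<open>The separating power has the exponent \<open>j\<close> of the lowest digit of
  \<open>y\<close>. It exceeds \<open>x\<close> because the leading digit of \<open>x\<close> has an
  exponent below \<open>j\<close>, and it divides \<open>y\<close> because no digit of
  \<open>y\<close> has an exponent below \<open>j\<close>.\<close>

lemma apart_if_sat_apart:
  assumes "sat_apart H" "\<And>x. x \<in> H \<Longrightarrow> 0 < x" shows "apart H"
  unfolding apart_def
proof (intro ballI impI)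
  fix x y assume xy: "x \<in> H" "y \<in> H" "x < y"
  then obtain i j where ij: "\<And>k. bit_of x k \<Longrightarrow> k \<le> i" "\<And>k. bit_of y k \<Longrightarrow> j \<le> k" "i < j"
    using assms(1) unfolding sat_apart_def by blast
  obtain u r where u: "u \<in> Pw" "r < u" "x = u + r" using Pw_top[OF assms(2)[OF xy(1)]] by blast
  obtain k where k: "u = pow2 k" using u(1) unfolding Pw_def by blast
  have "x = pow2 k * (2 * 0 + 1) + r" using u(3) k by simp
  then have "bit_of x k" unfolding bit_of_def using u(2) k by blast
  then have "k < j" using ij(1,3) by (meson le_less_trans)
  then have "2 * u \<le> pow2 j" using pow2_less_dvd[of k j] dvd_le pow2_pos unfolding k by blast
  then have "x < pow2 j" using u(2,3) unfolding emb_simps by linarith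
  moreover have "pow2 j dvd y"
  proof -
    obtain p where p: "lowp y p" using lowp_exists[OF assms(2)[OF xy(2)]] by blast
    then obtain l c where l: "p = pow2 l" "y = p * c" unfolding lowp_def Pw_def by (auto elim!: dvdE)
    have "\<not> 2 * p dvd p * c" using p l(2) by (simp add: lowp_def)
    moreover have "2 * p dvd p * (2 * q)" for q
    proof -
      have "p * (2 * q) = 2 * p * q" by (simp add: ac_simps)
      then show ?thesis by simp
    qed
    ultimately obtain q where "c = 2 * q + 1" using even_or_odd[of c] by auto
    then have "y = pow2 l * (2 * q + 1) + 0" using l by simp
    then have "bit_of y l" unfolding bit_of_def using pow2_pos by blast
    then have "j \<le> l" by (rule ij(2))
    then have "pow2 j \<le> pow2 l" using pow2_less[of j l] by (cases "j = l") (auto simp: le_less)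
    then have "pow2 j dvd pow2 l" by (intro Pw_le_dvd) (auto simp: Pw_def)
    then show ?thesis unfolding l by (rule dvd_mult2)
  qed
  ultimately show "\<exists>q\<in>Pw. x < q \<and> q dvd y" unfolding Pw_def by blast
qed

lemma bit_of_pow2: "bit_of (pow2 n) i \<longleftrightarrow> i = n"
proof
  assume "bit_of (pow2 n) i"
  then obtain q r where qr: "pow2 n = pow2 i * (2 * q + 1) + r" "r < pow2 i" unfolding bit_of_def by blast
  have "\<not> i < n"
  proof
    assume "i < n"
    then have "2 * pow2 i dvd pow2 n" by (rule pow2_less_dvd)
    moreover have "pow2 n = 2 * pow2 i * q + (pow2 i + r)" using qr(1) by (simp add: algebra_simps)
    \<comment> \<open>The remainder \<open>pow2 i + r\<close> would be a positive multiple of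
      \<open>2 * pow2 i\<close> although it is smaller.\<close>
    ultimately have "2 * pow2 i dvd pow2 i + r" by (metis dvd_add_right_iff dvd_triv_left)
    moreover have "0 < pow2 i + r" using pow2_pos[of i] by (simp add: add_pos_nonneg)
    ultimately have "2 * pow2 i \<le> pow2 i + r" by (rule dvd_le)
    then show False using qr(2) unfolding emb_simps by linarith
  qed
  moreover have "\<not> n < i"
  proof
    assume "n < i"
    then have "pow2 n < pow2 i" by (rule pow2_less)
    moreover have "pow2 n = pow2 i + (pow2 i * (2 * q) + r)" using qr(1) by (simp add: algebra_simps)
    then have "pow2 i \<le> pow2 n" by simp
    ultimately show False by simp
  qed
  ultimately show "i = n" by simp
next
  assume "i = n"
  then have "pow2 n = pow2 i * (2 * 0 + 1) + 0" by simp
  then show "bit_of (pow2 n) i" unfolding bit_of_def using pow2_pos by blast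
qed

lemma sat_apart_powers: "H \<subseteq> Pw \<Longrightarrow> sat_apart H"
  unfolding sat_apart_def
proof (intro allI impI)
  fix x y assume H: "H \<subseteq> Pw" "x \<in> H \<and> y \<in> H \<and> x < y"
  then have "x \<in> range pow2" "y \<in> range pow2" unfolding Pw_def by auto
  then obtain i j where ij: "x = pow2 i" "y = pow2 j" by (elim rangeE)
  then have "i < j" using H(2) pow2_less_iff[of i j] by simp
  with ij show "\<exists>i j. (bit_of x i \<and> (\<forall>k. bit_of x k \<longrightarrow> k \<le> i)) \<and> (bit_of y j \<and> (\<forall>k. bit_of y k \<longrightarrow> j \<le> k)) \<and> i < j"
    by (intro exI[of _ i] exI[of _ j]) (simp add: bit_of_pow2)
qed

lemma sat_Sum [simp]: "sat (std S) e r (Sum H a x) \<longleftrightarrow> is_sum (r H) (tval (std S) e a) (tval (std S) e x)"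
proof -
  let ?a = "tval (std S) e a"
  have "sat (std S) e r (Sum H a x) \<longleftrightarrow> (\<exists>F\<in>S. \<exists>G\<in>S. (\<exists>A. F = graph A) \<and> (\<exists>B. G = graph B) \<and>
      (\<forall>n v. n < ?a \<and> pr n v \<in> F \<longrightarrow> v \<in> r H) \<and>
      (\<forall>n m v. n < ?a \<and> m < ?a \<and> pr n v \<in> F \<and> pr m v \<in> F \<longrightarrow> n = m) \<and> pr 0 0 \<in> G \<and>
      (\<forall>n v w. n < ?a \<and> pr n v \<in> G \<and> pr n w \<in> F \<longrightarrow> pr (n + 1) (v + w) \<in> G) \<and>
      pr ?a (tval (std S) e x) \<in> G)"
    unfolding Sum_def by (simp add: sat_Fun_NN numeral_2_eq_2)
  also have "\<dots> \<longleftrightarrow> (\<exists>A B. graph A \<in> S \<and> graph B \<in> S \<and>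
      (\<forall>n v. n < ?a \<and> pr n v \<in> graph A \<longrightarrow> v \<in> r H) \<and>
      (\<forall>n m v. n < ?a \<and> m < ?a \<and> pr n v \<in> graph A \<and> pr m v \<in> graph A \<longrightarrow> n = m) \<and> pr 0 0 \<in> graph B \<and>
      (\<forall>n v w. n < ?a \<and> pr n v \<in> graph B \<and> pr n w \<in> graph A \<longrightarrow> pr (n + 1) (v + w) \<in> graph B) \<and>
      pr ?a (tval (std S) e x) \<in> graph B)"
    by blast
  also have "\<dots> \<longleftrightarrow> is_sum (r H) ?a (tval (std S) e x)"
    unfolding is_sum_def graph_in_S mem_graph by (intro arg_cong[of _ _ Ex] ext) auto
  finally show ?thesis .
qed

text \<open>The semantic form of the principle: a colouring is a set of the model instead of a coded
  function, and the two colours become membership and non-membership.\<close>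

definition HT_in :: bool where
  "HT_in \<longleftrightarrow> (\<forall>C\<in>S. \<exists>H\<in>S. (\<forall>x\<in>H. 0 < x) \<and> (\<forall>n. \<exists>x\<in>H. n < x) \<and> sat_apart H \<and>
     (\<exists>a\<ge>3. (\<forall>x. is_sum H a x \<longrightarrow> x \<in> C) \<or> (\<forall>x. is_sum H a x \<longrightarrow> x \<notin> C)))"

end

section \<open>From the formal principle to its semantic form\<close>

context rca
begin

text \<open>The coded colourings are defined on positive numbers only, so sums must be positive to
  have a colour.\<close>

lemma sum_pos:
  assumes "is_sum H a x" "\<And>x. x \<in> H \<Longrightarrow> 0 < x" "3 \<le> a" shows "0 < x"
proof -
  obtain A B where AB: "\<forall>n<a. A n \<in> H" "\<forall>n<a. B (n + 1) = B n + A n" "B a = x"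
    using assms(1) unfolding is_sum_def by blast
  have "a \<noteq> 0" using assms(3) by auto
  then obtain b where b: "a = b + 1" using zero_or_suc[of a] by auto
  have "b < a" unfolding b by simp
  then have "x = B b + A b" "A b \<in> H" using AB b by auto
  then show ?thesis using assms(2)[of "A b"] by (simp add: add_nonneg_pos)
qed

lemma valid_HT_iff_sat: "valid_in (std S) HT_ex_ge3_apart \<longleftrightarrow>
  (\<forall>F\<in>S. (\<forall>z. z \<in> F \<longrightarrow> (\<exists>x y. z = pr x y \<and> 0 < x \<and> y < 2)) \<and>
     (\<forall>x. 0 < x \<longrightarrow> (\<exists>y. pr x y \<in> F \<and> (\<forall>y'. pr x y' \<in> F \<longrightarrow> y' = y))) \<longrightarrow>
     (\<exists>H\<in>S. (\<forall>x. x \<in> H \<longrightarrow> 0 < x) \<and> (\<forall>n. \<exists>x. x \<in> H \<and> n < x) \<and> sat_apart H \<and>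
       (\<exists>a. 3 \<le> a \<and> (\<exists>c. c < 2 \<and> (\<forall>x. is_sum H a x \<longrightarrow> pr x c \<in> F)))))"
proof -
  obtain A where "A \<in> S" using sets_nonempty by auto
  then have ex: "\<exists>r :: nat \<Rightarrow> 'm set. range r \<subseteq> S" by (intro exI[of _ "\<lambda>n. A"]) auto
  show ?thesis
    unfolding valid_in_def HT_ex_ge3_apart_def Fun_def Infinite_def
    using ex by (simp add: numeral_2_eq_2)
qed

lemma less_2_iff: "(c :: 'm) < 2 \<longleftrightarrow> c = 0 \<or> c = 1"
proof -
  have "c < 1 + 1 \<longleftrightarrow> c = 0 \<or> c = 1"
    unfolding less_add_1_iff le_less using less_add_1_iff[of c 0] by auto
  then show ?thesis by simp
qed

lemma valid_HT_iff: "valid_in (std S) HT_ex_ge3_apart \<longleftrightarrow> HT_in"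
proof
  assume v: "valid_in (std S) HT_ex_ge3_apart"
  show HT_in
    unfolding HT_in_def
  proof
    fix C assume C: "C \<in> S"
    define F where "F = {z. \<exists>x\<le>z. \<exists>y\<le>z. z = pr x y \<and> 0 < x \<and> y = (if x \<in> C then 1 else 0)}"
    have F: "pr x y \<in> F \<longleftrightarrow> 0 < x \<and> y = (if x \<in> C then 1 else 0)" for x y
      unfolding F_def by (auto simp: le_pr)
    have FS: "F \<in> S" unfolding F_def by (rule comprehension) (intro d1_rules rt_pr C)
    have F1: "\<exists>x y. z = pr x y \<and> 0 < x \<and> y < 2" if z: "z \<in> F" for z
    proof -
      obtain x y where xy: "z = pr x y" using z unfolding F_def by blast
      then have "0 < x" "y < 2" using z F[of x y] by (auto simp: less_2_iff)
      then show ?thesis using xy by blast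
    qed
    have F2: "\<exists>y. pr x y \<in> F \<and> (\<forall>y'. pr x y' \<in> F \<longrightarrow> y' = y)" if "0 < x" for x
      by (rule exI[of _ "if x \<in> C then 1 else 0"]) (simp only: F that simp_thms)
    have "\<exists>H\<in>S. (\<forall>x. x \<in> H \<longrightarrow> 0 < x) \<and> (\<forall>n. \<exists>x. x \<in> H \<and> n < x) \<and> sat_apart H \<and>
       (\<exists>a. 3 \<le> a \<and> (\<exists>c. c < 2 \<and> (\<forall>x. is_sum H a x \<longrightarrow> pr x c \<in> F)))"
      by (rule mp[OF bspec[OF v[unfolded valid_HT_iff_sat] FS]], intro conjI allI impI F1 F2)
    then obtain H a c where H: "H \<in> S" "\<forall>x. x \<in> H \<longrightarrow> 0 < x" "\<forall>n. \<exists>x. x \<in> H \<and> n < x" "sat_apart H"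
        "3 \<le> a" "\<forall>x. is_sum H a x \<longrightarrow> pr x c \<in> F"
      by (elim bexE conjE exE) (rule that; assumption)
    have "x \<in> C \<longleftrightarrow> c = 1" if "is_sum H a x" for x
    proof -
      have "c = (if x \<in> C then 1 else 0)" using H(6)[rule_format, OF that] F[of x c] by blast
      then show ?thesis by (cases "x \<in> C") auto
    qed
    then have "(\<forall>x. is_sum H a x \<longrightarrow> x \<in> C) \<or> (\<forall>x. is_sum H a x \<longrightarrow> x \<notin> C)"
      by (cases "c = 1") auto
    moreover have "\<forall>x\<in>H. 0 < x" "\<forall>n. \<exists>x\<in>H. n < x" using H(2,3) by (simp_all add: Bex_def)
    ultimately show "\<exists>H\<in>S. (\<forall>x\<in>H. 0 < x) \<and> (\<forall>n. \<exists>x\<in>H. n < x) \<and> sat_apart H \<and>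
       (\<exists>a\<ge>3. (\<forall>x. is_sum H a x \<longrightarrow> x \<in> C) \<or> (\<forall>x. is_sum H a x \<longrightarrow> x \<notin> C))"
      by (intro bexI[OF _ H(1)] conjI exI[of _ a] H(4,5))
  qed
next
  assume ht: HT_in
  show "valid_in (std S) HT_ex_ge3_apart"
    unfolding valid_HT_iff_sat
  proof (intro ballI impI, elim conjE)
    fix F assume F: "F \<in> S" and F1: "\<forall>z. z \<in> F \<longrightarrow> (\<exists>x y. z = pr x y \<and> 0 < x \<and> y < 2)"
      and F2: "\<forall>x. 0 < x \<longrightarrow> (\<exists>y. pr x y \<in> F \<and> (\<forall>y'. pr x y' \<in> F \<longrightarrow> y' = y))"
    have "{x. pr x 1 \<in> F} \<in> S" by (rule comprehension) (intro d1_rules rt_pr F)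
    from bspec[OF ht[unfolded HT_in_def] this]
    obtain H a where H: "H \<in> S" "\<forall>x\<in>H. 0 < x" "\<forall>n. \<exists>x\<in>H. n < x" "sat_apart H" "3 \<le> a"
        "(\<forall>x. is_sum H a x \<longrightarrow> pr x 1 \<in> F) \<or> (\<forall>x. is_sum H a x \<longrightarrow> pr x 1 \<notin> F)"
      unfolding mem_Collect_eq by (elim bexE conjE exE) (rule that; assumption)
    have "\<exists>c. c < 2 \<and> (\<forall>x. is_sum H a x \<longrightarrow> pr x c \<in> F)"
    proof (cases "\<forall>x. is_sum H a x \<longrightarrow> pr x 1 \<in> F")
      case True
      then show ?thesis by (intro exI[of _ 1]) simp
    next
      case False
      have "pr x 0 \<in> F" if x: "is_sum H a x" for x
      proof -
        have "0 < x" using sum_pos[OF x] H(2,5) by blast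
        then obtain y where y: "pr x y \<in> F" using F2 by blast
        then obtain x' y' where "pr x y = pr x' y'" "y' < 2" using F1 by blast
        then have "y < 2" by simp
        moreover have "y \<noteq> 1" using H(6) False x y by blast
        ultimately show ?thesis using y by (simp add: less_2_iff)
      qed
      then show ?thesis by (intro exI[of _ 0]) simp
    qed
    then have "3 \<le> a \<and> (\<exists>c. c < 2 \<and> (\<forall>x. is_sum H a x \<longrightarrow> pr x c \<in> F))" using H(5) by (rule conjI[rotated])
    then have ex: "\<exists>a. 3 \<le> a \<and> (\<exists>c. c < 2 \<and> (\<forall>x. is_sum H a x \<longrightarrow> pr x c \<in> F))" by (rule exI[of _ a])
    have "\<forall>x. x \<in> H \<longrightarrow> 0 < x" "\<forall>n. \<exists>x. x \<in> H \<and> n < x" using H(2,3) by (simp_all add: Bex_def)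
    then show "\<exists>H\<in>S. (\<forall>x. x \<in> H \<longrightarrow> 0 < x) \<and> (\<forall>n. \<exists>x. x \<in> H \<and> n < x) \<and> sat_apart H \<and>
       (\<exists>a. 3 \<le> a \<and> (\<exists>c. c < 2 \<and> (\<forall>x. is_sum H a x \<longrightarrow> pr x c \<in> F)))"
      by (intro bexI[OF _ H(1)] conjI H(4) ex)
  qed
qed

lemma aca_if_HT: "HT_in \<Longrightarrow> aca S"
proof
  fix P assume ht: HT_in and P: "sg (\<lambda>e. P (e 0))"
  obtain \<theta> where \<theta>: "\<theta> \<in> S" "\<And>k. P k \<longleftrightarrow> (\<exists>t. pr k t \<in> \<theta>)"
    by (rule sg_set_of_pairs[OF P]) (rule that; assumption)
  interpret enumeration S \<theta> by standard (rule \<theta>(1))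
  obtain H a where H: "H \<in> S" "\<forall>x\<in>H. 0 < x" "\<forall>n. \<exists>x\<in>H. n < x" "sat_apart H" "3 \<le> a"
      "(\<forall>x. is_sum H a x \<longrightarrow> x \<in> colouring) \<or> (\<forall>x. is_sum H a x \<longrightarrow> x \<notin> colouring)"
    using bspec[OF ht[unfolded HT_in_def] colouring_in_S] by (elim bexE conjE exE) (rule that; assumption)
  interpret apart_sums S \<theta> H a
    by standard (use H apart_if_sat_apart[OF H(4)] in auto)
  show "{x. P x} \<in> S" using range_in_S \<theta>(2) by simp
qed

lemma d1_const: "d1 (\<lambda>e. v)"
proof -
  have "d1 (\<lambda>e. (0 :: 'm) = 0)" "d1 (\<lambda>e. (0 :: 'm) = 1)" by (intro d1_eq rt_const)+
  then show ?thesis by (cases v) simp_all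
qed

text \<open>By comprehension the Delta1 predicate is given by a set of the model, and with that set
  as a parameter it becomes Delta0.\<close>

lemma d1_collection:
  assumes "d1 (\<lambda>e. Q (e 1) (e 0))" "\<And>x. x < a \<Longrightarrow> \<exists>y. Q x y"
  shows "\<exists>b. \<forall>x<a. \<exists>y<b. Q x y"
proof -
  have Q: "rt s \<Longrightarrow> rt t \<Longrightarrow> d1 (\<lambda>e. Q (s e) (t e))" for s t
    using d1_subst2[of t s "\<lambda>y x. Q x y"] assms(1) by simp
  let ?X = "{z. \<exists>x\<le>z. \<exists>y\<le>z. z = pr x y \<and> Q x y}"
  have X: "?X \<in> S" by (rule comprehension) (intro d1_rules rt_pr Q)
  have XQ: "pr x y \<in> ?X \<longleftrightarrow> Q x y" for x y by (auto simp: le_pr)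
  have "d0 (\<lambda>e. pr (e 1) (e 0) \<in> ?X)" unfolding pr_def by (intro d0_mem tdef_rules X[unfolded pr_def])
  then have "d0 (\<lambda>e. Q (e 1) (e 0))" unfolding XQ .
  then show ?thesis using assms(2) by (rule collection)
qed

end

section \<open>Ramsey's theorem for triples\<close>

definition unbounded :: "'m :: pnum set \<Rightarrow> bool" where
  "unbounded A \<longleftrightarrow> (\<forall>n. \<exists>x. x \<in> A \<and> n < x)"

context aca
begin

text \<open>The set \<open>\<sigma>\<close> is a path of colours followed by unboundedly many elements of A, and B consists of the
  elements that follow it longer than all smaller ones.\<close>

lemma cohesive:
  assumes R: "d1 (\<lambda>e. R (e 0) (e 1))" and A: "A \<in> S" "unbounded A"
  obtains B \<sigma> where "B \<in> S" "\<sigma> \<in> S" "B \<subseteq> A" "unbounded B"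
    "\<And>x. \<exists>b. \<forall>y\<in>B. b < y \<longrightarrow> (R x y \<longleftrightarrow> x \<in> \<sigma>)"
proof -
  have d_R: "rt s \<Longrightarrow> rt t \<Longrightarrow> d1 (\<lambda>e. R (s e) (t e))" for s t using d1_subst2[of s t R] R by simp
  let ?P = "\<lambda>X n. \<forall>b. \<exists>y. b < y \<and> y \<in> A \<and> (\<forall>x<n. R x y \<longleftrightarrow> x \<in> X) \<and> R n y"
  have "\<exists>\<sigma>\<in>S. \<forall>n. n \<in> \<sigma> \<longleftrightarrow> ?P \<sigma> n"
  proof (rule set_recursion)
    show "d1 (\<lambda>e. ?P (dec (e 0)) (e 1))"
      by (rule d1_all, rule d1_ex, intro d1_conj d1_all_less d1_iff d1_dec d_R d1_less d1_mem rt_var A(1))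
    show "?P X y \<longleftrightarrow> ?P Y y" if XY: "\<And>z. z < y \<Longrightarrow> z \<in> X \<longleftrightarrow> z \<in> Y" for X Y y
    proof -
      have "(\<forall>x<y. R x w \<longleftrightarrow> x \<in> X) \<longleftrightarrow> (\<forall>x<y. R x w \<longleftrightarrow> x \<in> Y)" for w
        by (intro all_cong1 imp_cong refl) (simp only: XY)
      then show ?thesis by (simp only:)
    qed
  qed
  then obtain \<sigma> where \<sigma>S: "\<sigma> \<in> S" and \<sigma>P: "\<forall>n. n \<in> \<sigma> \<longleftrightarrow> ?P \<sigma> n" by (rule bexE)
  note \<sigma> = \<sigma>S spec[OF \<sigma>P]
  define agree where "agree n y \<longleftrightarrow> (\<forall>x<n. R x y \<longleftrightarrow> x \<in> \<sigma>)" for n y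
  have d_agree: "rt s \<Longrightarrow> rt t \<Longrightarrow> d1 (\<lambda>e. agree (s e) (t e))" for s t
  proof -
    have "d1 (\<lambda>e. agree (e 0) (e 1))" unfolding agree_def by (intro d1_all_less d1_iff d_R d1_mem rt_var \<sigma>(1))
    then show "rt s \<Longrightarrow> rt t \<Longrightarrow> d1 (\<lambda>e. agree (s e) (t e))" using d1_subst2[of s t agree] by simp
  qed
  have agree_Suc: "agree (n + 1) y \<longleftrightarrow> agree n y \<and> (R n y \<longleftrightarrow> n \<in> \<sigma>)" for n y
    unfolding agree_def less_add_1_iff le_less by auto
  have inv: "\<forall>b. \<exists>y. b < y \<and> y \<in> A \<and> agree n y" for n
  proof (rule d1_induct[of "\<lambda>n. \<forall>b. \<exists>y. b < y \<and> y \<in> A \<and> agree n y"])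
    show "d1 (\<lambda>e. \<forall>b. \<exists>y. b < y \<and> y \<in> A \<and> agree (e 0) y)"
      by (rule d1_all, rule d1_ex, intro d1_conj d1_less d1_mem d_agree rt_var A(1))
    show "\<forall>b. \<exists>y. b < y \<and> y \<in> A \<and> agree 0 y" using A(2) unfolding unbounded_def agree_def by auto
    fix n assume IH: "\<forall>b. \<exists>y. b < y \<and> y \<in> A \<and> agree n y"
    show "\<forall>b. \<exists>y. b < y \<and> y \<in> A \<and> agree (n + 1) y"
    proof (cases "n \<in> \<sigma>")
      case True
      then have "\<forall>b. \<exists>y. b < y \<and> y \<in> A \<and> agree n y \<and> R n y" using \<sigma>(2)[of n] unfolding agree_def by (rule iffD1[rotated])
      then show ?thesis unfolding agree_Suc using True by blast
    next
      case False
      then obtain c where c: "\<And>y. c < y \<Longrightarrow> y \<in> A \<Longrightarrow> agree n y \<Longrightarrow> \<not> R n y"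
        using \<sigma>(2)[of n] unfolding agree_def by blast
      show ?thesis
      proof
        fix b
        obtain y where y: "b + c < y" "y \<in> A" "agree n y" using IH by blast
        have "b < y" "c < y" using y(1) by (auto intro: le_less_trans[rotated])
        then show "\<exists>y. b < y \<and> y \<in> A \<and> agree (n + 1) y" using y c False unfolding agree_Suc by blast
      qed
    qed
  qed
  define B where "B = {y. y \<in> A \<and> (\<exists>n\<le>y. agree n y \<and> (\<forall>y'<y. y' \<in> A \<longrightarrow> (\<forall>n'\<le>y'. agree n' y' \<longrightarrow> n' < n)))}"
  have "B \<in> S" unfolding B_def by (rule comprehension) (intro d1_rules d_agree A(1))
  moreover have "B \<subseteq> A" unfolding B_def by blast
  moreover have "unbounded B"
    unfolding unbounded_def
  proof
    fix b
    obtain y0 where y0: "b < y0" "y0 \<in> A" "agree (b + 1) y0" using inv by blast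
    have "b + 1 \<le> y0" using y0(1) by (simp add: less_iff_succ_less_eq)
    then have w: "y0 \<in> A \<and> (\<exists>n\<le>y0. b < n \<and> agree n y0)" using y0 by (intro conjI exI[of _ "b + 1"]) simp_all
    \<comment> \<open>The least element that follows the path for more than \<open>b\<close> steps
      follows it longer than all smaller ones, hence it lies in \<open>B\<close>.\<close>
    have "\<exists>y. (y \<in> A \<and> (\<exists>n\<le>y. b < n \<and> agree n y)) \<and> (\<forall>z<y. \<not> (z \<in> A \<and> (\<exists>n\<le>z. b < n \<and> agree n z)))"
      by (rule d1_least[of "\<lambda>y. y \<in> A \<and> (\<exists>n\<le>y. b < n \<and> agree n y)", OF _ w]) (intro d1_rules d_agree A(1))
    then obtain y n where y: "y \<in> A" "n \<le> y" "b < n" "agree n y"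
      and least: "\<And>z n. z < y \<Longrightarrow> z \<in> A \<Longrightarrow> n \<le> z \<Longrightarrow> agree n z \<Longrightarrow> \<not> b < n" by blast
    have "n' < n" if "y' < y" "y' \<in> A" "n' \<le> y'" "agree n' y'" for y' n'
      using least[OF that] y(3) by (simp add: not_less)
    then have "y \<in> B" unfolding B_def using y by blast
    moreover have "b < y" using y(2,3) by simp
    ultimately show "\<exists>x. x \<in> B \<and> b < x" by blast
  qed
  moreover have "\<exists>b. \<forall>y\<in>B. b < y \<longrightarrow> (R x y \<longleftrightarrow> x \<in> \<sigma>)" for x
  proof -
    \<comment> \<open>Every element of \<open>B\<close> beyond \<open>y0\<close> follows the path
      longer than \<open>y0\<close>, so it already has the prescribed colour at
      \<open>x\<close>.\<close>
    obtain y0 where y0: "x + 1 < y0" "y0 \<in> A" "agree (x + 1) y0" using inv by blast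
    have "R x y \<longleftrightarrow> x \<in> \<sigma>" if y: "y \<in> B" "y0 < y" for y
    proof -
      obtain n where n: "agree n y" "\<And>y' n'. y' < y \<Longrightarrow> y' \<in> A \<Longrightarrow> n' \<le> y' \<Longrightarrow> agree n' y' \<Longrightarrow> n' < n"
        using y(1) unfolding B_def by blast
      have "x + 1 < n" using n(2)[OF y(2) y0(2) less_imp_le[OF y0(1)] y0(3)] .
      then have "x < n" by (meson less_add_one less_trans)
      then show ?thesis using n(1) unfolding agree_def by blast
    qed
    then show ?thesis by blast
  qed
  ultimately show ?thesis using that \<sigma>(1) by blast
qed

text \<open>Pairing the first two arguments reduces the first limit to \<open>cohesive\<close>:
  \<open>D\<close> holds the limit colours of pairs and \<open>E\<close> the limit colours of
  points. The greedy set requires the colours of triples and the limit colours of pairs to be right,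
  so that it can always be continued.\<close>

lemma ramsey3:
  assumes K: "d1 (\<lambda>e. K (e 0) (e 1) (e 2))" and A: "A \<in> S" "unbounded A"
  obtains H v where "H \<in> S" "H \<subseteq> A" "unbounded H"
    "\<And>x y z. x \<in> H \<Longrightarrow> y \<in> H \<Longrightarrow> z \<in> H \<Longrightarrow> x < y \<Longrightarrow> y < z \<Longrightarrow> K x y z \<longleftrightarrow> v"
proof -
  have d_K: "rt a \<Longrightarrow> rt b \<Longrightarrow> rt c \<Longrightarrow> d1 (\<lambda>e. K (a e) (b e) (c e))" for a b c
    using d1_subst3[of a b c K] K by simp
  have "d1 (\<lambda>e. \<exists>i\<le>e 0. \<exists>j\<le>e 0. e 0 = pr i j \<and> K i j (e 1))" by (intro d1_rules rt_pr d_K)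
  then obtain B D where B: "B \<in> S" "D \<in> S" "B \<subseteq> A" "unbounded B"
    and D: "\<And>w. \<exists>b. \<forall>z\<in>B. b < z \<longrightarrow> ((\<exists>i\<le>w. \<exists>j\<le>w. w = pr i j \<and> K i j z) \<longleftrightarrow> w \<in> D)"
    by (rule cohesive[of "\<lambda>w z. \<exists>i\<le>w. \<exists>j\<le>w. w = pr i j \<and> K i j z", OF _ A]) (rule that; assumption)
  have D': "\<exists>b. \<forall>z\<in>B. b < z \<longrightarrow> (K i j z \<longleftrightarrow> pr i j \<in> D)" for i j
  proof -
    have "(\<exists>i'\<le>pr i j. \<exists>j'\<le>pr i j. pr i j = pr i' j' \<and> K i' j' z) \<longleftrightarrow> K i j z" for z by (auto simp: le_pr)
    then show ?thesis using D[of "pr i j"] by simp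
  qed
  have "d1 (\<lambda>e. pr (e 0) (e 1) \<in> D)" by (intro d1_rules rt_pr B(2))
  then obtain B' E where B': "B' \<in> S" "E \<in> S" "B' \<subseteq> B" "unbounded B'"
    and E: "\<And>i. \<exists>b. \<forall>j\<in>B'. b < j \<longrightarrow> (pr i j \<in> D \<longleftrightarrow> i \<in> E)"
    by (rule cohesive[of "\<lambda>i j. pr i j \<in> D", OF _ B(1,4)]) (rule that; assumption)
  \<comment> \<open>The limit colour shared by unboundedly many points; if membership in
    \<open>E\<close> fails to be such a colour, non-membership is one.\<close>
  define v where "v \<longleftrightarrow> unbounded {i. i \<in> B' \<and> i \<in> E}"
  define C where "C = {i. i \<in> B' \<and> (i \<in> E \<longleftrightarrow> v)}"
  have C: "C \<in> S" unfolding C_def by (rule comprehension) (intro d1_rules d1_const B'(1,2))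
  have C_inf: "unbounded C"
  proof (cases v)
    case True
    then show ?thesis unfolding C_def v_def by simp
  next
    case False
    then obtain c where c: "\<And>i. i \<in> B' \<Longrightarrow> c < i \<Longrightarrow> i \<notin> E" unfolding v_def unbounded_def by blast
    show ?thesis
      unfolding unbounded_def
    proof
      fix b
      obtain y where y: "y \<in> B'" "b + c < y" using B'(4) unfolding unbounded_def by blast
      have "b < y" "c < y" using y(2) by (auto intro: le_less_trans[rotated])
      then show "\<exists>x. x \<in> C \<and> b < x" using y(1) c False unfolding C_def by blast
    qed
  qed
  \<comment> \<open>A candidate \<open>y\<close> is accepted as soon as all pairs and triples it
    forms with accepted elements have the colour \<open>v\<close>. This refers to smaller members
    only, as set recursion demands.\<close>
  let ?P = "\<lambda>X y. y \<in> C \<and> (\<forall>i<y. i \<in> X \<longrightarrow> (pr i y \<in> D \<longleftrightarrow> v) \<and> (\<forall>j<y. i < j \<longrightarrow> j \<in> X \<longrightarrow> (K i j y \<longleftrightarrow> v)))"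
  have "\<exists>H\<in>S. \<forall>y. y \<in> H \<longleftrightarrow> ?P H y"
  proof (rule set_recursion)
    show "d1 (\<lambda>e. ?P (dec (e 0)) (e 1))" by (intro d1_rules d1_dec d1_const rt_pr d_K C B(2))
    show "?P X y \<longleftrightarrow> ?P Y y" if XY: "\<And>z. z < y \<Longrightarrow> z \<in> X \<longleftrightarrow> z \<in> Y" for X Y y
      by (intro conj_cong all_cong1 imp_cong refl XY) assumption+
  qed
  then obtain H where HS: "H \<in> S" and HP: "\<forall>y. y \<in> H \<longleftrightarrow> ?P H y" by (rule bexE)
  note H = HS spec[OF HP]
  have HC: "H \<subseteq> C" using H(2) by blast
  have HB: "C \<subseteq> B'" unfolding C_def by blast
  have "unbounded H"
  proof (rule ccontr)
    \<comment> \<open>A bounded \<open>H\<close> imposes boundedly many requirements, each of which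
      is met from some point on. Collection makes these points uniform, and a later element of
      \<open>C\<close> would then be accepted beyond the bound.\<close>
    assume "\<not> unbounded H"
    then obtain b where b: "\<And>y. y \<in> H \<Longrightarrow> y < b + 1" unfolding unbounded_def less_add_1_iff by (meson not_less)
    have "\<exists>n. i \<in> H \<longrightarrow> (\<forall>y. y \<in> C \<longrightarrow> n \<le> y \<longrightarrow> (pr i y \<in> D \<longleftrightarrow> v))" for i
    proof (cases "i \<in> H")
      case True
      then have "i \<in> E \<longleftrightarrow> v" using HC unfolding C_def by blast
      moreover obtain n where "\<forall>j\<in>B'. n < j \<longrightarrow> (pr i j \<in> D \<longleftrightarrow> i \<in> E)" using E by blast
      ultimately have "\<forall>y. y \<in> C \<longrightarrow> n + 1 \<le> y \<longrightarrow> (pr i y \<in> D \<longleftrightarrow> v)"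
        using HB unfolding less_iff_succ_less_eq[symmetric] by blast
      then show ?thesis by blast
    qed blast
    then have "\<exists>c. \<forall>i<b + 1. \<exists>n<c. i \<in> H \<longrightarrow> (\<forall>y. y \<in> C \<longrightarrow> n \<le> y \<longrightarrow> (pr i y \<in> D \<longleftrightarrow> v))"
      by (intro d1_collection d1_imp d1_all d1_iff d1_const d1_mem d1_le rt_pr rt_var H(1) C B(2))
    then obtain c where "\<forall>i<b + 1. \<exists>n<c. i \<in> H \<longrightarrow> (\<forall>y. y \<in> C \<longrightarrow> n \<le> y \<longrightarrow> (pr i y \<in> D \<longleftrightarrow> v))" ..
    then have c: "pr i y \<in> D \<longleftrightarrow> v" if "i \<in> H" "y \<in> C" "c \<le> y" for i y
      using b that by (meson less_imp_le order_trans)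
    have inner: "\<exists>n. i \<in> H \<longrightarrow> (\<forall>j<b + 1. i < j \<longrightarrow> j \<in> H \<longrightarrow> (\<forall>y. y \<in> C \<longrightarrow> n \<le> y \<longrightarrow> (K i j y \<longleftrightarrow> v)))" for i
    proof -
      have "\<exists>n. i \<in> H \<longrightarrow> i < j \<longrightarrow> j \<in> H \<longrightarrow> (\<forall>y. y \<in> C \<longrightarrow> n \<le> y \<longrightarrow> (K i j y \<longleftrightarrow> v))" for j
      proof (cases "i \<in> H \<and> j \<in> H \<and> i < j")
        case True
        then have "pr i j \<in> D \<longleftrightarrow> v" using H(2)[of j] by blast
        moreover obtain n where "\<forall>z\<in>B. n < z \<longrightarrow> (K i j z \<longleftrightarrow> pr i j \<in> D)" using D' by blast
        ultimately have "\<forall>y. y \<in> C \<longrightarrow> n + 1 \<le> y \<longrightarrow> (K i j y \<longleftrightarrow> v)"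
          using HB B'(3) unfolding less_iff_succ_less_eq[symmetric] by blast
        then show ?thesis by blast
      qed blast
      then have "\<exists>c. \<forall>j<b + 1. \<exists>n<c. i \<in> H \<longrightarrow> i < j \<longrightarrow> j \<in> H \<longrightarrow> (\<forall>y. y \<in> C \<longrightarrow> n \<le> y \<longrightarrow> (K i j y \<longleftrightarrow> v))"
        by (intro d1_collection d1_imp d1_all d1_iff d1_const d1_mem d1_le d1_less d_K rt_var rt_const H(1) C)
      then obtain c' where "\<forall>j<b + 1. \<exists>n<c'. i \<in> H \<longrightarrow> i < j \<longrightarrow> j \<in> H \<longrightarrow> (\<forall>y. y \<in> C \<longrightarrow> n \<le> y \<longrightarrow> (K i j y \<longleftrightarrow> v))" ..
      then have "i \<in> H \<longrightarrow> (\<forall>j<b + 1. i < j \<longrightarrow> j \<in> H \<longrightarrow> (\<forall>y. y \<in> C \<longrightarrow> c' \<le> y \<longrightarrow> (K i j y \<longleftrightarrow> v)))"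
        by (meson less_imp_le order_trans)
      then show ?thesis ..
    qed
    then have "\<exists>c. \<forall>i<b + 1. \<exists>n<c. i \<in> H \<longrightarrow>
        (\<forall>j<b + 1. i < j \<longrightarrow> j \<in> H \<longrightarrow> (\<forall>y. y \<in> C \<longrightarrow> n \<le> y \<longrightarrow> (K i j y \<longleftrightarrow> v)))"
      by (intro d1_collection d1_imp d1_all_less d1_all d1_iff d1_const d1_mem d1_le d1_less d_K rt_var rt_const H(1) C)
    then obtain c' where "\<forall>i<b + 1. \<exists>n<c'. i \<in> H \<longrightarrow>
        (\<forall>j<b + 1. i < j \<longrightarrow> j \<in> H \<longrightarrow> (\<forall>y. y \<in> C \<longrightarrow> n \<le> y \<longrightarrow> (K i j y \<longleftrightarrow> v)))" ..
    then have c': "K i j y \<longleftrightarrow> v" if "i \<in> H" "j \<in> H" "i < j" "y \<in> C" "c' \<le> y" for i j y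
      using b that by (meson less_imp_le order_trans)
    obtain y where y: "y \<in> C" "b + 1 + c + c' < y" using C_inf unfolding unbounded_def by blast
    have "c \<le> y" "c' \<le> y" "b + 1 \<le> y"
      using y(2) emb_nonneg[of b] emb_nonneg[of c] emb_nonneg[of c'] unfolding emb_simps by linarith+
    then have "y \<in> H" using H(2)[of y] y(1) c c' by blast
    then show False using b[of y] \<open>b + 1 \<le> y\<close> by (simp add: not_less[symmetric])
  qed
  moreover have "K x y z \<longleftrightarrow> v" if "x \<in> H" "y \<in> H" "z \<in> H" "x < y" "y < z" for x y z
    using H(2)[of z] that by (meson less_trans)
  moreover have "H \<subseteq> A" using HC HB B'(3) B(3) by blast
  ultimately show ?thesis using that H(1) by blast
qed

text \<open>Distinct powers of two are apart, so homogeneity for sums of three is all that is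
  needed. As 3 is standard, the recursion for the sum simply unrolls.\<close>

lemma HT_in: HT_in
  unfolding HT_in_def
proof
  fix C assume C: "C \<in> S"
  have "d1 (\<lambda>e. e 0 + e 1 + e 2 \<in> C)" by (intro d1_rules C)
  moreover have "unbounded Pw" unfolding unbounded_def Pw_def using less_pow2 by blast
  ultimately obtain H v where H: "H \<in> S" "H \<subseteq> Pw" "unbounded H"
    and hom: "\<And>x y z. x \<in> H \<Longrightarrow> y \<in> H \<Longrightarrow> z \<in> H \<Longrightarrow> x < y \<Longrightarrow> y < z \<Longrightarrow> x + y + z \<in> C \<longleftrightarrow> v"
    by (rule ramsey3[of "\<lambda>x y z. x + y + z \<in> C", OF _ Pw_in_S]) (rule that; assumption)
  \<comment> \<open>The summands of a sum are listed in any order, whereas the colouring of triples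
    is controlled for increasing ones only.\<close>
  have hom': "x + y + z \<in> C \<longleftrightarrow> v" if xyz: "x \<in> H" "y \<in> H" "z \<in> H" "x \<noteq> y" "y \<noteq> z" "x \<noteq> z" for x y z
  proof -
    consider "x < y" "y < z" | "x < z" "z < y" | "y < x" "x < z" | "y < z" "z < x" | "z < x" "x < y" | "z < y" "y < x"
      using xyz(4-6) by (metis linorder_neqE)
    then show ?thesis
    proof cases
      case 1
      then have "x + y + z \<in> C \<longleftrightarrow> v" using hom[of x y z] xyz(1-3) by blast
      then show ?thesis by (simp add: ac_simps)
    next
      case 2
      then have "x + z + y \<in> C \<longleftrightarrow> v" using hom[of x z y] xyz(1-3) by blast
      then show ?thesis by (simp add: ac_simps)
    next
      case 3
      then have "y + x + z \<in> C \<longleftrightarrow> v" using hom[of y x z] xyz(1-3) by blast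
      then show ?thesis by (simp add: ac_simps)
    next
      case 4
      then have "y + z + x \<in> C \<longleftrightarrow> v" using hom[of y z x] xyz(1-3) by blast
      then show ?thesis by (simp add: ac_simps)
    next
      case 5
      then have "z + x + y \<in> C \<longleftrightarrow> v" using hom[of z x y] xyz(1-3) by blast
      then show ?thesis by (simp add: ac_simps)
    next
      case 6
      then have "z + y + x \<in> C \<longleftrightarrow> v" using hom[of z y x] xyz(1-3) by blast
      then show ?thesis by (simp add: ac_simps)
    qed
  qed
  have "x \<in> C \<longleftrightarrow> v" if sum: "is_sum H 3 x" for x
  proof -
    obtain A B :: "'m \<Rightarrow> 'm" where AB: "\<forall>n<3. A n \<in> H" "\<forall>n<3. \<forall>m<3. A n = A m \<longrightarrow> n = m" "B 0 = 0"
        "\<forall>n<3. B (n + 1) = B n + A n" "B 3 = x"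
      using sum unfolding is_sum_def by blast
    have "B 1 = A 0" "B 2 = B 1 + A 1" "B 3 = B 2 + A 2"
      using AB(4)[rule_format, of 0] AB(4)[rule_format, of 1] AB(4)[rule_format, of 2] AB(3) by simp_all
    then have "x = A 0 + A 1 + A 2" using AB(5) by simp
    moreover have "A 0 \<in> H" "A 1 \<in> H" "A 2 \<in> H"
      using AB(1)[rule_format, of 0] AB(1)[rule_format, of 1] AB(1)[rule_format, of 2] by simp_all
    moreover have "A 0 \<noteq> A 1" "A 1 \<noteq> A 2" "A 0 \<noteq> A 2"
      using AB(2)[rule_format, of 0 1] AB(2)[rule_format, of 1 2] AB(2)[rule_format, of 0 2] by auto
    ultimately show ?thesis using hom' by simp
  qed
  then have "(\<forall>x. is_sum H 3 x \<longrightarrow> x \<in> C) \<or> (\<forall>x. is_sum H 3 x \<longrightarrow> x \<notin> C)" by (cases v) auto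
  moreover have "\<forall>x\<in>H. 0 < x" using H(2) Pw_pos by blast
  moreover have "\<forall>n. \<exists>x\<in>H. n < x" using H(3) unfolding unbounded_def by blast
  ultimately show "\<exists>H\<in>S. (\<forall>x\<in>H. 0 < x) \<and> (\<forall>n. \<exists>x\<in>H. n < x) \<and> sat_apart H \<and>
      (\<exists>a\<ge>3. (\<forall>x. is_sum H a x \<longrightarrow> x \<in> C) \<or> (\<forall>x. is_sum H a x \<longrightarrow> x \<notin> C))"
    by (intro bexI[OF _ H(1)] conjI exI[of _ 3] sat_apart_powers[OF H(2)] order_refl)
qed

end

text \<open>If there were a countermodel on \<open>mnum\<close>, then \<open>chosen\<close> would be
  one; by the class instance it is a standard structure, to which both implications apply.\<close>

lemma no_countermodel: "\<not> countermodel (M :: mnum struct)"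
proof
  assume "countermodel M"
  then have c: "countermodel (std (sets_of chosen))" using chosen(2) chosen_std by simp
  interpret rca "sets_of chosen" by standard (use c in \<open>simp add: countermodel_def\<close>)
  have "valid_in (std (sets_of chosen)) HT_ex_ge3_apart \<longleftrightarrow> (\<forall>\<phi>\<in>ACA0. valid_in (std (sets_of chosen)) \<phi>)"
    using valid_HT_iff aca_if_HT aca.valid_ACA0 aca_if_valid aca.HT_in by blast
  then show False using c by (simp add: countermodel_def)
qed

text \<open>Supplies the two premises of completeness that make the term model infinite.\<close>

lemma RCA0_successor:
  assumes "RCA0 \<subseteq> T"
  shows "T \<turnstile> \<^bold>\<not>(t \<^bold>+ \<^bold>1 \<^bold>= \<^bold>0)" "T \<turnstile> (s \<^bold>+ \<^bold>1 \<^bold>= t \<^bold>+ \<^bold>1 \<^bold>\<longrightarrow> s \<^bold>= t)"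
proof -
  let ?\<phi> = "\<^bold>\<not>(V 0 \<^bold>+ \<^bold>1 \<^bold>= \<^bold>0)" and ?\<psi> = "V 0 \<^bold>+ \<^bold>1 \<^bold>= V 1 \<^bold>+ \<^bold>1 \<^bold>\<longrightarrow> V 0 \<^bold>= V 1"
  have cl: "(Forall ^^ k) \<chi> \<in> T" if "\<chi> \<in> basic_axioms" "free_below k 0 \<chi>" for \<chi> k
  proof -
    have "(SForall ^^ 0) ((Forall ^^ k) \<chi>) \<in> RCA0" unfolding RCA0_def closures_def using that by blast
    then show ?thesis using assms by auto
  qed
  have "(Forall ^^ 1) ?\<phi> \<in> T" by (rule cl) (simp_all add: basic_axioms_def Neg_def)
  then have "T \<turnstile> \<^bold>\<forall>?\<phi>" by (intro Assm) simp
  from AllE[OF this, of t] show "T \<turnstile> \<^bold>\<not>(t \<^bold>+ \<^bold>1 \<^bold>= \<^bold>0)" by (simp add: inst_def)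
  have "(Forall ^^ 2) ?\<psi> \<in> T" by (rule cl) (simp_all add: basic_axioms_def)
  then have "T \<turnstile> \<^bold>\<forall>\<^bold>\<forall>?\<psi>" by (intro Assm) (simp add: numeral_2_eq_2)
  \<comment> \<open>The outer quantifier binds index 1, so \<open>t\<close> is put in first.\<close>
  from AllE[OF AllE[OF this, of t, unfolded inst_def subst_Forall], of s]
  show "T \<turnstile> (s \<^bold>+ \<^bold>1 \<^bold>= t \<^bold>+ \<^bold>1 \<^bold>\<longrightarrow> s \<^bold>= t)"
    by (simp add: inst_def lift_tm_def subst_tm_subst_tm)
qed

lemma HT_sentence: "free_below 0 0 HT_ex_ge3_apart"
  by (simp add: HT_ex_ge3_apart_def Fun_def Val_def pair_code_def Infinite_def Apart_def Mu_def Lambda_def Le_def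
      Exponent_def Pow2_def Sum_def Conj_def Disj_def Neg_def Exists_def SExists_def lift_tm_def)

theorem theorem5:
  shows "equivalent_over RCA0 {HT_ex_ge3_apart} ACA0"
  unfolding equivalent_over_def
proof (intro conjI ballI)
  have RCA0: "free_below 0 0 \<phi>" if "\<phi> \<in> RCA0" for \<phi> using that unfolding RCA0_def by (rule free_below_closures)
  have ACA0: "free_below 0 0 \<phi>" if "\<phi> \<in> ACA0" for \<phi> using that unfolding ACA0_def by (rule free_below_closures)
  fix \<phi> assume \<phi>: "\<phi> \<in> ACA0"
  show "RCA0 \<union> {HT_ex_ge3_apart} \<turnstile> \<phi>"
  \<comment> \<open>It remains to consider models with domain \<open>mnum\<close>; there the absence
    of a countermodel carries validity from one principle to the other.\<close>
  proof (rule completeness[OF _ _ _ _ _ infinite_mnum])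
    fix M :: "mnum struct"
    assume M: "sets_of M \<noteq> {}" "\<And>\<psi>. \<psi> \<in> RCA0 \<union> {HT_ex_ge3_apart} \<Longrightarrow> valid_in M \<psi>"
    then have "rca0_model M" by (simp add: rca0_model_def)
    then show "valid_in M \<phi>" using no_countermodel[of M] M(2)[of HT_ex_ge3_apart] \<phi> unfolding countermodel_def by simp
  next
    show "RCA0 \<union> {HT_ex_ge3_apart} \<turnstile> \<^bold>\<not>(t \<^bold>+ \<^bold>1 \<^bold>= \<^bold>0)" for t by (rule RCA0_successor) (rule Un_upper1)
    show "RCA0 \<union> {HT_ex_ge3_apart} \<turnstile> (s \<^bold>+ \<^bold>1 \<^bold>= t \<^bold>+ \<^bold>1 \<^bold>\<longrightarrow> s \<^bold>= t)" for s t by (rule RCA0_successor) (rule Un_upper1)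
  qed (use RCA0 HT_sentence ACA0[OF \<phi>] in auto)
next
  have RCA0: "free_below 0 0 \<phi>" if "\<phi> \<in> RCA0" for \<phi> using that unfolding RCA0_def by (rule free_below_closures)
  have ACA0: "free_below 0 0 \<phi>" if "\<phi> \<in> ACA0" for \<phi> using that unfolding ACA0_def by (rule free_below_closures)
  fix \<phi> assume "\<phi> \<in> {HT_ex_ge3_apart}"
  then have \<phi>: "\<phi> = HT_ex_ge3_apart" by simp
  show "RCA0 \<union> ACA0 \<turnstile> \<phi>"
    unfolding \<phi>
  proof (rule completeness[OF _ _ _ _ _ infinite_mnum])
    fix M :: "mnum struct"
    assume M: "sets_of M \<noteq> {}" "\<And>\<psi>. \<psi> \<in> RCA0 \<union> ACA0 \<Longrightarrow> valid_in M \<psi>"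
    then have "rca0_model M" by (simp add: rca0_model_def)
    then show "valid_in M HT_ex_ge3_apart" using no_countermodel[of M] M(2) unfolding countermodel_def by simp
  next
    show "RCA0 \<union> ACA0 \<turnstile> \<^bold>\<not>(t \<^bold>+ \<^bold>1 \<^bold>= \<^bold>0)" for t by (rule RCA0_successor) (rule Un_upper1)
    show "RCA0 \<union> ACA0 \<turnstile> (s \<^bold>+ \<^bold>1 \<^bold>= t \<^bold>+ \<^bold>1 \<^bold>\<longrightarrow> s \<^bold>= t)" for s t by (rule RCA0_successor) (rule Un_upper1)
  qed (use RCA0 HT_sentence ACA0 in auto)
qed

end
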